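(* For every even $n$ and every odd $k\ge 3$, there exist plane maps $B$ and $A_1,\dots,A_n$ such that: (1) the underlying graphs of $A_1,\dots,A_n$ are graph cores, and $B$ is a (map) core; (2) each of $B,A_1,\dots,A_n$ has underlying graph of odd girth $2k+1$; (3) there is a homomorphism $A_i\to B$ for each $i\in\{1,\dots,n\}$, and there is no homomorphism $A_i\to A_j$ for distinct $i,j\in\{1,\dots,n\}$.
   Context: Maps. A map $M$ is a tuple $(C,\alpha_0,\alpha_1,\alpha_2)$, where $C$ is a finite set (of crosses) and $\alpha_0,\alpha_1,\alpha_2$ are fixed-point-free involutions of $C$ with $\alpha_0\alpha_2=\alpha_2\alpha_0$, together with a finite number (possibly zero) of isolated vertices. Vertex permutation $\tau=\alpha_1\alpha_2$, face permutation $\phi=\alpha_1\alpha_0$. Vertices: orbits of $\langle\alpha_1,\alpha_2\rangle$ on $C$ plus isolated vertices; edges: orbits of $\langle\alpha_0,\alpha_2\rangle$; faces: orbits of $\langle\alpha_0,\alpha_1\rangle$ plus one face per isolated vertex; connected components: orbits of $\langle\alpha_0,\alpha_1,\alpha_2\rangle$ plus one per isolated vertex. The underlying graph (a multigraph) has the vertices and edges of the map with the induced incidence. A cross is incident with the vertex/face containing it; two crosses are coincident with a face if they lie in the same cycle of $\phi$; the degree of a face is the number of crosses in one of its $\phi$-cycles. $\mathbf v,\mathbf e,\mathbf f,\mathbf k$ count vertices, edges, faces, components. For connected $M$ with an edge, $\mathbf o(M)$ is the number of orbits of $\langle\alpha_0\alpha_2,\alpha_1\alpha_2\rangle$ on $C$;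 an edgeless connected map has $\mathbf o=2$; in general $\mathbf o$ is the minimum over components. $\boldsymbol\chi=\mathbf v-\mathbf e+\mathbf f$, $\mathbf{eg}=2\mathbf k-\boldsymbol\chi$, $\mathbf g=\mathbf{eg}/\mathbf o$, signed genus $\mathbf{sg}=(2\mathbf o-3)\mathbf g$; a map is plane if $\mathbf{eg}=0$. Isomorphism: same number of isolated vertices and a bijection of crosses commuting with each $\alpha_i$. Deletion and submaps: $M\backslash e$ removes the four crosses of edge $e$, restricts $\alpha_0,\alpha_2$, and chooses $\alpha_1$ so that the new vertex permutation cycles are those of $\tau$ with the crosses of $e$ removed (a vertex all of whose crosses lie in $e$ becomes isolated). Deleting a vertex deletes its incident edges then removes it. A submap is obtained by deleting some edges then some vertices; proper if different from $M$. Vertex gluing: for distinct crosses $a,b$ let $M^{(a\,b)}=(C,\alpha_0,(a\;b)\alpha_1(a\;b),\alpha_2)$. If $a,b$ are incident with distinct vertices and either are coincident with a common face or lie in different components, passing to $M^{(a\,b)}$ is a vertex gluing; deleting an isolated vertex when gluing it to another vertex is also a vertex gluing. Duplicate edges: two distinct edges incident with a common face of degree two; gluing them replaces $M$ by (a map isomorphic to) $M\backslash f$ for one of them $f$. Homomorphisms and cores: for $\mathbf{sg}(M)=\mathbf{sg}(M')$, a homomorphism $M\to M'$ exists if $M'$ has a submap isomorphic to a map obtained from $M$ by a finite sequence of vertex gluings and duplicate edge gluings. A map is a (map) core if there is no homomorphism from it to a proper submap of itself. A graph core is a finite graph with no graph homomorphism to a proper subgraph of itself. The odd girth of a graph is the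 length of its shortest odd cycle. *)

theory Defs
  imports Complex_Main "HOL-Combinatorics.Orbits" "HOL-Library.Extended_Nat"
begin

section \<open>Multigraphs\<close>

text \<open>An edge has a set of one (loop) or two end vertices.\<close>

record ('v, 'e) mgraph =
  gverts :: "'v set"
  gedges :: "'e set"
  gends :: "'e \<Rightarrow> 'v set"

definition finite_graph :: "('v, 'e) mgraph \<Rightarrow> bool" where
  "finite_graph G \<longleftrightarrow> finite (gverts G) \<and> finite (gedges G) \<and>
     (\<forall>e\<in>gedges G. gends G e \<subseteq> gverts G \<and> card (gends G e) \<in> {1, 2})"

definition subgraph :: "('v, 'e) mgraph \<Rightarrow> ('v, 'e) mgraph \<Rightarrow> bool" where
  "subgraph H G \<longleftrightarrow> gverts H \<subseteq> gverts G \<and> gedges H \<subseteq> gedges G \<and>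
     (\<forall>e\<in>gedges H. gends H e = gends G e \<and> gends H e \<subseteq> gverts H)"

definition proper_subgraph :: "('v, 'e) mgraph \<Rightarrow> ('v, 'e) mgraph \<Rightarrow> bool" where
  "proper_subgraph H G \<longleftrightarrow>
     subgraph H G \<and> (gverts H \<noteq> gverts G \<or> gedges H \<noteq> gedges G)"

definition graph_hom :: "('v, 'e) mgraph \<Rightarrow> ('w, 'd) mgraph \<Rightarrow> bool" where
  "graph_hom G H \<longleftrightarrow> (\<exists>fv fe. fv ` gverts G \<subseteq> gverts H \<and> fe ` gedges G \<subseteq> gedges H \<and>
     (\<forall>e\<in>gedges G. gends H (fe e) = fv ` gends G e))"

definition graph_core :: "('v, 'e) mgraph \<Rightarrow> bool" where
  "graph_core G \<longleftrightarrow> finite_graph G \<and> \<not> (\<exists>H. proper_subgraph H G \<and> graph_hom G H)"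

text \<open>Loops are cycles of length 1, pairs of parallel edges are cycles of length 2.\<close>

definition cycle_in :: "('v, 'e) mgraph \<Rightarrow> 'v list \<Rightarrow> 'e list \<Rightarrow> bool" where
  "cycle_in G vs es \<longleftrightarrow> es \<noteq> [] \<and> length vs = length es \<and> distinct vs \<and> distinct es \<and>
     set vs \<subseteq> gverts G \<and> set es \<subseteq> gedges G \<and>
     (\<forall>i<length es. gends G (es ! i) = {vs ! i, vs ! (Suc i mod length es)})"

text \<open>The value is \<open>\<infinity>\<close> if there is no odd cycle.\<close>

definition odd_girth :: "('v, 'e) mgraph \<Rightarrow> enat" where
  "odd_girth G = Inf {enat (length es) | vs es. cycle_in G vs es \<and> odd (length es)}"


section \<open>Maps\<close>

text \<open>
  \<open>gorbit F x\<close> closes \<open>x\<close> under the functions in \<open>F\<close> only, not under their inverses. For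
  permutations of a finite set this is the orbit of the group generated by \<open>F\<close>.
\<close>

definition gorbit :: "('a \<Rightarrow> 'a) set \<Rightarrow> 'a \<Rightarrow> 'a set" where
  "gorbit F x = {y. (x, y) \<in> {(u, f u) | u f. f \<in> F}\<^sup>*}"

definition gorbits :: "('a \<Rightarrow> 'a) set \<Rightarrow> 'a set \<Rightarrow> 'a set set" where
  "gorbits F C = gorbit F ` C"

text \<open>Isolated vertices have no identity, they are only counted.\<close>

record 'a cmap =
  crosses :: "'a set"
  al0 :: "'a \<Rightarrow> 'a"
  al1 :: "'a \<Rightarrow> 'a"
  al2 :: "'a \<Rightarrow> 'a"
  isol :: nat

definition fpf_involution_on :: "'a set \<Rightarrow> ('a \<Rightarrow> 'a) \<Rightarrow> bool" where
  "fpf_involution_on C f \<longleftrightarrow> f permutes C \<and> (\<forall>x\<in>C. f x \<noteq> x \<and> f (f x) = x)"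

text \<open>
  The involutions are the identity outside the set of crosses, so equality of maps is equality
  of records. The last condition says that every edge consists of four crosses.
\<close>

definition is_map :: "'a cmap \<Rightarrow> bool" where
  "is_map M \<longleftrightarrow> finite (crosses M) \<and>
     fpf_involution_on (crosses M) (al0 M) \<and>
     fpf_involution_on (crosses M) (al1 M) \<and>
     fpf_involution_on (crosses M) (al2 M) \<and>
     al0 M \<circ> al2 M = al2 M \<circ> al0 M \<and>
     (\<forall>x\<in>crosses M. al0 M x \<noteq> al2 M x)"

definition vperm :: "'a cmap \<Rightarrow> 'a \<Rightarrow> 'a" where
  "vperm M = al1 M \<circ> al2 M"

definition fperm :: "'a cmap \<Rightarrow> 'a \<Rightarrow> 'a" where
  "fperm M = al1 M \<circ> al0 M"

text \<open>Without the contributions of the isolated vertices:\<close>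

definition vertex_orbits :: "'a cmap \<Rightarrow> 'a set set" where
  "vertex_orbits M = gorbits {al1 M, al2 M} (crosses M)"

definition edge_orbits :: "'a cmap \<Rightarrow> 'a set set" where
  "edge_orbits M = gorbits {al0 M, al2 M} (crosses M)"

definition face_orbits :: "'a cmap \<Rightarrow> 'a set set" where
  "face_orbits M = gorbits {al0 M, al1 M} (crosses M)"

definition comp_orbits :: "'a cmap \<Rightarrow> 'a set set" where
  "comp_orbits M = gorbits {al0 M, al1 M, al2 M} (crosses M)"

definition num_verts :: "'a cmap \<Rightarrow> nat" where
  "num_verts M = card (vertex_orbits M) + isol M"

definition num_edges :: "'a cmap \<Rightarrow> nat" where
  "num_edges M = card (edge_orbits M)"

definition num_faces :: "'a cmap \<Rightarrow> nat" where
  "num_faces M = card (face_orbits M) + isol M"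

definition num_comps :: "'a cmap \<Rightarrow> nat" where
  "num_comps M = card (comp_orbits M) + isol M"

text \<open>
  The number of orientation classes, minimised over the components. Edgeless components count 2,
  and so does the empty map (whose genus is 0 in any case).
\<close>

definition num_orient :: "'a cmap \<Rightarrow> nat" where
  "num_orient M = (if crosses M = {} then 2 else
     Min ((\<lambda>K. card (gorbits {al0 M \<circ> al2 M, al1 M \<circ> al2 M} K)) ` comp_orbits M
          \<union> (if isol M = 0 then {} else {2})))"

definition euler_char :: "'a cmap \<Rightarrow> int" where
  "euler_char M = int (num_verts M) - int (num_edges M) + int (num_faces M)"

definition euler_genus :: "'a cmap \<Rightarrow> int" where
  "euler_genus M = 2 * int (num_comps M) - euler_char M"

definition genus :: "'a cmap \<Rightarrow> rat" where
  "genus M = of_int (euler_genus M) / of_nat (num_orient M)"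

definition signed_genus :: "'a cmap \<Rightarrow> rat" where
  "signed_genus M = (2 * of_nat (num_orient M) - 3) * genus M"

definition plane :: "'a cmap \<Rightarrow> bool" where
  "plane M \<longleftrightarrow> euler_genus M = 0"

definition underlying_graph :: "'a cmap \<Rightarrow> ('a set + nat, 'a set) mgraph" where
  "underlying_graph M =
     \<lparr>gverts = Inl ` vertex_orbits M \<union> Inr ` {..<isol M},
      gedges = edge_orbits M,
      gends = (\<lambda>e. Inl ` {v \<in> vertex_orbits M. v \<inter> e \<noteq> {}})\<rparr>"

definition map_iso :: "'a cmap \<Rightarrow> 'b cmap \<Rightarrow> bool" where
  "map_iso M N \<longleftrightarrow> isol M = isol N \<and>
     (\<exists>h. bij_betw h (crosses M) (crosses N) \<and>
        (\<forall>x\<in>crosses M. h (al0 M x) = al0 N (h x) \<and> h (al1 M x) = al1 N (h x) \<and>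
                         h (al2 M x) = al2 N (h x)))"


section \<open>Deletion and submaps\<close>

text \<open>The permutation whose cycles are those of \<open>f\<close> with the elements of \<open>D\<close> removed:\<close>

definition skip :: "('a \<Rightarrow> 'a) \<Rightarrow> 'a set \<Rightarrow> 'a \<Rightarrow> 'a" where
  "skip f D x = (f ^^ (LEAST n. 0 < n \<and> (f ^^ n) x \<notin> D)) x"

text \<open>
  Since \<open>vperm M = al1 M \<circ> al2 M\<close> and \<open>al2 M\<close> is an involution, the new \<open>al1\<close> is the new vertex
  permutation composed with the new \<open>al2\<close>.
\<close>

definition delete_edges :: "'a cmap \<Rightarrow> 'a set set \<Rightarrow> 'a cmap" where
  "delete_edges M E = (let D = \<Union>E; C = crosses M - D in
     \<lparr>crosses = C,
      al0 = (\<lambda>x. if x \<in> C then al0 M x else x),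
      al1 = (\<lambda>x. if x \<in> C then skip (vperm M) D (al2 M x) else x),
      al2 = (\<lambda>x. if x \<in> C then al2 M x else x),
      isol = isol M + card {v \<in> vertex_orbits M. v \<subseteq> D}\<rparr>)"

abbreviation delete_edge :: "'a cmap \<Rightarrow> 'a set \<Rightarrow> 'a cmap" where
  "delete_edge M e \<equiv> delete_edges M {e}"

text \<open>In the second rule \<open>v\<close> itself is among the newly isolated vertices.\<close>

inductive vertex_deletion :: "'a cmap \<Rightarrow> 'a cmap \<Rightarrow> bool" where
  isolated: "0 < isol M \<Longrightarrow> vertex_deletion M (M\<lparr>isol := isol M - 1\<rparr>)"
| nonisolated: "v \<in> vertex_orbits M \<Longrightarrow> N = delete_edges M {e \<in> edge_orbits M. e \<inter> v \<noteq> {}} \<Longrightarrow>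
    vertex_deletion M (N\<lparr>isol := isol N - 1\<rparr>)"

definition submap :: "'a cmap \<Rightarrow> 'a cmap \<Rightarrow> bool" where
  "submap N M \<longleftrightarrow> (\<exists>E\<subseteq>edge_orbits M. vertex_deletion\<^sup>*\<^sup>* (delete_edges M E) N)"

definition proper_submap :: "'a cmap \<Rightarrow> 'a cmap \<Rightarrow> bool" where
  "proper_submap N M \<longleftrightarrow> submap N M \<and> N \<noteq> M"


section \<open>Gluing, homomorphisms and cores\<close>

definition conj_al1 :: "'a cmap \<Rightarrow> 'a \<Rightarrow> 'a \<Rightarrow> 'a cmap" where
  "conj_al1 M a b = M\<lparr>al1 := transpose a b \<circ> al1 M \<circ> transpose a b\<rparr>"

definition coincident :: "'a cmap \<Rightarrow> 'a \<Rightarrow> 'a \<Rightarrow> bool" where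
  "coincident M a b \<longleftrightarrow> b \<in> orbit (fperm M) a"

definition same_component :: "'a cmap \<Rightarrow> 'a \<Rightarrow> 'a \<Rightarrow> bool" where
  "same_component M a b \<longleftrightarrow> b \<in> gorbit {al0 M, al1 M, al2 M} a"

inductive vertex_gluing :: "'a cmap \<Rightarrow> 'a cmap \<Rightarrow> bool" where
  crosses: "a \<in> crosses M \<Longrightarrow> b \<in> crosses M \<Longrightarrow>
    gorbit {al1 M, al2 M} a \<noteq> gorbit {al1 M, al2 M} b \<Longrightarrow>
    coincident M a b \<or> \<not> same_component M a b \<Longrightarrow>
    vertex_gluing M (conj_al1 M a b)"
| isolated: "0 < isol M \<Longrightarrow> 2 \<le> num_verts M \<Longrightarrow> vertex_gluing M (M\<lparr>isol := isol M - 1\<rparr>)"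

text \<open>All cycles of \<open>fperm M\<close> in a face have the same length.\<close>

definition face_degree :: "'a cmap \<Rightarrow> 'a set \<Rightarrow> nat" where
  "face_degree M F = card (orbit (fperm M) (SOME x. x \<in> F))"

definition duplicate_edges :: "'a cmap \<Rightarrow> 'a set \<Rightarrow> 'a set \<Rightarrow> bool" where
  "duplicate_edges M e f \<longleftrightarrow> e \<in> edge_orbits M \<and> f \<in> edge_orbits M \<and> e \<noteq> f \<and>
     (\<exists>F\<in>face_orbits M. face_degree M F = 2 \<and> e \<inter> F \<noteq> {} \<and> f \<inter> F \<noteq> {})"

inductive gluing :: "'a cmap \<Rightarrow> 'a cmap \<Rightarrow> bool" where
  vertex: "vertex_gluing M N \<Longrightarrow> gluing M N"
| duplicate: "duplicate_edges M e f \<Longrightarrow> gluing M (delete_edge M f)"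

definition map_hom :: "'a cmap \<Rightarrow> 'b cmap \<Rightarrow> bool" where
  "map_hom M M' \<longleftrightarrow> signed_genus M = signed_genus M' \<and>
     (\<exists>N S. gluing\<^sup>*\<^sup>* M N \<and> submap S M' \<and> map_iso N S)"

definition map_core :: "'a cmap \<Rightarrow> bool" where
  "map_core M \<longleftrightarrow> is_map M \<and> \<not> (\<exists>N. proper_submap N M \<and> map_hom M N)"

end

theory Submission
  imports Defs "HOL-Library.Countable"
begin

text \<open>
  Maps may be disconnected, so \<open>B\<close> can be the disjoint union of the \<open>A\<^sub>i\<close> and one more map of the same
  kind, provided that the underlying graphs of all these maps are cores without homomorphisms between
  them: gluings, isomorphisms and submaps all induce homomorphisms of the underlying graphs.

  Let \<open>m = 2 k - 1\<close>. A block is a subdivision of \<open>K\<^sub>4\<close> in which two opposite edges are replaced by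
  paths of length \<open>m\<close>; all of its faces have length \<open>m + 2 = 2 k + 1\<close>. Label its edges by \<open>m + 2\<close>
  labels so that opposite edges of \<open>K\<^sub>4\<close> carry the same labels. Every odd closed walk contains every
  label, so it has length at least \<open>m + 2\<close>, and with equality it contains every label exactly once. A
  homomorphism therefore maps the quadrilateral of a block to the quadrilateral of a block, and the two
  long paths to the long paths. Each map is a chain of blocks connected by bridges, from a vertex at
  distance two from an end of the first long path of one block to the starting point of that of the
  next. This orients the chain, so a homomorphism between chains of equal length fixes the index of
  every block, and it must respect from which of the two ends the bridge has distance two. In the
  chain \<open>t\<close> this is the far end for the block \<open>t\<close> and the near end for all other blocks.
\<close>

section \<open>Orbits of involutions\<close>

text \<open>Every odd closed walk meets the label \<open>l\<close> because the edges with any other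
  label form a bipartite graph: \<open>colour\<close> two-colours it, and
  \<open>block_parity\<close> continues the colouring across the bridges. An odd closed walk of
  length \<open>m + 2\<close> spends all its edges on the labels up to \<open>m + 1\<close>, so it
  has no room for a bridge. The distance two keeps bridges from being folded into blocks. A bridge
  leads from distance two of an end of a path to an end of a path, and for \<open>m >= 5\<close>,
  that is \<open>k >= 3\<close>, no edge of a block joins images of such vertices. Hence a bridge
  goes to a bridge, passed in the same direction. Chains have the blocks 0 to N + 1, with t between
  1 and N. So the block \<open>t\<close> has an incoming bridge, which fixes the direction of its
  first path, and an outgoing bridge, whose position then reveals \<open>t\<close>. The second path
  of a block can still be reversed. Homomorphisms are therefore shown to be injective, not to be the
  identity; for a finite simple graph this suffices for being a core. Planarity is proved by
  counting: explicit rotations give the orbits, hence the Euler characteristic.\<close>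

definition involutions_on :: "('a \<Rightarrow> 'a) set \<Rightarrow> 'a set \<Rightarrow> bool" where
  "involutions_on F C \<longleftrightarrow> (\<forall>f\<in>F. \<forall>x\<in>C. f x \<in> C \<and> f (f x) = x)"

lemma gorbit_self: "x \<in> gorbit F x"
  by (simp add: gorbit_def)

lemma gorbit_step: "y \<in> gorbit F x \<Longrightarrow> f \<in> F \<Longrightarrow> f y \<in> gorbit F x"
  unfolding gorbit_def by (auto intro: rtrancl_into_rtrancl)

lemma gorbit_induct [consumes 1, case_names self step]:
  assumes "y \<in> gorbit F x" and "P x"
    and "\<And>y f. y \<in> gorbit F x \<Longrightarrow> P y \<Longrightarrow> f \<in> F \<Longrightarrow> P (f y)"
  shows "P y"
proof -
  have "(x, y) \<in> {(u, f u) | u f. f \<in> F}\<^sup>*" using assms(1) by (simp add: gorbit_def)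
  then show ?thesis
    by (induction rule: rtrancl_induct) (use assms(2,3) in \<open>auto simp: gorbit_def\<close>)
qed

lemma gorbit_trans: "y \<in> gorbit F x \<Longrightarrow> z \<in> gorbit F y \<Longrightarrow> z \<in> gorbit F x"
  unfolding gorbit_def by auto

lemma gorbit_subset:
  assumes "involutions_on F C" "x \<in> C" shows "gorbit F x \<subseteq> C"
proof
  fix y assume "y \<in> gorbit F x" then show "y \<in> C"
    by (induction rule: gorbit_induct) (use assms in \<open>auto simp: involutions_on_def\<close>)
qed

lemma gorbit_sym:
  assumes F: "involutions_on F C" and "x \<in> C" and "y \<in> gorbit F x"
  shows "x \<in> gorbit F y"
  using assms(3)
proof (induction rule: gorbit_induct)
  case self then show ?case by (rule gorbit_self)
next
  case (step y f)
  have "y \<in> C" using gorbit_subset[OF F \<open>x \<in> C\<close>] step(1) by auto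
  then have "f (f y) = y" using F step by (auto simp: involutions_on_def)
  then have "y \<in> gorbit F (f y)" using gorbit_step[OF gorbit_self \<open>f \<in> F\<close>, of "f y"] by simp
  then show ?case using step.IH gorbit_trans by metis
qed

lemma gorbit_eq:
  assumes "involutions_on F C" and "x \<in> C" and "y \<in> gorbit F x"
  shows "gorbit F y = gorbit F x"
  using gorbit_sym[OF assms] gorbit_trans assms(3) by fast

text \<open>Two elements with the same label reach the same representative \<open>d\<close>, so the
  fibres of an invariant labelling are exactly the orbits. Counting faces or components thus reduces
  to exhibiting a labelling and paths to representatives.\<close>

lemma gorbits_by_label:
  assumes F: "involutions_on F C"
    and inv: "\<And>f x. f \<in> F \<Longrightarrow> x \<in> C \<Longrightarrow> L (f x) = L x"
    and conn: "\<And>x. x \<in> C \<Longrightarrow> d (L x) \<in> gorbit F x"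
  shows "x \<in> C \<Longrightarrow> gorbit F x = {y \<in> C. L y = L x}"
    and "card (gorbits F C) = card (L ` C)"
proof -
  have *: "gorbit F x = {y \<in> C. L y = L x}" if "x \<in> C" for x
  proof -
    have "y \<in> C \<and> L y = L x" if "y \<in> gorbit F x" for y
      using that
      by (induction rule: gorbit_induct)
        (use F inv \<open>x \<in> C\<close> in \<open>auto simp: involutions_on_def\<close>)
    moreover have "y \<in> gorbit F x" if "y \<in> C" "L y = L x" for y
      using conn[OF \<open>x \<in> C\<close>] conn[OF \<open>y \<in> C\<close>] gorbit_sym[OF F \<open>y \<in> C\<close>] gorbit_trans that
      by metis
    ultimately show ?thesis by auto
  qed
  show "x \<in> C \<Longrightarrow> gorbit F x = {y \<in> C. L y = L x}" by (rule *)
  have "gorbits F C = (\<lambda>l. {y \<in> C. L y = l}) ` L ` C"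
    by (auto simp: gorbits_def * image_image)
  moreover have "inj_on (\<lambda>l. {y \<in> C. L y = l}) (L ` C)"
    by (rule inj_onI) blast
  ultimately show "card (gorbits F C) = card (L ` C)" by (simp add: card_image)
qed

section \<open>Maps and homomorphisms of their underlying graphs\<close>

lemma fpf_involutionI:
  assumes "\<And>x. x \<in> C \<Longrightarrow> f x \<in> C \<and> f (f x) = x \<and> f x \<noteq> x" and "\<And>x. x \<notin> C \<Longrightarrow> f x = x"
  shows "fpf_involution_on C f"
proof -
  have "f (f x) = x" for x using assms by (cases "x \<in> C") auto
  then have "bij f" by (metis bij_betw_byWitness subset_UNIV)
  then have "f permutes C" using assms(2) by (auto simp: permutes_def bij_iff)
  then show ?thesis using assms(1) by (auto simp: fpf_involution_on_def)
qed

lemma fpf_involutionD: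
  assumes "fpf_involution_on C f"
  shows "x \<in> C \<Longrightarrow> f x \<in> C" "f (f x) = x" "x \<in> C \<Longrightarrow> f x \<noteq> x" "x \<notin> C \<Longrightarrow> f x = x"
proof -
  have p: "f permutes C" using assms by (simp add: fpf_involution_on_def)
  show "x \<in> C \<Longrightarrow> f x \<in> C" using p by (simp add: permutes_in_image)
  show "x \<notin> C \<Longrightarrow> f x = x" using p by (rule permutes_not_in)
  then show "f (f x) = x" using assms by (cases "x \<in> C") (auto simp: fpf_involution_on_def)
  show "x \<in> C \<Longrightarrow> f x \<noteq> x" using assms by (simp add: fpf_involution_on_def)
qed

context
  fixes M :: "'a cmap"
  assumes M: "is_map M"
begin

lemma map_finite: "finite (crosses M)"
  using M by (simp add: is_map_def)

lemma map_fpf: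
  "fpf_involution_on (crosses M) (al0 M)" "fpf_involution_on (crosses M) (al1 M)"
  "fpf_involution_on (crosses M) (al2 M)"
  using M by (simp_all add: is_map_def)

lemma map_in:
  "x \<in> crosses M \<Longrightarrow> al0 M x \<in> crosses M" "x \<in> crosses M \<Longrightarrow> al1 M x \<in> crosses M"
  "x \<in> crosses M \<Longrightarrow> al2 M x \<in> crosses M"
  using fpf_involutionD(1)[OF map_fpf(1)] fpf_involutionD(1)[OF map_fpf(2)]
    fpf_involutionD(1)[OF map_fpf(3)] by blast+

lemma map_invol: "al0 M (al0 M x) = x" "al1 M (al1 M x) = x" "al2 M (al2 M x) = x"
  using fpf_involutionD(2)[OF map_fpf(1)] fpf_involutionD(2)[OF map_fpf(2)]
    fpf_involutionD(2)[OF map_fpf(3)] by blast+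

lemma map_fpf_neq:
  "x \<in> crosses M \<Longrightarrow> al0 M x \<noteq> x" "x \<in> crosses M \<Longrightarrow> al1 M x \<noteq> x" "x \<in> crosses M \<Longrightarrow> al2 M x \<noteq> x"
  using fpf_involutionD(3)[OF map_fpf(1)] fpf_involutionD(3)[OF map_fpf(2)]
    fpf_involutionD(3)[OF map_fpf(3)] by blast+

lemma map_outside:
  "x \<notin> crosses M \<Longrightarrow> al0 M x = x" "x \<notin> crosses M \<Longrightarrow> al1 M x = x" "x \<notin> crosses M \<Longrightarrow> al2 M x = x"
  using fpf_involutionD(4)[OF map_fpf(1)] fpf_involutionD(4)[OF map_fpf(2)]
    fpf_involutionD(4)[OF map_fpf(3)] by blast+

lemma map_comm: "al0 M (al2 M x) = al2 M (al0 M x)"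
  using M by (metis comp_apply is_map_def)

lemma map_al0_al2_neq: "x \<in> crosses M \<Longrightarrow> al0 M x \<noteq> al2 M x"
  using M by (simp add: is_map_def)

lemma map_involutions:
  "F \<subseteq> {al0 M, al1 M, al2 M} \<Longrightarrow> involutions_on F (crosses M)"
  using map_in map_invol by (auto simp: involutions_on_def)

lemma vorb_subset: "x \<in> crosses M \<Longrightarrow> gorbit {al1 M, al2 M} x \<subseteq> crosses M"
  by (rule gorbit_subset[OF map_involutions]) auto

lemma vorb_eq:
  "x \<in> crosses M \<Longrightarrow> y \<in> gorbit {al1 M, al2 M} x \<Longrightarrow>
    gorbit {al1 M, al2 M} y = gorbit {al1 M, al2 M} x"
  by (rule gorbit_eq[OF map_involutions]) auto

lemma edge_orbit_eq:
  assumes "x \<in> crosses M"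
  shows "gorbit {al0 M, al2 M} x = {x, al0 M x, al2 M x, al0 M (al2 M x)}" (is "?O = ?R")
proof
  have "y \<in> ?R" if "y \<in> ?O" for y
    using that by (induction rule: gorbit_induct) (auto simp: map_invol map_comm)
  then show "?O \<subseteq> ?R" by blast
  show "?R \<subseteq> ?O"
    using gorbit_self[of x "{al0 M, al2 M}"]
    by (auto intro: gorbit_step)
qed

lemma edge_orbit_cases:
  assumes "e \<in> edge_orbits M" "y \<in> e"
  shows "y \<in> crosses M" "e = {y, al0 M y, al2 M y, al0 M (al2 M y)}"
proof -
  obtain x where x: "x \<in> crosses M" "e = gorbit {al0 M, al2 M} x"
    using assms(1) by (auto simp: edge_orbits_def gorbits_def)
  have inv: "involutions_on {al0 M, al2 M} (crosses M)" by (rule map_involutions) auto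
  show y: "y \<in> crosses M" using gorbit_subset[OF inv x(1)] x assms by auto
  show "e = {y, al0 M y, al2 M y, al0 M (al2 M y)}"
    using gorbit_eq[OF inv x(1)] x assms edge_orbit_eq[OF y] by auto
qed

lemma edge_orbitI: "x \<in> crosses M \<Longrightarrow> {x, al0 M x, al2 M x, al0 M (al2 M x)} \<in> edge_orbits M"
  using edge_orbit_eq by (auto simp: edge_orbits_def gorbits_def)

lemma gends_underlying:
  assumes "e \<in> edge_orbits M"
  shows "gends (underlying_graph M) e = (\<lambda>y. Inl (gorbit {al1 M, al2 M} y)) ` e"
proof -
  have "{v \<in> vertex_orbits M. v \<inter> e \<noteq> {}} = gorbit {al1 M, al2 M} ` e" (is "?L = ?R")
  proof
    show "?L \<subseteq> ?R"
    proof
      fix v assume "v \<in> ?L"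
      then obtain x y where "x \<in> crosses M" "v = gorbit {al1 M, al2 M} x" "y \<in> v" "y \<in> e"
        by (auto simp: vertex_orbits_def gorbits_def)
      then show "v \<in> ?R" using vorb_eq by blast
    qed
    show "?R \<subseteq> ?L"
      using edge_orbit_cases(1)[OF assms] gorbit_self
      by (fastforce simp: vertex_orbits_def gorbits_def)
  qed
  then show ?thesis by (simp add: underlying_graph_def image_image)
qed

end

text \<open>An edge is determined by \<open>al0\<close> and \<open>al2\<close>, while for vertices
  it is enough that \<open>h\<close> does not tear a vertex orbit apart; hence the weak condition on
  \<open>al1\<close>. It covers gluings, deletions and isomorphisms alike. \<open>nonempty\<close>
  provides a target for isolated vertices. The edge map is exposed because the core argument must
  know which edges are hit.\<close>

lemma underlying_graph_hom:
  fixes M :: "'a cmap" and N :: "'b cmap"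
  assumes M: "is_map M" and N: "is_map N"
    and h_in: "\<And>x. x \<in> crosses M \<Longrightarrow> h x \<in> crosses N"
    and h0: "\<And>x. x \<in> crosses M \<Longrightarrow> h (al0 M x) = al0 N (h x)"
    and h2: "\<And>x. x \<in> crosses M \<Longrightarrow> h (al2 M x) = al2 N (h x)"
    and h1: "\<And>x. x \<in> crosses M \<Longrightarrow> h (al1 M x) \<in> gorbit {al1 N, al2 N} (h x)"
    and nonempty: "isol M = 0 \<or> gverts (underlying_graph N) \<noteq> {}"
  obtains fv :: "'a set + nat \<Rightarrow> 'b set + nat"
    where "fv ` gverts (underlying_graph M) \<subseteq> gverts (underlying_graph N)"
    and "\<And>e. e \<in> edge_orbits M \<Longrightarrow> h ` e \<in> edge_orbits N"
    and "\<And>e. e \<in> edge_orbits M \<Longrightarrow>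
      gends (underlying_graph N) (h ` e) = fv ` gends (underlying_graph M) e"
proof -
  let ?vM = "gorbit {al1 M, al2 M}" and ?vN = "gorbit {al1 N, al2 N}"
  obtain w where w: "isol M = 0 \<or> w \<in> gverts (underlying_graph N)" using nonempty by auto
  define fv :: "'a set + nat \<Rightarrow> 'b set + nat"
    where "fv = case_sum (\<lambda>v. Inl (?vN (h (SOME x. x \<in> v)))) (\<lambda>_. w)"
  have orb: "?vN (h y) = ?vN (h x)" if "x \<in> crosses M" "y \<in> ?vM x" for x y
    using that(2)
  proof (induction rule: gorbit_induct)
    case (step y f)
    have y: "y \<in> crosses M" using vorb_subset[OF M that(1)] step by auto
    have "h (f y) \<in> ?vN (h y)"
      using step h1[OF y] h2[OF y] gorbit_step[OF gorbit_self, of "al2 N"] by auto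
    then show ?case using vorb_eq[OF N h_in[OF y]] step.IH by metis
  qed simp
  have fvI: "fv (Inl (?vM x)) = Inl (?vN (h x))" if "x \<in> crosses M" for x
    using orb[OF that] someI[of "\<lambda>y. y \<in> ?vM x", OF gorbit_self] by (simp add: fv_def)
  show thesis
  proof
    show "fv ` gverts (underlying_graph M) \<subseteq> gverts (underlying_graph N)"
      using fvI h_in w
      by (auto simp: underlying_graph_def vertex_orbits_def gorbits_def)
        (auto simp: fv_def)
  next
    fix e assume e: "e \<in> edge_orbits M"
    then obtain x where x: "x \<in> crosses M" "e = {x, al0 M x, al2 M x, al0 M (al2 M x)}"
      by (auto simp: edge_orbits_def gorbits_def edge_orbit_eq[OF M])
    then have "h ` e = {h x, al0 N (h x), al2 N (h x), al0 N (al2 N (h x))}"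
      using h0 h2 map_in[OF M] by auto
    then show he: "h ` e \<in> edge_orbits N" using edge_orbitI[OF N h_in[OF x(1)]] by simp
    have "gends (underlying_graph N) (h ` e) = (\<lambda>y. Inl (?vN (h y))) ` e"
      using gends_underlying[OF N he] by (simp add: image_image)
    also have "\<dots> = fv ` gends (underlying_graph M) e"
      using fvI edge_orbit_cases(1)[OF M e] by (simp add: gends_underlying[OF M e] image_image)
    finally show "gends (underlying_graph N) (h ` e) = fv ` gends (underlying_graph M) e" .
  qed
qed

lemma graph_hom_underlying:
  fixes M :: "'a cmap" and N :: "'b cmap"
  assumes "is_map M" "is_map N"
    and "\<And>x. x \<in> crosses M \<Longrightarrow> h x \<in> crosses N"
    and "\<And>x. x \<in> crosses M \<Longrightarrow> h (al0 M x) = al0 N (h x)"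
    and "\<And>x. x \<in> crosses M \<Longrightarrow> h (al2 M x) = al2 N (h x)"
    and "\<And>x. x \<in> crosses M \<Longrightarrow> h (al1 M x) \<in> gorbit {al1 N, al2 N} (h x)"
    and "isol M = 0 \<or> gverts (underlying_graph N) \<noteq> {}"
  shows "graph_hom (underlying_graph M) (underlying_graph N)"
proof -
  obtain fv :: "'a set + nat \<Rightarrow> 'b set + nat" where "fv ` gverts (underlying_graph M) \<subseteq> gverts (underlying_graph N)"
    and "\<And>e. e \<in> edge_orbits M \<Longrightarrow> h ` e \<in> edge_orbits N"
    and "\<And>e. e \<in> edge_orbits M \<Longrightarrow>
      gends (underlying_graph N) (h ` e) = fv ` gends (underlying_graph M) e"
    using underlying_graph_hom[OF assms] by blast
  moreover have "gedges (underlying_graph M) = edge_orbits M" for M :: "'z cmap"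
    by (simp add: underlying_graph_def)
  ultimately show ?thesis unfolding graph_hom_def
    by (intro exI[of _ fv] exI[of _ "image h"]) (auto simp: underlying_graph_def)
qed

lemma graph_hom_trans: "graph_hom G H \<Longrightarrow> graph_hom H K \<Longrightarrow> graph_hom G K"
  unfolding graph_hom_def
proof (elim exE conjE)
  fix fv fe gv ge
  assume "fv ` gverts G \<subseteq> gverts H" "fe ` gedges G \<subseteq> gedges H"
    "\<forall>e\<in>gedges G. gends H (fe e) = fv ` gends G e"
    "gv ` gverts H \<subseteq> gverts K" "ge ` gedges H \<subseteq> gedges K"
    "\<forall>e\<in>gedges H. gends K (ge e) = gv ` gends H e"
  then show "\<exists>fv fe. fv ` gverts G \<subseteq> gverts K \<and> fe ` gedges G \<subseteq> gedges K \<and>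
      (\<forall>e\<in>gedges G. gends K (fe e) = fv ` gends G e)"
    by (intro exI[of _ "gv \<circ> fv"] exI[of _ "ge \<circ> fe"]) (force simp: image_subset_iff image_image)
qed

section \<open>Deletion of edges\<close>

lemma vperm_permutes: "is_map M \<Longrightarrow> vperm M permutes crosses M"
  unfolding vperm_def
  by (rule permutes_compose) (auto simp: is_map_def fpf_involution_on_def)

lemma vperm_returns:
  assumes "is_map M" shows "\<exists>n>0. (vperm M ^^ n) x = x"
proof -
  have "permutation (vperm M)"
    using vperm_permutes[OF assms] map_finite[OF assms] by (auto simp: permutation_permutes)
  then have "x \<in> orbit (vperm M) x" by (rule permutation_self_in_orbit)
  then show ?thesis by (auto simp: orbit_altdef)
qed

text \<open>The dihedral relation: conjugation by \<open>al2\<close> inverts the vertex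
  permutation.\<close>

lemma vperm_reflect:
  assumes "is_map M" shows "(vperm M ^^ n) (al2 M ((vperm M ^^ n) y)) = al2 M y"
proof (induction n)
  case (Suc n)
  have "vperm M (al2 M (vperm M z)) = al2 M z" for z
    by (simp add: vperm_def map_invol[OF assms])
  then have "(vperm M ^^ Suc n) (al2 M ((vperm M ^^ Suc n) y)) =
      (vperm M ^^ n) (al2 M ((vperm M ^^ n) y))"
    by (metis comp_apply funpow.simps(2) funpow_Suc_right)
  then show ?case using Suc by simp
qed simp

text \<open>These composites are the reflections of the dihedral action on a vertex. Each is
  conjugate to \<open>al2\<close> or to \<open>al1\<close>, which have no fixed crosses; one
  conjugation lowers the exponent by two, hence the two base cases.\<close>

lemma vperm_reflect_neq:
  assumes "is_map M" shows "x \<in> crosses M \<Longrightarrow> (vperm M ^^ n) (al2 M x) \<noteq> x"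
proof (induction n arbitrary: x rule: induct_nat_012)
  case 0 then show ?case using map_fpf_neq(3)[OF assms] by simp
next
  case 1 then show ?case using map_fpf_neq(2)[OF assms] by (simp add: vperm_def map_invol[OF assms])
next
  case (ge2 n)
  define z where "z = al2 M (al1 M x)"
  have z: "z \<in> crosses M" "vperm M z = x" "al2 M z = vperm M (al2 M x)"
    using ge2.prems by (auto simp: z_def vperm_def map_in[OF assms] map_invol[OF assms])
  show ?case
  proof
    assume "(vperm M ^^ Suc (Suc n)) (al2 M x) = x"
    then have "vperm M ((vperm M ^^ n) (al2 M z)) = vperm M z"
      unfolding z(2,3) by (metis comp_apply funpow.simps(2) funpow_Suc_right)
    then have "(vperm M ^^ n) (al2 M z) = z"
      using permutes_inj[OF vperm_permutes[OF assms]] by (auto dest: injD)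
    then show False using ge2.IH(1)[OF z(1)] by simp
  qed
qed

lemma vperm_apply: "vperm M x = al1 M (al2 M x)"
  by (simp add: vperm_def)

lemma funpow_add_apply: "(f ^^ k) ((f ^^ l) x) = (f ^^ (k + l)) x"
  by (simp add: funpow_add)

lemma vperm_pow_in_vorb: "(vperm M ^^ n) x \<in> gorbit {al1 M, al2 M} x"
proof (induction n)
  case (Suc n)
  then have "al1 M (al2 M ((vperm M ^^ n) x)) \<in> gorbit {al1 M, al2 M} x"
    by (intro gorbit_step[of _ _ _ "al1 M"] gorbit_step[of _ _ _ "al2 M"]) auto
  then show ?case by (simp add: vperm_apply[of M "(vperm M ^^ n) x"])
qed (simp add: gorbit_self)

text \<open>The powers of the vertex permutation bring \<open>x\<close> back to itself, and
  \<open>x\<close> lies outside \<open>D\<close>; so the \<open>LEAST\<close> in \<open>skip\<close>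
  is attained.\<close>

lemma skipE:
  assumes "is_map M" "x \<notin> D"
  obtains n where "0 < n" "skip (vperm M) D x = (vperm M ^^ n) x" "(vperm M ^^ n) x \<notin> D"
    "\<And>k. 0 < k \<Longrightarrow> k < n \<Longrightarrow> (vperm M ^^ k) x \<in> D"
proof -
  let ?P = "\<lambda>n. 0 < n \<and> (vperm M ^^ n) x \<notin> D"
  obtain n0 where "?P n0" using vperm_returns[OF assms(1), of x] assms(2) by metis
  then have "?P (LEAST n. ?P n)" by (rule LeastI)
  moreover have "(vperm M ^^ k) x \<in> D" if "0 < k" "k < (LEAST n. ?P n)" for k
    using not_less_Least[OF that(2)] that(1) by auto
  ultimately show thesis using that[of "LEAST n. ?P n"] by (simp add: skip_def)
qed

lemma skip_eqI:
  assumes "0 < n" "(f ^^ n) x \<notin> D" "\<And>k. 0 < k \<Longrightarrow> k < n \<Longrightarrow> (f ^^ k) x \<in> D"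
  shows "skip f D x = (f ^^ n) x"
proof -
  have "(LEAST n. 0 < n \<and> (f ^^ n) x \<notin> D) = n"
  proof (rule Least_equality)
    fix k assume "0 < k \<and> (f ^^ k) x \<notin> D" then show "n \<le> k" using assms(3)[of k] by linarith
  qed (use assms in simp)
  then show ?thesis by (simp add: skip_def)
qed

context
  fixes M :: "'a cmap" and E D
  assumes M: "is_map M" and E: "E \<subseteq> edge_orbits M" and D_def: "D = \<Union> E"
begin

lemma deleted_al2: "x \<in> D \<Longrightarrow> al2 M x \<in> D" and deleted_al0: "x \<in> D \<Longrightarrow> al0 M x \<in> D"
proof -
  assume "x \<in> D"
  then obtain e where e: "e \<in> E" "x \<in> e" unfolding D_def by blast
  have "al0 M x \<in> e" "al2 M x \<in> e" using edge_orbit_cases(2)[OF M _ e(2)] E e(1) by auto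
  then show "al2 M x \<in> D" "al0 M x \<in> D" using e(1) unfolding D_def by blast+
qed

lemma kept_al2: "x \<notin> D \<Longrightarrow> al2 M x \<notin> D" and kept_al0: "x \<notin> D \<Longrightarrow> al0 M x \<notin> D"
  using deleted_al2[of "al2 M x"] deleted_al0[of "al0 M x"] by (auto simp: map_invol[OF M])

lemma delete_edges_simps:
  "crosses (delete_edges M E) = crosses M - D"
  "x \<in> crosses M - D \<Longrightarrow> al0 (delete_edges M E) x = al0 M x"
  "x \<in> crosses M - D \<Longrightarrow> al1 (delete_edges M E) x = skip (vperm M) D (al2 M x)"
  "x \<in> crosses M - D \<Longrightarrow> al2 (delete_edges M E) x = al2 M x"
  by (simp_all add: delete_edges_def Let_def D_def)

text \<open>Only the new \<open>al1\<close> is delicate. It sends \<open>x\<close> to the first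
  surviving cross \<open>y\<close> on the way round the vertex from \<open>al2 M x\<close>. By the
  dihedral relation the way back from \<open>al2 M y\<close> is the mirror image, and its inner
  crosses are deleted too, since \<open>D\<close> is closed under \<open>al2\<close>. A fixed cross
  would be fixed by a reflection.\<close>

lemma is_map_delete_edges: "is_map (delete_edges M E)"
proof -
  let ?N = "delete_edges M E" and ?C = "crosses M - D"
  have outside: "al0 ?N x = x" "al1 ?N x = x" "al2 ?N x = x" if "x \<notin> ?C" for x
    using that by (auto simp: delete_edges_def Let_def D_def)
  have "fpf_involution_on ?C (al0 ?N)"
    by (rule fpf_involutionI)
      (simp_all add: delete_edges_simps outside map_in[OF M] map_invol[OF M]
        map_fpf_neq[OF M] kept_al0)
  moreover have "fpf_involution_on ?C (al2 ?N)"
    by (rule fpf_involutionI)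
      (simp_all add: delete_edges_simps outside map_in[OF M] map_invol[OF M]
        map_fpf_neq[OF M] kept_al2)
  moreover have "fpf_involution_on ?C (al1 ?N)"
  proof (rule fpf_involutionI)
    fix x assume x: "x \<in> ?C"
    then have "al2 M x \<notin> D" using kept_al2 by auto
    then obtain n where n: "0 < n" "skip (vperm M) D (al2 M x) = (vperm M ^^ n) (al2 M x)"
      "(vperm M ^^ n) (al2 M x) \<notin> D"
      "\<And>k. 0 < k \<Longrightarrow> k < n \<Longrightarrow> (vperm M ^^ k) (al2 M x) \<in> D"
      by (rule skipE[OF M]) blast
    define y where "y = (vperm M ^^ n) (al2 M x)"
    have "y \<in> crosses M"
      using x vorb_subset[OF M, of "al2 M x"] vperm_pow_in_vorb[of n M "al2 M x"] map_in(3)[OF M]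
      unfolding y_def by blast
    then have y: "y \<in> ?C" using n(3) unfolding y_def by blast
    have y_x: "(vperm M ^^ n) (al2 M y) = x"
      unfolding y_def vperm_reflect[OF M] map_invol[OF M] ..
    have x_y: "al1 ?N x = y" unfolding y_def n(2)[symmetric] by (rule delete_edges_simps(3)[OF x])
    have "skip (vperm M) D (al2 M y) = (vperm M ^^ n) (al2 M y)"
    proof (rule skip_eqI[OF n(1)])
      show "(vperm M ^^ n) (al2 M y) \<notin> D"
        using x unfolding y_x by blast
      fix k assume k: "0 < k" "k < n"
      \<comment> \<open>The cross number \<open>k\<close> on the way back mirrors the cross number
        \<open>n - k\<close> on the way out.\<close>
      have "y = (vperm M ^^ k) ((vperm M ^^ (n - k)) (al2 M x))"
        using k by (simp add: y_def funpow_add_apply)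
      then have "(vperm M ^^ k) (al2 M y) = al2 M ((vperm M ^^ (n - k)) (al2 M x))"
        by (simp only: vperm_reflect[OF M])
      moreover have "(vperm M ^^ (n - k)) (al2 M x) \<in> D" using n(4)[of "n - k"] k by linarith
      ultimately show "(vperm M ^^ k) (al2 M y) \<in> D" using deleted_al2 by metis
    qed
    then have "al1 ?N y = x" using delete_edges_simps(3)[OF y] y_x by metis
    moreover have "y \<noteq> x" using vperm_reflect_neq[OF M] x unfolding y_def by blast
    ultimately show "al1 ?N x \<in> ?C \<and> al1 ?N (al1 ?N x) = x \<and> al1 ?N x \<noteq> x" using x_y y by simp
  qed (rule outside(2))
  moreover have "al0 ?N \<circ> al2 ?N = al2 ?N \<circ> al0 ?N"
  proof
    fix x show "(al0 ?N \<circ> al2 ?N) x = (al2 ?N \<circ> al0 ?N) x"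
    proof (cases "x \<in> ?C")
      case True
      then have "al0 M x \<in> ?C" "al2 M x \<in> ?C" by (simp_all add: map_in[OF M] kept_al0 kept_al2)
      then show ?thesis using True by (simp only: comp_apply delete_edges_simps map_comm[OF M])
    next
      case False
      then show ?thesis using outside[OF False] by simp
    qed
  qed
  moreover have "al0 ?N x \<noteq> al2 ?N x" if "x \<in> ?C" for x
    using delete_edges_simps(2,4)[OF that] map_al0_al2_neq[OF M, of x] that by simp
  ultimately show ?thesis
    using map_finite[OF M] unfolding is_map_def delete_edges_simps(1) by blast
qed

lemma delete_edges_al1_in_vorb:
  assumes "x \<in> crosses M - D"
  shows "al1 (delete_edges M E) x \<in> gorbit {al1 M, al2 M} x"
proof -
  have "skip (vperm M) D (al2 M x) \<in> gorbit {al1 M, al2 M} (al2 M x)"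
    unfolding skip_def by (rule vperm_pow_in_vorb)
  moreover have "al2 M x \<in> gorbit {al1 M, al2 M} x"
    by (rule gorbit_step[OF gorbit_self]) simp
  ultimately show ?thesis unfolding delete_edges_simps(3)[OF assms] by (rule gorbit_trans[rotated])
qed

text \<open>Deletion does not split a vertex. Its crosses are the images of \<open>x\<close> and
  \<open>al2 M x\<close> under powers of the vertex permutation, and a power that ends outside
  \<open>D\<close> decomposes into skips.\<close>

lemma delete_edges_vorb:
  assumes x: "x \<in> crosses M - D" and y: "y \<in> gorbit {al1 M, al2 M} x" "y \<notin> D"
  shows "y \<in> gorbit {al1 (delete_edges M E), al2 (delete_edges M E)} x"
proof -
  let ?O = "gorbit {al1 (delete_edges M E), al2 (delete_edges M E)}"
  have sub: "?O z \<subseteq> crosses M - D" if "z \<in> crosses M - D" for z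
    using vorb_subset[OF is_map_delete_edges] that by (simp add: delete_edges_simps)
  have al2: "al2 M z \<in> ?O x" if "z \<in> ?O x" for z
    using gorbit_step[OF that, of "al2 (delete_edges M E)"] sub[OF x] that
    by (auto simp: delete_edges_simps)
  have skip: "skip (vperm M) D z \<in> ?O x" if "z \<in> ?O x" for z
  proof -
    have "al2 M z \<in> ?O x" by (rule al2[OF that])
    moreover from this have "al2 M z \<in> crosses M - D" using sub[OF x] by auto
    moreover from this have "al1 (delete_edges M E) (al2 M z) = skip (vperm M) D z"
      by (simp only: delete_edges_simps map_invol[OF M])
    ultimately show ?thesis
      by (metis gorbit_step insertI1)
  qed
  have pow: "(vperm M ^^ k) z \<in> ?O x" if "z \<in> ?O x" "(vperm M ^^ k) z \<notin> D" for k z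
    using that
  proof (induction k arbitrary: z rule: less_induct)
    case (less k)
    show ?case
    proof (cases "k = 0")
      case False
      have "z \<notin> D" using less.prems(1) sub[OF x] by auto
      then obtain n where n: "0 < n" "skip (vperm M) D z = (vperm M ^^ n) z"
        "\<And>k. 0 < k \<Longrightarrow> k < n \<Longrightarrow> (vperm M ^^ k) z \<in> D"
        by (rule skipE[OF M]) blast
      then have "n \<le> k" using less.prems(2) False by (meson not_gr_zero not_less)
      then have "(vperm M ^^ k) z = (vperm M ^^ (k - n)) (skip (vperm M) D z)"
        by (simp add: n(2) funpow_add_apply)
      moreover have "k - n < k" using n(1) False by simp
      ultimately show ?thesis
        using less.IH[of "k - n" "skip (vperm M) D z"] skip[OF less.prems(1)] less.prems(2) by metis
    qed (use less in simp)
  qed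
  have orb: "\<exists>k. y = (vperm M ^^ k) x \<or> y = (vperm M ^^ k) (al2 M x)"
    using y(1)
  proof (induction rule: gorbit_induct)
    case self then show ?case by (intro exI[of _ 0]) simp
  next
    case (step y f)
    \<comment> \<open>By the dihedral relation this is an inverse power applied to
      \<open>al2 M z\<close>; a period \<open>q\<close> turns the exponent \<open>- l\<close> into
      the natural number \<open>q * l - l\<close>.\<close>
    have al2_pow: "\<exists>k. al2 M ((vperm M ^^ l) z) = (vperm M ^^ k) (al2 M z)" for l z
    proof -
      obtain q where q: "q > 0" "(vperm M ^^ q) (al2 M z) = al2 M z"
        using vperm_returns[OF M] by blast
      have returns: "(vperm M ^^ (q * s)) (al2 M z) = al2 M z" for s
        by (induction s) (auto simp: q funpow_add)
      have "(vperm M ^^ l) ((vperm M ^^ (q * l - l)) (al2 M z)) = al2 M z"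
        using returns[of l] q(1) by (simp add: funpow_add_apply)
      also have "\<dots> = (vperm M ^^ l) (al2 M ((vperm M ^^ l) z))"
        by (simp add: vperm_reflect[OF M])
      finally have "(vperm M ^^ (q * l - l)) (al2 M z) = al2 M ((vperm M ^^ l) z)"
        using inj_fn[OF permutes_inj[OF vperm_permutes[OF M]]] by (auto dest: injD)
      then show ?thesis by metis
    qed
    have al2': "\<exists>k. al2 M y = (vperm M ^^ k) x \<or> al2 M y = (vperm M ^^ k) (al2 M x)"
      using step.IH al2_pow map_invol(3)[OF M] by metis
    have "al1 M y = vperm M (al2 M y)" by (simp add: vperm_def map_invol[OF M])
    then have "\<exists>k. al1 M y = (vperm M ^^ k) x \<or> al1 M y = (vperm M ^^ k) (al2 M x)"
      using al2' by (metis funpow.simps(2) comp_apply)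
    then show ?case using step.hyps al2' by auto
  qed
  have "x \<in> ?O x" by (rule gorbit_self)
  with orb show ?thesis using pow[of x] pow[of "al2 M x"] y(2) al2[of x] by blast
qed

end


section \<open>Gluings and submaps induce graph homomorphisms\<close>

lemma even_card_fpf_involution:
  assumes "finite T" "\<And>x. x \<in> T \<Longrightarrow> f x \<in> T \<and> f (f x) = x \<and> f x \<noteq> x"
  shows "even (card T)"
  using assms
proof (induction "card T" arbitrary: T rule: less_induct)
  case less
  show ?case
  proof (cases "T = {}")
    case False
    then obtain x where x: "x \<in> T" by blast
    have fx: "f x \<in> T" "f x \<noteq> x" using less.prems(2)[OF x] by auto
    let ?T = "T - {x, f x}"
    have card: "card T = card ?T + 2"
      using card_Diff_subset[of "{x, f x}" T] card_mono[OF less.prems(1), of "{x, f x}"] x fx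
      by simp
    have "even (card ?T)"
    proof (rule less.hyps)
      show "f y \<in> ?T \<and> f (f y) = y \<and> f y \<noteq> y" if "y \<in> ?T" for y
        using less.prems(2)[of y] less.prems(2)[OF x] that by auto
    qed (use card less.prems in auto)
    then show ?thesis using card by simp
  qed simp
qed

lemma gverts_nonempty: "crosses M \<noteq> {} \<or> 0 < isol M \<Longrightarrow> gverts (underlying_graph M) \<noteq> {}"
  by (auto simp: underlying_graph_def vertex_orbits_def gorbits_def)

lemma conj_al1_simps:
  "crosses (conj_al1 M a b) = crosses M" "al0 (conj_al1 M a b) = al0 M"
  "al2 (conj_al1 M a b) = al2 M" "isol (conj_al1 M a b) = isol M"
  "al1 (conj_al1 M a b) x = transpose a b (al1 M (transpose a b x))"
  by (simp_all add: conj_al1_def)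

context
  fixes M :: "'a cmap" and a b :: 'a
  assumes M: "is_map M" and a: "a \<in> crosses M" and b: "b \<in> crosses M"
    and ab: "gorbit {al1 M, al2 M} a \<noteq> gorbit {al1 M, al2 M} b"
begin

lemma is_map_conj_al1: "is_map (conj_al1 M a b)"
proof -
  have tr: "transpose a b x \<in> crosses M \<longleftrightarrow> x \<in> crosses M" for x
    using a b by (auto simp: transpose_def)
  have "fpf_involution_on (crosses M) (al1 (conj_al1 M a b))"
  proof (rule fpf_involutionI)
    fix x assume x: "x \<in> crosses M"
    have "al1 M (transpose a b x) \<noteq> transpose a b x" using map_fpf_neq(2)[OF M] tr x by blast
    then have "transpose a b (al1 M (transpose a b x)) \<noteq> x" by (metis transpose_involutory)
    then show "al1 (conj_al1 M a b) x \<in> crosses M \<and>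
        al1 (conj_al1 M a b) (al1 (conj_al1 M a b) x) = x \<and> al1 (conj_al1 M a b) x \<noteq> x"
      using x tr map_in(2)[OF M] by (simp add: conj_al1_simps map_invol[OF M])
  next
    fix x assume x: "x \<notin> crosses M"
    then have "transpose a b x = x" using a b by (auto simp: transpose_def)
    then show "al1 (conj_al1 M a b) x = x" using map_outside(2)[OF M x] by (simp add: conj_al1_simps)
  qed
  then show ?thesis using M by (simp add: is_map_def conj_al1_simps)
qed

lemma conj_al1_other:
  assumes "x \<notin> {a, b, al1 M a, al1 M b}" shows "al1 (conj_al1 M a b) x = al1 M x"
proof -
  have "al1 M x \<noteq> a" "al1 M x \<noteq> b" using assms map_invol(2)[OF M] by auto
  then show ?thesis using assms by (simp add: conj_al1_simps)
qed

text \<open>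
  If \<open>al1 M a\<close> were not reached, the part \<open>T\<close> of the new orbit of \<open>a\<close> inside its old orbit would
  have even size because of \<open>al2\<close>, and \<open>T - {a}\<close> would have even size because of \<open>al1\<close>.
\<close>

lemma conj_al1_connects:
  "al1 M a \<in> gorbit {al1 (conj_al1 M a b), al2 (conj_al1 M a b)} a" (is "_ \<in> gorbit ?F a")
proof (rule ccontr)
  assume notin: "al1 M a \<notin> gorbit ?F a"
  define V where "V = gorbit {al1 M, al2 M} a"
  define T where "T = gorbit ?F a \<inter> V"
  have VC: "V \<subseteq> crosses M" unfolding V_def by (rule vorb_subset[OF M a])
  have bV: "b \<notin> V" using vorb_eq[OF M a, of b] ab by (auto simp: V_def)
  have V1: "al1 M x \<in> V" and V2: "al2 M x \<in> V" if "x \<in> V" for x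
    using that gorbit_step[of x "{al1 M, al2 M}" a] by (auto simp: V_def)
  have b'V: "al1 M b \<notin> V" using V1[of "al1 M b"] bV map_invol(2)[OF M, of b] by auto
  have fin: "finite T" using VC map_finite[OF M] by (auto simp: T_def intro: finite_subset)
  have "even (card T)"
  proof (rule even_card_fpf_involution[OF fin, of "al2 M"])
    fix x assume x: "x \<in> T"
    then have "al2 M x \<in> gorbit ?F a" using gorbit_step[of x ?F a "al2 M"]
      by (simp add: T_def conj_al1_simps)
    then show "al2 M x \<in> T \<and> al2 M (al2 M x) = x \<and> al2 M x \<noteq> x"
      using x V2 VC map_fpf_neq(3)[OF M] map_invol(3)[OF M] by (auto simp: T_def)
  qed
  moreover have "even (card (T - {a}))"
  proof (rule even_card_fpf_involution[of _ "al1 M"])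
    show "finite (T - {a})" using fin by simp
    fix x assume x: "x \<in> T - {a}"
    then have "x \<notin> {a, b, al1 M a, al1 M b}" using notin bV b'V by (auto simp: T_def)
    then have *: "al1 (conj_al1 M a b) x = al1 M x" "al1 M x \<noteq> a"
      using conj_al1_other map_invol(2)[OF M, of x] by auto
    then have "al1 M x \<in> gorbit ?F a"
      using x gorbit_step[of x ?F a "al1 (conj_al1 M a b)"] by (simp add: T_def)
    then show "al1 M x \<in> T - {a} \<and> al1 M (al1 M x) = x \<and> al1 M x \<noteq> x"
      using x V1 VC map_fpf_neq(2)[OF M] map_invol(2)[OF M] * by (auto simp: T_def)
  qed
  moreover have "a \<in> T" by (simp add: T_def V_def gorbit_self)
  ultimately show False using fin by (auto simp: card_Diff_singleton card_gt_0_iff)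
qed

end

text \<open>The identity on crosses works. \<open>al1\<close> changes only at \<open>a\<close>,
  \<open>b\<close> and their old partners, and there \<open>conj_al1_connects\<close>, used for
  \<open>(a, b)\<close> and for \<open>(b, a)\<close>, shows that old partners still share a
  vertex.\<close>

lemma conj_al1_graph_hom:
  assumes M: "is_map M" and a: "a \<in> crosses M" and b: "b \<in> crosses M"
    and ab: "gorbit {al1 M, al2 M} a \<noteq> gorbit {al1 M, al2 M} b"
  shows "graph_hom (underlying_graph M) (underlying_graph (conj_al1 M a b))"
proof -
  let ?N = "conj_al1 M a b"
  let ?O = "gorbit {al1 ?N, al2 ?N}"
  note N = is_map_conj_al1[OF M a b ab]
  have swap: "conj_al1 M b a = ?N" by (simp add: conj_al1_def transpose_commute)
  have sym: "x \<in> ?O (al1 M x)" if "x \<in> crosses M" "al1 M x \<in> ?O x" for x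
    using gorbit_sym[OF map_involutions[OF N], of "{al1 ?N, al2 ?N}"] that
    by (simp add: conj_al1_simps)
  have "al1 M a \<in> ?O a" by (rule conj_al1_connects[OF M a b ab])
  moreover have "al1 M b \<in> ?O b" using conj_al1_connects[OF M b a ab[symmetric]] by (simp add: swap)
  ultimately have special: "al1 M x \<in> ?O x" if "x \<in> {a, b, al1 M a, al1 M b}" for x
    using that sym[OF a] sym[OF b] map_invol(2)[OF M] by auto
  have "al1 M x \<in> ?O x" for x
  proof (cases "x \<in> {a, b, al1 M a, al1 M b}")
    case False
    then show ?thesis
      using conj_al1_other[OF M a b ab False] gorbit_step[OF gorbit_self, of "al1 ?N" _ x] by simp
  qed (rule special)
  then show ?thesis
    using gverts_nonempty[of ?N] a
    by (intro graph_hom_underlying[OF M N, of id]) (auto simp: conj_al1_simps)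
qed

text \<open>On a face of degree two the face permutation is an involution, so \<open>al0\<close> and
  \<open>al1\<close> commute there and the face has at most the crosses \<open>z\<close>,
  \<open>al0 M z\<close>, \<open>al1 M z\<close>, \<open>al0 M (al1 M z)\<close>. If
  \<open>al1 M z\<close> were in \<open>f\<close>, the whole face would be, and \<open>e\<close>
  would share a cross with \<open>f\<close>. So \<open>al1 M z\<close> lies on another edge, and
  that edge has the same ends as \<open>f\<close>.\<close>

lemma duplicate_edges_parallel:
  assumes M: "is_map M" and dup: "duplicate_edges M e f"
  obtains z where "z \<in> crosses M" "f = {z, al0 M z, al2 M z, al0 M (al2 M z)}"
    "al1 M z \<notin> f" "al1 M (al0 M z) = al0 M (al1 M z)"
proof -
  obtain F where e: "e \<in> edge_orbits M" and f: "f \<in> edge_orbits M" "e \<noteq> f"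
    and F: "F \<in> face_orbits M" "face_degree M F = 2" "e \<inter> F \<noteq> {}" "f \<inter> F \<noteq> {}"
    using dup by (auto simp: duplicate_edges_def)
  let ?G = "gorbit {al0 M, al1 M}"
  have inv: "involutions_on {al0 M, al1 M} (crosses M)" by (rule map_involutions[OF M]) auto
  obtain x1 where x1: "x1 \<in> crosses M" "F = ?G x1"
    using F(1) by (auto simp: face_orbits_def gorbits_def)
  define x where "x = (SOME x. x \<in> F)"
  have xF: "x \<in> F" unfolding x_def x1 by (rule someI) (rule gorbit_self)
  have Fx: "F = ?G y" if "y \<in> F" for y using gorbit_eq[OF inv x1(1)] that x1(2) by auto
  have FC: "F \<subseteq> crosses M" using gorbit_subset[OF inv x1(1)] x1(2) by auto
  let ?p = "fperm M"
  have perm: "?p permutes crosses M" unfolding fperm_def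
    by (rule permutes_compose) (use M in \<open>auto simp: is_map_def fpf_involution_on_def\<close>)
  then have "permutation ?p" using map_finite[OF M] by (auto simp: permutation_permutes)
  then have xo: "x \<in> orbit ?p x" by (rule permutation_self_in_orbit)
  have card: "card (orbit ?p x) = 2" using F(2) by (simp add: face_degree_def x_def)
  have fin: "finite (orbit ?p x)" using card by (intro card_ge_0_finite) simp
  have ne: "?p x \<noteq> x"
  proof
    assume fixed: "?p x = x"
    have "y = x" if "y \<in> orbit ?p x" for y
      using that by (induction rule: orbit.induct) (auto simp: fixed)
    then have "orbit ?p x \<subseteq> {x}" by blast
    then show False using card card_mono[of "{x}" "orbit ?p x"] by simp
  qed
  then have "?p (?p x) \<noteq> ?p x" using permutes_inj[OF perm] by (auto dest: injD)
  moreover have "{x, ?p x, ?p (?p x)} \<subseteq> orbit ?p x"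
    using orbit.base[of ?p x] orbit.step[OF orbit.base, of ?p x] xo by simp
  then have "card {x, ?p x, ?p (?p x)} \<le> 2" using card_mono[OF fin] card by metis
  ultimately have "?p (?p x) = x" using ne by (auto simp: card_insert_if split: if_splits)
  then have comm_x: "al1 M (al0 M x) = al0 M (al1 M x)"
    unfolding fperm_def comp_apply by (metis map_invol(1)[OF M] map_invol(2)[OF M])
  have comm: "al1 M (al0 M y) = al0 M (al1 M y)" if "y \<in> F" for y
  proof -
    have "y \<in> ?G x" using Fx[OF xF] that by simp
    then show ?thesis
    proof (induction rule: gorbit_induct)
      case self then show ?case by (rule comm_x)
    next
      case (step y g)
      then show ?case using map_invol[OF M] by (metis insertE singletonD)
    qed
  qed
  obtain z where z: "z \<in> f" "z \<in> F" using F(4) by blast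
  have f_eq: "f = {z, al0 M z, al2 M z, al0 M (al2 M z)}"
    using edge_orbit_cases(2)[OF M f(1) z(1)] .
  have Fz: "F \<subseteq> {z, al0 M z, al1 M z, al0 M (al1 M z)}"
  proof
    fix y assume "y \<in> F"
    then have "y \<in> ?G z" using Fx[OF z(2)] by simp
    then show "y \<in> {z, al0 M z, al1 M z, al0 M (al1 M z)}"
    proof (induction rule: gorbit_induct)
      case (step y g)
      have "al1 M (al0 M (al1 M z)) = al0 M z" by (metis comm[OF z(2)] map_invol(2)[OF M])
      then show ?case using step comm[OF z(2)] by (auto simp: map_invol[OF M])
    qed simp
  qed
  have "al1 M z \<notin> f"
  proof
    assume "al1 M z \<in> f"
    then have "al0 M (al1 M z) \<in> f" using edge_orbit_cases(2)[OF M f(1)] by blast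
    then have "F \<subseteq> f" using Fz \<open>al1 M z \<in> f\<close> f_eq by auto
    then obtain y where "y \<in> e" "y \<in> f" using F(3) by blast
    then have "e = f" using edge_orbit_cases(2)[OF M e] edge_orbit_cases(2)[OF M f(1)] by metis
    then show False using f(2) by simp
  qed
  then show thesis using that[of z] f_eq comm[OF z(2)] z(2) FC by auto
qed

text \<open>The four crosses of \<open>f\<close> move to the parallel edge through
  \<open>al1 M z\<close>; all other crosses stay. No cross leaves its vertex, and by
  \<open>delete_edges_vorb\<close> the vertices survive the deletion in one piece.\<close>

lemma duplicate_graph_hom:
  assumes M: "is_map M" and dup: "duplicate_edges M e f"
  shows "graph_hom (underlying_graph M) (underlying_graph (delete_edge M f))"
proof -
  obtain z where z: "z \<in> crosses M" and f_eq: "f = {z, al0 M z, al2 M z, al0 M (al2 M z)}"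
    and z1: "al1 M z \<notin> f" and comm: "al1 M (al0 M z) = al0 M (al1 M z)"
    by (rule duplicate_edges_parallel[OF M dup])
  have f: "{f} \<subseteq> edge_orbits M" "f = \<Union> {f}"
    using dup unfolding duplicate_edges_def by simp_all
  let ?N = "delete_edges M {f}"
  let ?O = "gorbit {al1 M, al2 M}"
  note N = is_map_delete_edges[OF M f] and simps = delete_edges_simps[OF M f]
  note [simp] = map_invol[OF M] and in' = map_in[OF M]
  define y where "y = al1 M z"
  have y: "y \<in> crosses M" "y \<notin> f" using z z1 in' by (auto simp: y_def)
  have y': "al0 M y \<notin> f" "al2 M y \<notin> f" "al0 M (al2 M y) \<notin> f"
    using y(2) kept_al0[OF M f] kept_al2[OF M f] by blast+
  have dist: "al0 M z \<noteq> z" "al2 M z \<noteq> z" "al0 M (al2 M z) \<noteq> z" "al0 M z \<noteq> al2 M z"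
    "al0 M (al2 M z) \<noteq> al0 M z" "al0 M (al2 M z) \<noteq> al2 M z"
  proof -
    show "al0 M z \<noteq> z" "al2 M z \<noteq> z" "al0 M z \<noteq> al2 M z" "al0 M (al2 M z) \<noteq> al2 M z"
      by (rule map_fpf_neq[OF M] map_al0_al2_neq[OF M] in' z)+
    then show "al0 M (al2 M z) \<noteq> z" "al0 M (al2 M z) \<noteq> al0 M z"
      using map_invol(1)[OF M] by metis+
  qed
  define h where "h = id(z := y, al0 M z := al0 M y, al2 M z := al2 M y,
    al0 M (al2 M z) := al0 M (al2 M y))"
  have h_f: "h z = y" "h (al0 M z) = al0 M y" "h (al2 M z) = al2 M y"
    "h (al0 M (al2 M z)) = al0 M (al2 M y)"
    using dist by (auto simp: h_def)
  have h_id: "h x = x" if "x \<notin> f" for x using that by (auto simp: h_def f_eq)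
  have h_in: "h x \<in> crosses M - f" if "x \<in> crosses M" for x
  proof (cases "x \<in> f")
    case True
    then consider "x = z" | "x = al0 M z" | "x = al2 M z" | "x = al0 M (al2 M z)"
      unfolding f_eq by blast
    then show ?thesis using h_f y y' in' by cases simp_all
  next
    case False then show ?thesis using h_id[OF False] that by simp
  qed
  have h0: "h (al0 M x) = al0 M (h x)" for x
  proof (cases "x \<in> f")
    case True
    then consider "x = z" | "x = al0 M z" | "x = al2 M z" | "x = al0 M (al2 M z)"
      unfolding f_eq by blast
    then show ?thesis by cases (simp_all add: h_f)
  next
    case False then show ?thesis using h_id[of x] h_id[of "al0 M x"] kept_al0[OF M f] by simp
  qed
  have h2: "h (al2 M x) = al2 M (h x)" for x
  proof (cases "x \<in> f")
    case True
    then consider "x = z" | "x = al0 M z" | "x = al2 M z" | "x = al0 M (al2 M z)"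
      unfolding f_eq by blast
    then show ?thesis
      by cases (simp_all add: h_f map_comm[OF M, symmetric])
  next
    case False then show ?thesis using h_id[of x] h_id[of "al2 M x"] kept_al2[OF M f] by simp
  qed
  have O1: "al1 M x \<in> ?O x" and O2: "al2 M x \<in> ?O x" for x
    by (rule gorbit_step[OF gorbit_self]; simp)+
  have Oeq: "?O (al1 M x) = ?O x" "?O (al2 M x) = ?O x" if "x \<in> crosses M" for x
    using vorb_eq[OF M that] O1 O2 by blast+
  have h_O: "?O (h x) = ?O x" if "x \<in> crosses M" for x
  proof (cases "x \<in> f")
    case False then show ?thesis by (simp add: h_id)
  next
    case True
    have "al0 M y = al1 M (al0 M z)" by (simp add: comm y_def)
    then have "?O (al0 M y) = ?O (al0 M z)" using Oeq(1)[OF in'(1)[OF z]] by simp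
    moreover have "?O y = ?O z" unfolding y_def by (rule Oeq(1)[OF z])
    moreover have "?O (al0 M (al2 M w)) = ?O (al0 M w)" if "w \<in> crosses M" for w
      unfolding map_comm[OF M] by (rule Oeq(2)[OF in'(1)[OF that]])
    moreover have "?O (al2 M y) = ?O y" "?O (al2 M z) = ?O z" using Oeq z y by blast+
    ultimately have *: "?O (al0 M y) = ?O (al0 M z)" "?O y = ?O z" "?O (al2 M y) = ?O (al2 M z)"
      "?O (al0 M (al2 M y)) = ?O (al0 M (al2 M z))"
      using z y(1) by simp_all
    consider "x = z" | "x = al0 M z" | "x = al2 M z" | "x = al0 M (al2 M z)"
      using True unfolding f_eq by blast
    then show ?thesis by cases (simp_all only: h_f *)
  qed
  have h1: "h (al1 M x) \<in> gorbit {al1 ?N, al2 ?N} (h x)" if x: "x \<in> crosses M" for x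
  proof (rule delete_edges_vorb[OF M f])
    show "h x \<in> crosses M - f" by (rule h_in[OF x])
    have "?O (h (al1 M x)) = ?O (h x)" using h_O[OF x] h_O[OF in'(2)[OF x]] Oeq(1)[OF x] by simp
    then show "h (al1 M x) \<in> ?O (h x)" using gorbit_self[of "h (al1 M x)"] by metis
    show "h (al1 M x) \<notin> f" using h_in[OF in'(2)[OF x]] by blast
  qed
  have "crosses ?N \<noteq> {}" using y by (auto simp: simps(1))
  then show ?thesis
    using gverts_nonempty[of ?N] h1 h_in
    by (intro graph_hom_underlying[OF M N, of h]) (simp_all add: simps h0 h2)
qed

lemma gluing_graph_hom:
  assumes "is_map M" and "gluing M N"
  shows "is_map N \<and> graph_hom (underlying_graph M) (underlying_graph N)"
  using assms(2)
proof cases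
  case vertex
  then show ?thesis
  proof cases
    case (crosses a b)
    then show ?thesis using is_map_conj_al1[OF assms(1)] conj_al1_graph_hom[OF assms(1)] by simp
  next
    case isolated
    then have N: "is_map N" using assms(1) by (simp add: is_map_def)
    have "gverts (underlying_graph N) \<noteq> {}"
    proof (rule gverts_nonempty)
      show "crosses N \<noteq> {} \<or> 0 < isol N"
        using isolated by (auto simp: num_verts_def vertex_orbits_def gorbits_def)
    qed
    then have "graph_hom (underlying_graph M) (underlying_graph N)"
      using isolated gorbit_step[OF gorbit_self, of "al1 M"]
      by (intro graph_hom_underlying[OF assms(1) N, of id]) auto
    with N show ?thesis by simp
  qed
next
  case (duplicate e f)
  then show ?thesis
    using duplicate_graph_hom[OF assms(1)] is_map_delete_edges[OF assms(1) _ refl, of "{f}"]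
    by (auto simp: duplicate_edges_def)
qed

lemma graph_hom_refl: "graph_hom G G"
  unfolding graph_hom_def by (intro exI[of _ id]) simp

lemma gluings_graph_hom:
  assumes "gluing\<^sup>*\<^sup>* M N" and "is_map M"
  shows "is_map N \<and> graph_hom (underlying_graph M) (underlying_graph N)"
  using assms
  by (induction rule: rtranclp_induct)
    (auto simp: graph_hom_refl dest: gluing_graph_hom intro: graph_hom_trans)

lemma map_iso_graph_hom:
  assumes "is_map M" "is_map N" "map_iso M N"
  shows "graph_hom (underlying_graph M) (underlying_graph N)"
proof -
  obtain h where h: "bij_betw h (crosses M) (crosses N)"
    "\<And>x. x \<in> crosses M \<Longrightarrow> h (al0 M x) = al0 N (h x) \<and> h (al1 M x) = al1 N (h x) \<and>
      h (al2 M x) = al2 N (h x)" and isol: "isol M = isol N"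
    using assms(3) unfolding map_iso_def by auto
  show ?thesis
    using h isol gverts_nonempty[of N] gorbit_step[OF gorbit_self, of "al1 N"]
    by (intro graph_hom_underlying[OF assms(1,2), of h]) (auto simp: bij_betw_def)
qed

text \<open>The invariant of a sequence of deletions. The final \<open>al1\<close> results from
  several skips in a row and has no direct description in \<open>M\<close>; that it stays inside the
  vertices of \<open>M\<close> is a property that composes and suffices for graph
  homomorphisms.\<close>

definition map_embedded :: "'a cmap \<Rightarrow> 'a cmap \<Rightarrow> bool" where
  "map_embedded S M \<longleftrightarrow> is_map S \<and> crosses S \<subseteq> crosses M \<and>
     (\<forall>x\<in>crosses S. al0 S x = al0 M x \<and> al2 S x = al2 M x \<and>
        al1 S x \<in> gorbit {al1 M, al2 M} x)"

lemma map_embedded_trans: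
  assumes TS: "map_embedded T S" and SM: "map_embedded S M"
  shows "map_embedded T M"
proof -
  have S: "is_map S" using SM by (simp add: map_embedded_def)
  have "y \<in> gorbit {al1 M, al2 M} x" if "y \<in> gorbit {al1 S, al2 S} x" "x \<in> crosses S" for x y
    using that(1)
  proof (induction rule: gorbit_induct)
    case self then show ?case by (rule gorbit_self)
  next
    case (step y f)
    have "y \<in> crosses S" using vorb_subset[OF S that(2)] step by auto
    then have "al1 S y \<in> gorbit {al1 M, al2 M} y" "al2 S y = al2 M y"
      using SM by (auto simp: map_embedded_def)
    then show ?case
      using step gorbit_trans gorbit_step[of y "{al1 M, al2 M}" x "al2 M"] by fastforce
  qed
  moreover have "al1 T x \<in> gorbit {al1 S, al2 S} x" "x \<in> crosses S" if "x \<in> crosses T" for x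
    using TS that by (auto simp: map_embedded_def)
  ultimately have "al1 T x \<in> gorbit {al1 M, al2 M} x" if "x \<in> crosses T" for x
    using that by blast
  moreover have "al0 T x = al0 M x \<and> al2 T x = al2 M x" if "x \<in> crosses T" for x
    using TS SM that by (auto simp: map_embedded_def)
  ultimately show ?thesis using TS SM by (auto simp: map_embedded_def)
qed

lemma is_map_isol: "is_map (M\<lparr>isol := i\<rparr>) \<longleftrightarrow> is_map M"
  by (simp add: is_map_def)

lemma map_embedded_isol: "map_embedded S M \<Longrightarrow> map_embedded (S\<lparr>isol := i\<rparr>) M"
  by (simp add: map_embedded_def is_map_isol)

lemma map_embedded_delete_edges:
  assumes M: "is_map M" and E: "E \<subseteq> edge_orbits M"
  shows "map_embedded (delete_edges M E) M"
  unfolding map_embedded_def delete_edges_simps(1)[OF M E refl]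
  by (intro conjI ballI is_map_delete_edges[OF M E refl] delete_edges_al1_in_vorb[OF M E refl]
      delete_edges_simps[OF M E refl] Diff_subset)

lemma delete_edges_empty:
  assumes "is_map M" shows "delete_edges M {} = M"
proof -
  have "(LEAST n::nat. 0 < n) = 1" by (rule Least_equality) auto
  then have skip: "skip (vperm M) {} y = al1 M (al2 M y)" for y
    by (simp add: skip_def vperm_def)
  show ?thesis
  proof (rule cmap.equality)
    show "isol (delete_edges M {}) = isol M"
      using gorbit_self by (force simp: delete_edges_def vertex_orbits_def gorbits_def)
  qed (auto simp: delete_edges_def fun_eq_iff skip map_outside[OF assms] map_invol[OF assms])
qed

lemma delete_edges_smaller:
  assumes M: "is_map M" and E: "E \<subseteq> edge_orbits M" "E \<noteq> {}"
  shows "crosses (delete_edges M E) \<noteq> crosses M"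
proof -
  obtain e where "e \<in> E" using E by blast
  moreover from this obtain x where "x \<in> crosses M" "x \<in> e"
    using E gorbit_self by (fastforce simp: edge_orbits_def gorbits_def)
  ultimately show ?thesis by (auto simp: delete_edges_simps(1)[OF M E(1) refl])
qed

text \<open>For the second claim: without isolated vertices, the first deletion that changes
  \<open>M\<close> removes an edge, and later ones never restore crosses.\<close>

lemma submap_embedded:
  assumes M: "is_map M" and S: "submap S M"
  shows "map_embedded S M" and "isol M = 0 \<Longrightarrow> S \<noteq> M \<Longrightarrow> crosses S \<noteq> crosses M"
proof -
  obtain E where E: "E \<subseteq> edge_orbits M" and del: "vertex_deletion\<^sup>*\<^sup>* (delete_edges M E) S"
    using S by (auto simp: submap_def)
  have "map_embedded S M \<and> (isol M = 0 \<longrightarrow> S \<noteq> M \<longrightarrow> crosses S \<noteq> crosses M)"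
    using del
  proof (induction rule: rtranclp_induct)
    case base
    show ?case
      using map_embedded_delete_edges[OF M E] delete_edges_empty[OF M]
        delete_edges_smaller[OF M E] by (cases "E = {}") auto
  next
    case (step S T)
    have S: "is_map S" "map_embedded S M" using step.IH by (auto simp: map_embedded_def)
    show ?case using step.hyps(2)
    proof cases
      case isolated
      then show ?thesis using step.IH map_embedded_isol by auto
    next
      case (nonisolated v N)
      let ?E = "{e \<in> edge_orbits S. e \<inter> v \<noteq> {}}"
      have sub: "?E \<subseteq> edge_orbits S" by blast
      obtain x where x: "x \<in> crosses S" "x \<in> v"
        using nonisolated(2) gorbit_self by (fastforce simp: vertex_orbits_def gorbits_def)
      then have "{x, al0 S x, al2 S x, al0 S (al2 S x)} \<in> ?E" using edge_orbitI[OF S(1)] by simp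
      then have "?E \<noteq> {}" by blast
      then have neq: "crosses N \<noteq> crosses S"
        using delete_edges_smaller[OF S(1) sub] nonisolated(3) by blast
      have NS: "map_embedded N S"
        unfolding nonisolated(3) by (rule map_embedded_delete_edges[OF S(1) sub])
      have "crosses N \<subseteq> crosses S" "crosses S \<subseteq> crosses M"
        using NS S(2) unfolding map_embedded_def by blast+
      moreover have "crosses T = crosses N" by (simp add: nonisolated(1))
      ultimately have "crosses T \<noteq> crosses M" using neq by blast
      moreover have "map_embedded T M"
        unfolding nonisolated(1) by (rule map_embedded_isol[OF map_embedded_trans[OF NS S(2)]])
      ultimately show ?thesis by blast
    qed
  qed
  then show "map_embedded S M" "isol M = 0 \<Longrightarrow> S \<noteq> M \<Longrightarrow> crosses S \<noteq> crosses M" by blast+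
qed

lemma map_hom_graph_hom:
  assumes M: "is_map M" and N: "is_map N" "crosses N \<noteq> {}" and "map_hom M N"
  shows "graph_hom (underlying_graph M) (underlying_graph N)"
proof -
  obtain K S where K: "gluing\<^sup>*\<^sup>* M K" and S: "submap S N" and iso: "map_iso K S"
    using assms(4) by (auto simp: map_hom_def)
  have SN: "map_embedded S N" by (rule submap_embedded(1)[OF N(1) S])
  then have S: "is_map S" by (simp add: map_embedded_def)
  have "graph_hom (underlying_graph S) (underlying_graph N)"
    by (rule graph_hom_underlying[OF S N(1), of id])
      (use SN gverts_nonempty[of N] N(2) in \<open>auto simp: map_embedded_def\<close>)
  then show ?thesis
    using gluings_graph_hom[OF K M] map_iso_graph_hom[OF _ S iso] graph_hom_trans by metis
qed

text \<open>A homomorphism to a proper submap ends in a map \<open>S\<close> that lacks some cross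
  \<open>x\<close> of \<open>M\<close>. The edge \<open>e0\<close> through \<open>x\<close> is then
  missed altogether, so the underlying graph maps to itself without \<open>e0\<close>. Keeping all
  vertices in this proper subgraph \<open>H\<close> avoids any question about the image of
  \<open>fv\<close>.\<close>

lemma map_core_if_graph_core:
  assumes M: "is_map M" "isol M = 0" and core: "graph_core (underlying_graph M)"
  shows "map_core M"
  unfolding map_core_def
proof (intro conjI notI M(1))
  assume "\<exists>N. proper_submap N M \<and> map_hom M N"
  then obtain N where N: "submap N M" "N \<noteq> M" "map_hom M N" by (auto simp: proper_submap_def)
  obtain K S where K: "gluing\<^sup>*\<^sup>* M K" and S: "submap S N" and iso: "map_iso K S"
    using N(3) by (auto simp: map_hom_def)
  note NM = submap_embedded[OF M(1) N(1)]
  then have "is_map N" by (simp add: map_embedded_def)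
  then have SN: "map_embedded S N" by (rule submap_embedded(1)[OF _ S])
  have SM: "map_embedded S M" by (rule map_embedded_trans[OF SN NM(1)])
  then have S: "is_map S" by (simp add: map_embedded_def)
  obtain x where x: "x \<in> crosses M" "x \<notin> crosses S"
    using NM SN N(2) M(2) by (auto simp: map_embedded_def)
  define e0 where "e0 = {x, al0 M x, al2 M x, al0 M (al2 M x)}"
  have e0: "e0 \<in> edge_orbits M" unfolding e0_def by (rule edge_orbitI[OF M(1) x(1)])
  obtain fv where fv: "fv ` gverts (underlying_graph S) \<subseteq> gverts (underlying_graph M)"
    and fe: "\<And>e. e \<in> edge_orbits S \<Longrightarrow> id ` e \<in> edge_orbits M"
    and ends: "\<And>e. e \<in> edge_orbits S \<Longrightarrow>
      gends (underlying_graph M) (id ` e) = fv ` gends (underlying_graph S) e"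
    using underlying_graph_hom[OF S M(1), of id] SM gverts_nonempty[of M] x(1)
    by (auto simp: map_embedded_def)
  define H where "H = (underlying_graph M)\<lparr>gedges := edge_orbits M - {e0}\<rparr>"
  have H: "gverts H = gverts (underlying_graph M)" "gedges H = edge_orbits M - {e0}"
    "gends H = gends (underlying_graph M)" by (simp_all add: H_def)
  have [simp]: "gedges (underlying_graph T) = edge_orbits T" for T :: "'a cmap"
    by (simp add: underlying_graph_def)
  have "gends (underlying_graph M) e \<subseteq> gverts (underlying_graph M)" for e
    by (auto simp: underlying_graph_def)
  then have "proper_subgraph H (underlying_graph M)"
    using e0 by (auto simp: proper_subgraph_def subgraph_def H)
  moreover have "e \<noteq> e0" if "e \<in> edge_orbits S" for e
    using edge_orbit_cases(1)[OF S that] x(2) by (auto simp: e0_def)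
  then have "graph_hom (underlying_graph S) H"
    unfolding graph_hom_def using fv fe ends
    by (intro exI[of _ fv] exI[of _ id]) (auto simp: H)
  then have "graph_hom (underlying_graph M) H"
    using gluings_graph_hom[OF K M(1)] map_iso_graph_hom[OF _ S iso] graph_hom_trans by metis
  ultimately show False using core by (auto simp: graph_core_def)
qed


section \<open>Maps given by rotation systems\<close>

definition cyc_next :: "'a list \<Rightarrow> 'a \<Rightarrow> 'a" where
  "cyc_next xs v = the (map_of (zip xs (rotate1 xs)) v)"

definition cyc_prev :: "'a list \<Rightarrow> 'a \<Rightarrow> 'a" where
  "cyc_prev xs v = the (map_of (zip (rotate1 xs) xs) v)"

lemma cyc_next_nth: "distinct xs \<Longrightarrow> i < length xs \<Longrightarrow> cyc_next xs (xs ! i) = rotate1 xs ! i"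
  by (simp add: cyc_next_def map_of_zip_nth)

lemma cyc_prev_nth: "distinct xs \<Longrightarrow> i < length xs \<Longrightarrow> cyc_prev xs (rotate1 xs ! i) = xs ! i"
  by (simp add: cyc_prev_def map_of_zip_nth)

lemma cyc_next_props:
  assumes "distinct xs" "v \<in> set xs"
  shows "cyc_next xs v \<in> set xs" "cyc_prev xs (cyc_next xs v) = v"
    "cyc_prev xs v \<in> set xs" "cyc_next xs (cyc_prev xs v) = v"
proof -
  obtain i where i: "i < length xs" "v = xs ! i" using assms(2) by (auto simp: in_set_conv_nth)
  show "cyc_next xs v \<in> set xs" "cyc_prev xs (cyc_next xs v) = v"
    using i assms(1) nth_mem[of i "rotate1 xs"] by (simp_all add: cyc_next_nth cyc_prev_nth)
  obtain j where j: "j < length xs" "v = rotate1 xs ! j"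
    using assms(2) set_rotate1[of xs] by (metis in_set_conv_nth length_rotate1)
  show "cyc_prev xs v \<in> set xs" "cyc_next xs (cyc_prev xs v) = v"
    using j assms(1) by (simp_all add: cyc_next_nth cyc_prev_nth)
qed

text \<open>
  The flag \<open>(u, v, s)\<close> is the end at \<open>u\<close> of the edge from \<open>u\<close> to \<open>v\<close>, together with one of the two
  sides of the edge.
\<close>

type_synonym 'v flag = "'v \<times> 'v \<times> bool"

definition flags :: "'v set \<Rightarrow> ('v \<Rightarrow> 'v list) \<Rightarrow> 'v flag set" where
  "flags V rot = {(u, v, s). u \<in> V \<and> v \<in> set (rot u)}"

text \<open>A side is named as seen from the end \<open>u\<close>, so its name changes when
  \<open>flag0\<close> passes to the other end. Together with \<open>flag1\<close> this makes the
  vertex permutation act on flags with side \<open>True\<close> as \<open>cyc_next\<close>, and the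
  face permutation send the dart \<open>(u, v)\<close> to
  \<open>(v, cyc_next (rot v) u)\<close>.\<close>

fun flag0 flag2 :: "'v flag \<Rightarrow> 'v flag" where
  "flag0 (u, v, s) = (v, u, \<not> s)"
| "flag2 (u, v, s) = (u, v, \<not> s)"

fun flag1 :: "('v \<Rightarrow> 'v list) \<Rightarrow> 'v flag \<Rightarrow> 'v flag" where
  "flag1 rot (u, v, s) = (u, (if s then cyc_prev else cyc_next) (rot u) v, \<not> s)"

text \<open>Coding by natural numbers puts all maps into the type \<open>nat cmap\<close>; off the
  codes the value is the identity, as \<open>is_map\<close> requires.\<close>

definition on_codes :: "'b::countable set \<Rightarrow> ('b \<Rightarrow> 'b) \<Rightarrow> nat \<Rightarrow> nat" where
  "on_codes C f x = (if x \<in> to_nat ` C then to_nat (f (from_nat x)) else x)"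

definition rotation_map :: "'v::countable set \<Rightarrow> ('v \<Rightarrow> 'v list) \<Rightarrow> nat cmap" where
  "rotation_map V rot = \<lparr>crosses = to_nat ` flags V rot,
     al0 = on_codes (flags V rot) flag0,
     al1 = on_codes (flags V rot) (flag1 rot),
     al2 = on_codes (flags V rot) flag2,
     isol = 0\<rparr>"

locale rotation_system =
  fixes V :: "'v::countable set" and rot :: "'v \<Rightarrow> 'v list"
  assumes finite_V: "finite V"
    and distinct_rot: "u \<in> V \<Longrightarrow> distinct (rot u)"
    and rot_nonempty: "u \<in> V \<Longrightarrow> rot u \<noteq> []"
    and rot_sym: "u \<in> V \<Longrightarrow> v \<in> set (rot u) \<Longrightarrow> v \<in> V \<and> v \<noteq> u \<and> u \<in> set (rot v)"
begin

abbreviation "M \<equiv> rotation_map V rot"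

definition vcode :: "'v \<Rightarrow> nat set" where
  "vcode u = to_nat ` ({u} \<times> set (rot u) \<times> (UNIV :: bool set))"

definition ecode :: "'v \<Rightarrow> 'v \<Rightarrow> nat set" where
  "ecode u v = to_nat ` {(u, v, True), (u, v, False), (v, u, True), (v, u, False)}"

lemma rotation_map_simps:
  "crosses M = to_nat ` flags V rot" "isol M = 0"
  "x \<in> flags V rot \<Longrightarrow> al0 M (to_nat x) = to_nat (flag0 x)"
  "x \<in> flags V rot \<Longrightarrow> al1 M (to_nat x) = to_nat (flag1 rot x)"
  "x \<in> flags V rot \<Longrightarrow> al2 M (to_nat x) = to_nat (flag2 x)"
  by (simp_all add: rotation_map_def on_codes_def)

lemma rotation_crossE:
  assumes "x \<in> crosses M"
  obtains u v s where "u \<in> V" "v \<in> set (rot u)" "(u, v, s) \<in> flags V rot" "x = to_nat (u, v, s)"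
proof -
  obtain y where y: "y \<in> flags V rot" "x = to_nat y"
    using assms by (auto simp: rotation_map_simps)
  then show thesis using that by (cases y) (auto simp: flags_def)
qed

lemma flag_closed:
  assumes "x \<in> flags V rot"
  shows "flag0 x \<in> flags V rot" "flag1 rot x \<in> flags V rot" "flag2 x \<in> flags V rot"
proof -
  obtain u v s where x: "x = (u, v, s)" by (cases x)
  then have uv: "u \<in> V" "v \<in> set (rot u)" using assms by (simp_all add: flags_def)
  then show "flag0 x \<in> flags V rot" "flag1 rot x \<in> flags V rot" "flag2 x \<in> flags V rot"
    using rot_sym[OF uv] cyc_next_props[OF distinct_rot[OF uv(1)] uv(2)]
    by (simp_all add: x flags_def)
qed

lemma flag_invol:
  assumes "x \<in> flags V rot"
  shows "flag0 (flag0 x) = x" "flag1 rot (flag1 rot x) = x" "flag2 (flag2 x) = x"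
proof -
  obtain u v s where x: "x = (u, v, s)" by (cases x)
  then have uv: "u \<in> V" "v \<in> set (rot u)" using assms by (simp_all add: flags_def)
  then show "flag0 (flag0 x) = x" "flag1 rot (flag1 rot x) = x" "flag2 (flag2 x) = x"
    using cyc_next_props[OF distinct_rot[OF uv(1)] uv(2)] by (simp_all add: x)
qed

lemma flag_neq: "flag0 x \<noteq> x" "flag1 rot x \<noteq> x" "flag2 x \<noteq> x"
  by (cases x; auto)+

lemma finite_flags: "finite (flags V rot)"
proof -
  have "flags V rot \<subseteq> V \<times> V \<times> UNIV" using rot_sym by (auto simp: flags_def)
  then show ?thesis using finite_V by (meson finite_SigmaI finite finite_subset)
qed

lemma fpf_on_codes:
  assumes "\<And>x. x \<in> C \<Longrightarrow> f x \<in> C \<and> f (f x) = x \<and> f x \<noteq> x"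
  shows "fpf_involution_on (to_nat ` C) (on_codes C f)"
proof (rule fpf_involutionI)
  fix x assume "x \<in> to_nat ` C"
  then obtain y where y: "y \<in> C" "x = to_nat y" by blast
  have "f y \<in> C" "f (f y) = y" "f y \<noteq> y" using assms[OF y(1)] by simp_all
  then show "on_codes C f x \<in> to_nat ` C \<and> on_codes C f (on_codes C f x) = x \<and>
      on_codes C f x \<noteq> x"
    using y by (simp add: on_codes_def)
qed (simp add: on_codes_def)

lemma is_map_rotation_map: "is_map M"
proof -
  have "fpf_involution_on (crosses M) (al0 M)" "fpf_involution_on (crosses M) (al1 M)"
    "fpf_involution_on (crosses M) (al2 M)"
    unfolding rotation_map_def cmap.simps
    by (rule fpf_on_codes; intro conjI flag_closed flag_invol flag_neq; assumption)+
  moreover have "al0 M (al2 M x) = al2 M (al0 M x)" for x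
  proof (cases "x \<in> crosses M")
    case True
    then obtain y where y: "y \<in> flags V rot" "x = to_nat y" by (auto simp: rotation_map_simps)
    moreover have "flag0 (flag2 y) = flag2 (flag0 y)" by (cases y) simp
    ultimately show ?thesis by (simp add: rotation_map_simps flag_closed)
  qed (simp add: rotation_map_def on_codes_def)
  moreover have "al0 M x \<noteq> al2 M x" if x: "x \<in> crosses M" for x
  proof -
    obtain u v s where y: "(u, v, s) \<in> flags V rot" "x = to_nat (u, v, s :: bool)"
      using x by (rule rotation_crossE) blast
    have "u \<noteq> v" using y(1) rot_sym by (auto simp: flags_def)
    then show ?thesis using y(1) by (simp add: y(2) rotation_map_simps)
  qed
  ultimately show ?thesis
    using finite_flags by (auto simp: is_map_def rotation_map_simps)
qed

lemma rotation_involutions: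
  "F \<subseteq> {al0 M, al1 M, al2 M} \<Longrightarrow> involutions_on F (crosses M)"
  by (rule map_involutions[OF is_map_rotation_map])

lemma orbit_al:
  assumes "x \<in> flags V rot" "to_nat x \<in> gorbit F y"
  shows "al0 M \<in> F \<Longrightarrow> to_nat (flag0 x) \<in> gorbit F y"
    "al1 M \<in> F \<Longrightarrow> to_nat (flag1 rot x) \<in> gorbit F y"
    "al2 M \<in> F \<Longrightarrow> to_nat (flag2 x) \<in> gorbit F y"
  using gorbit_step[OF assms(2), of "al0 M"] gorbit_step[OF assms(2), of "al1 M"]
    gorbit_step[OF assms(2), of "al2 M"]
  unfolding rotation_map_simps(3-5)[OF assms(1)] by simp_all

text \<open>Alternating \<open>al2\<close> and \<open>al1\<close> advances by one entry of the list.
  From any entry this reaches the last one, and one more step wraps round to the head, which serves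
  as the representative of the vertex in vertex orbits and in components.\<close>

lemma orbit_rotate:
  assumes F: "al1 M \<in> F" "al2 M \<in> F" and u: "u \<in> V" "v \<in> set (rot u)"
    and v: "to_nat (u, v, s :: bool) \<in> gorbit F y"
  shows "to_nat (u, hd (rot u), True) \<in> gorbit F y"
proof -
  let ?xs = "rot u"
  have flag: "(u, w, s') \<in> flags V rot" if "w \<in> set ?xs" for w s'
    using that u by (simp add: flags_def)
  have step: "to_nat (u, rotate1 ?xs ! i, True) \<in> gorbit F y"
    if "to_nat (u, ?xs ! i, True) \<in> gorbit F y" "i < length ?xs" for i
  proof -
    have "to_nat (u, ?xs ! i, False) \<in> gorbit F y"
      using orbit_al(3)[OF flag that(1) F(2)] that(2) by simp
    then show ?thesis
      using orbit_al(2)[OF flag _ F(1), of "?xs ! i" False y] that(2)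
        cyc_next_nth[OF distinct_rot[OF u(1)] that(2)] by simp
  qed
  obtain i where i: "i < length ?xs" "v = ?xs ! i" using u(2) by (auto simp: in_set_conv_nth)
  have "to_nat (u, ?xs ! i, True) \<in> gorbit F y"
    using v orbit_al(3)[OF flag[OF u(2)] v F(2)] u(2) i by (cases s) auto
  then have "to_nat (u, ?xs ! (i + k), True) \<in> gorbit F y" if "i + k < length ?xs" for k
    using that
  proof (induction k)
    case (Suc k)
    then show ?case using step[of "i + k"] by (simp add: nth_rotate1)
  qed simp
  from this[of "length ?xs - 1 - i"]
  have "to_nat (u, ?xs ! (length ?xs - 1), True) \<in> gorbit F y" using i by simp
  then have "to_nat (u, rotate1 ?xs ! (length ?xs - 1), True) \<in> gorbit F y"
    by (rule step) (use i in auto)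
  then show ?thesis using i by (cases ?xs) (auto simp: nth_rotate1 hd_conv_nth)
qed

lemma vertex_orbit_code:
  assumes "u \<in> V" "v \<in> set (rot u)"
  shows "gorbit {al1 M, al2 M} (to_nat (u, v, s :: bool)) = vcode u"
proof -
  let ?L = "\<lambda>x. fst (from_nat x :: 'v flag)"
  let ?d = "\<lambda>u. to_nat (u, hd (rot u), True)"
  have inv: "involutions_on {al1 M, al2 M} (crosses M)" by (rule rotation_involutions) auto
  have 1: "?L (f x) = ?L x" if "f \<in> {al1 M, al2 M}" "x \<in> crosses M" for f x
    using that by (auto simp: rotation_map_simps)
  have 2: "?d (?L x) \<in> gorbit {al1 M, al2 M} x" if "x \<in> crosses M" for x
    using that orbit_rotate[OF _ _ _ _ gorbit_self, of "{al1 M, al2 M}"]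
    by (auto simp: rotation_map_simps flags_def)
  have label: "gorbit {al1 M, al2 M} x = {y \<in> crosses M. ?L y = ?L x}" if "x \<in> crosses M" for x
    by (rule gorbits_by_label(1)[where d = ?d]) (fact inv, fact 1, fact 2, fact that)
  have "to_nat (u, v, s) \<in> crosses M" using assms by (auto simp: rotation_map_simps flags_def)
  then show "gorbit {al1 M, al2 M} (to_nat (u, v, s)) = vcode u"
    using label assms by (auto simp: rotation_map_simps flags_def vcode_def)
qed

lemma flags_image: "(\<lambda>(u, v, s). g u v) ` flags V rot = {g u v | u v. u \<in> V \<and> v \<in> set (rot u)}"
  (is "?L = ?R")
proof
  show "?L \<subseteq> ?R" by (auto simp: flags_def)
  show "?R \<subseteq> ?L"
  proof
    fix z assume "z \<in> ?R"
    then obtain u v where "u \<in> V" "v \<in> set (rot u)" "z = g u v" by blast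
    then show "z \<in> ?L" by (intro image_eqI[of _ _ "(u, v, True)"]) (auto simp: flags_def)
  qed
qed

lemma rotation_map_vertex_orbits: "vertex_orbits M = vcode ` V"
proof -
  have "vertex_orbits M = (\<lambda>(u, v, s). vcode u) ` flags V rot"
    unfolding vertex_orbits_def gorbits_def rotation_map_simps image_image
    by (rule image_cong) (auto simp: flags_def vertex_orbit_code)
  also have "\<dots> = vcode ` V"
    unfolding flags_image[of "\<lambda>u _. vcode u"] using rot_nonempty by (fastforce simp: neq_Nil_conv)
  finally show ?thesis .
qed

lemma vcode_inj: "inj_on vcode V"
proof (rule inj_onI)
  fix u u' assume *: "u \<in> V" "u' \<in> V" "vcode u = vcode u'"
  have "to_nat (u, hd (rot u), True) \<in> vcode u" using rot_nonempty[OF *(1)] by (auto simp: vcode_def)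
  then show "u = u'" using * by (auto simp: vcode_def)
qed

lemma edge_orbit_code:
  assumes "(u, v, s) \<in> flags V rot"
  shows "gorbit {al0 M, al2 M} (to_nat (u, v, s)) = ecode u v"
proof -
  have "to_nat (u, v, s) \<in> crosses M" using assms by (auto simp: rotation_map_simps)
  then have "gorbit {al0 M, al2 M} (to_nat (u, v, s)) =
      to_nat ` {(u, v, s), (v, u, \<not> s), (u, v, \<not> s), (v, u, s)}"
    using edge_orbit_eq[OF is_map_rotation_map] assms flag_closed(3)[OF assms]
    by (simp add: rotation_map_simps)
  then show ?thesis by (cases s) (auto simp: ecode_def)
qed

lemma rotation_map_edge_orbits: "edge_orbits M = {ecode u v | u v. u \<in> V \<and> v \<in> set (rot u)}"
proof -
  have "edge_orbits M = (\<lambda>(u, v, s). ecode u v) ` flags V rot"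
    unfolding edge_orbits_def gorbits_def rotation_map_simps image_image
    by (rule image_cong) (auto simp: edge_orbit_code)
  then show ?thesis unfolding flags_image .
qed

lemma ecode_eq_iff: "ecode u v = ecode u' v' \<longleftrightarrow> {u, v} = {u', v'}"
proof
  assume "ecode u v = ecode u' v'"
  moreover have "to_nat (u, v, True) \<in> ecode u v" by (simp add: ecode_def)
  ultimately have "to_nat (u, v, True) \<in> ecode u' v'" by simp
  then show "{u, v} = {u', v'}" by (auto simp: ecode_def)
qed (auto simp: ecode_def doubleton_eq_iff)

lemma gends_rotation_map:
  assumes "u \<in> V" "v \<in> set (rot u)"
  shows "gends (underlying_graph M) (ecode u v) = {Inl (vcode u), Inl (vcode v)}"
proof -
  have e: "ecode u v \<in> edge_orbits M" using assms by (auto simp: rotation_map_edge_orbits)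
  have "v \<in> V" "u \<in> set (rot v)" using rot_sym[OF assms] by auto
  then show ?thesis
    unfolding gends_underlying[OF is_map_rotation_map e]
    using assms by (auto simp: ecode_def vertex_orbit_code)
qed

lemma gverts_rotation_map: "gverts (underlying_graph M) = (Inl \<circ> vcode) ` V"
  by (simp add: underlying_graph_def rotation_map_vertex_orbits rotation_map_simps image_comp)

lemma gedges_rotation_map: "gedges (underlying_graph M) = {ecode u v | u v. u \<in> V \<and> v \<in> set (rot u)}"
  by (simp add: underlying_graph_def rotation_map_edge_orbits)

lemma finite_graph_rotation_map: "finite_graph (underlying_graph M)"
proof -
  have "finite (gedges (underlying_graph M))"
    unfolding gedges_rotation_map flags_image[symmetric] using finite_flags by (rule finite_imageI)
  moreover have "gends (underlying_graph M) e \<subseteq> gverts (underlying_graph M) \<and>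
      card (gends (underlying_graph M) e) \<in> {1, 2}" if e: "e \<in> gedges (underlying_graph M)" for e
  proof -
    obtain u v where uv: "u \<in> V" "v \<in> set (rot u)" "e = ecode u v"
      using e unfolding gedges_rotation_map by blast
    show ?thesis
      using rot_sym[OF uv(1,2)] uv(1)
      unfolding uv(3) gends_rotation_map[OF uv(1,2)] gverts_rotation_map
      by (simp add: card_insert_if)
  qed
  ultimately show ?thesis using finite_V by (simp add: finite_graph_def gverts_rotation_map)
qed

text \<open>Handshake: every edge comes from exactly two darts.\<close>

lemma rotation_map_num_edges: "2 * num_edges M = (\<Sum>u\<in>V. length (rot u))"
proof -
  let ?D = "SIGMA u:V. set (rot u)"
  have fin: "finite ?D" using finite_V by simp
  have sub: "ecode u v = ecode u' v' \<longleftrightarrow> (u', v') \<in> {(u, v), (v, u)}" for u v u' v'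
    by (auto simp: ecode_eq_iff doubleton_eq_iff)
  have img: "edge_orbits M = case_prod ecode ` ?D" by (auto simp: rotation_map_edge_orbits)
  have "card ?D = (\<Sum>e\<in>case_prod ecode ` ?D. card {x \<in> ?D. case_prod ecode x = e})"
    using sum.image_gen[OF fin, of "\<lambda>_. 1 :: nat" "case_prod ecode"] by simp
  also have "\<dots> = (\<Sum>e\<in>case_prod ecode ` ?D. 2)"
  proof (rule sum.cong[OF refl])
    fix e assume "e \<in> case_prod ecode ` ?D"
    then obtain u v where uv: "u \<in> V" "v \<in> set (rot u)" "e = ecode u v" by auto
    have "{x \<in> ?D. case_prod ecode x = e} = {(u, v), (v, u)}"
    proof -
      have "ecode v u = ecode u v" by (simp add: sub)
      then have "{(u, v), (v, u)} \<subseteq> {x \<in> ?D. case_prod ecode x = e}"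
        using uv rot_sym[OF uv(1,2)] by simp
      moreover have "{x \<in> ?D. case_prod ecode x = e} \<subseteq> {(u, v), (v, u)}"
        unfolding uv(3) by (auto simp: sub)
      ultimately show ?thesis by blast
    qed
    then show "card {x \<in> ?D. case_prod ecode x = e} = 2" using rot_sym[OF uv(1,2)] by simp
  qed
  finally have "card ?D = 2 * num_edges M" by (simp add: num_edges_def img)
  moreover have "card ?D = (\<Sum>u\<in>V. length (rot u))"
    using finite_V distinct_rot by (simp add: distinct_card)
  ultimately show ?thesis by simp
qed

text \<open>The graph of the face permutation on the darts, that is, on the flags with side
  \<open>True\<close>.\<close>

definition face_steps :: "(('v \<times> 'v) \<times> ('v \<times> 'v)) set" where
  "face_steps = {((u, v), (v, cyc_next (rot v) u)) | u v. u \<in> V \<and> v \<in> set (rot u)}"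

text \<open>\<open>al0\<close> and \<open>al1\<close> both change the side, so a face is run through
  in two directions, once for each side. A flag with side \<open>False\<close> takes the label of
  its \<open>flag0\<close> image, which is the reversed dart with side \<open>True\<close>; so
  labels and connections are needed for darts only.\<close>

lemma rotation_map_num_faces:
  assumes inv: "\<And>u v. u \<in> V \<Longrightarrow> v \<in> set (rot u) \<Longrightarrow> face v (cyc_next (rot v) u) = face u v"
    and conn: "\<And>u v. u \<in> V \<Longrightarrow> v \<in> set (rot u) \<Longrightarrow>
      ((u, v), d (face u v)) \<in> (face_steps \<union> face_steps\<inverse>)\<^sup>*"
  shows "num_faces M = card {face u v | u v. u \<in> V \<and> v \<in> set (rot u)}"
proof -
  let ?F = "{al0 M, al1 M}"
  let ?l = "\<lambda>(u, v, s). if s then face u v else face v u"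
  let ?L = "\<lambda>x. ?l (from_nat x :: 'v flag)"
  let ?d = "\<lambda>f. to_nat (fst (d f), snd (d f), True)"
  have invol: "involutions_on ?F (crosses M)" by (rule rotation_involutions) auto
  have l0: "?l (flag0 x) = ?l x" for x by (cases x) simp
  have l1: "?l (flag1 rot x) = ?l x" if x: "x \<in> flags V rot" for x
  proof -
    obtain u v s where x_eq: "x = (u, v, s)" by (cases x)
    then have uv: "u \<in> V" "v \<in> set (rot u)" using x by (auto simp: flags_def)
    have v': "cyc_prev (rot u) v \<in> set (rot u)" "cyc_next (rot u) (cyc_prev (rot u) v) = v"
      using cyc_next_props[OF distinct_rot[OF uv(1)] uv(2)] by auto
    show ?thesis
    proof (cases s)
      case True
      then show ?thesis using inv[of "cyc_prev (rot u) v" u] rot_sym[OF uv(1) v'(1)] v'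
        by (simp add: x_eq)
    next
      case False
      then show ?thesis using inv[of v u] rot_sym[OF uv] by (simp add: x_eq)
    qed
  qed
  have 1: "?L (f x) = ?L x" if f: "f \<in> ?F" and x: "x \<in> crosses M" for f x
  proof -
    obtain y where y: "y \<in> flags V rot" "x = to_nat y" using x by (auto simp: rotation_map_simps)
    have "?L (al0 M x) = ?l (flag0 y)" "?L (al1 M x) = ?l (flag1 rot y)" "?L x = ?l y"
      using y by (simp_all add: rotation_map_simps)
    then show ?thesis using f l0[of y] l1[OF y(1)] by auto
  qed
  have face_step: "to_nat (v, cyc_next (rot v) u, True) \<in> gorbit ?F (to_nat (u, v, True))"
    if "u \<in> V" "v \<in> set (rot u)" for u v
  proof -
    have "(u, v, True) \<in> flags V rot" "(v, u, False) \<in> flags V rot"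
      using that rot_sym[OF that] by (auto simp: flags_def)
    then show ?thesis
      using orbit_al(2)[of "(v, u, False)" ?F] orbit_al(1)[OF _ gorbit_self, of "(u, v, True)" ?F]
      by simp
  qed
  have dart_in: "to_nat (u, v, s :: bool) \<in> crosses M \<longleftrightarrow> u \<in> V \<and> v \<in> set (rot u)" for u v s
    by (auto simp: rotation_map_simps flags_def)
  have reach: "to_nat (fst q, snd q, True) \<in> gorbit ?F (to_nat (fst p, snd p, True)) \<and>
      to_nat (fst q, snd q, True) \<in> crosses M"
    if "(p, q) \<in> (face_steps \<union> face_steps\<inverse>)\<^sup>*" "to_nat (fst p, snd p, True) \<in> crosses M" for p q
    using that(1)
  proof (induction rule: rtrancl_induct)
    case base then show ?case using that(2) by (simp add: gorbit_self)
  next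
    case (step q r)
    have sub: "gorbit ?F z \<subseteq> crosses M" if "z \<in> crosses M" for z
      using gorbit_subset[OF invol] that by blast
    have "to_nat (fst r, snd r, True) \<in> gorbit ?F (to_nat (fst q, snd q, True))"
      using step.hyps(2)
    proof
      assume "(q, r) \<in> face_steps"
      then show ?thesis using face_step by (auto simp: face_steps_def)
    next
      assume "(q, r) \<in> face_steps\<inverse>"
      then obtain u v where uv: "u \<in> V" "v \<in> set (rot u)" "r = (u, v)" "q = (v, cyc_next (rot v) u)"
        by (auto simp: face_steps_def)
      then show ?thesis
        using gorbit_sym[OF invol _ face_step[OF uv(1,2)]] dart_in by simp
    qed
    with step.IH[THEN conjunct1]
    have "to_nat (fst r, snd r, True) \<in> gorbit ?F (to_nat (fst p, snd p, True))"
      by (rule gorbit_trans)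
    then show ?case using sub[OF that(2)] by blast
  qed
  have 2: "?d (?L x) \<in> gorbit ?F x" if x: "x \<in> crosses M" for x
  proof -
    obtain u v s where y: "u \<in> V" "v \<in> set (rot u)" "x = to_nat (u, v, s :: bool)"
      using x by (rule rotation_crossE) blast
    have flag: "(u, v, s) \<in> flags V rot" using y by (simp add: flags_def)
    note sym = rot_sym[OF y(1,2)]
    show ?thesis
    proof (cases s)
      case True
      then show ?thesis using reach[OF conn[OF y(1,2)]] y dart_in by simp
    next
      case False
      have "to_nat (v, u, True) \<in> gorbit ?F x"
        using orbit_al(1)[OF flag, of ?F x] gorbit_self[of x ?F] False y(3) by simp
      moreover have "?d (face v u) \<in> gorbit ?F (to_nat (v, u, True))"
        using reach[OF conn, of v u] sym dart_in by simp
      ultimately have "?d (face v u) \<in> gorbit ?F x" by (rule gorbit_trans)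
      then show ?thesis using False y(3) by simp
    qed
  qed
  have "card (face_orbits M) = card (?L ` crosses M)"
    unfolding face_orbits_def
    by (rule gorbits_by_label(2)[where d = ?d]) (fact invol, fact 1, fact 2)
  moreover have "?L ` crosses M = ?l ` flags V rot"
    by (simp add: rotation_map_simps image_image)
  moreover have "?l ` flags V rot = {face u v | u v. u \<in> V \<and> v \<in> set (rot u)}"
    (is "_ = ?R")
  proof
    show "?l ` flags V rot \<subseteq> ?R"
    proof
      fix z assume "z \<in> ?l ` flags V rot"
      then obtain u v s where uv: "u \<in> V" "v \<in> set (rot u)" "z = (if s then face u v else face v u)"
        by (auto simp: flags_def)
      then show "z \<in> ?R" using rot_sym[OF uv(1,2)] by (cases s) (simp; blast)+
    qed
    show "?R \<subseteq> ?l ` flags V rot"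
    proof
      fix z assume "z \<in> ?R"
      then obtain u v where "u \<in> V" "v \<in> set (rot u)" "z = face u v" by blast
      then show "z \<in> ?l ` flags V rot"
        by (intro image_eqI[of _ _ "(u, v, True)"]) (auto simp: flags_def)
    qed
  qed
  ultimately show ?thesis by (simp add: num_faces_def rotation_map_simps)
qed

lemma rotation_map_num_comps:
  assumes inv: "\<And>u v. u \<in> V \<Longrightarrow> v \<in> set (rot u) \<Longrightarrow> cl v = cl u"
    and conn: "\<And>u. u \<in> V \<Longrightarrow> (u, d (cl u)) \<in> {(u, v). u \<in> V \<and> v \<in> set (rot u)}\<^sup>*"
  shows "num_comps M = card (cl ` V)"
proof -
  let ?F = "{al0 M, al1 M, al2 M}"
  let ?L = "\<lambda>x. cl (fst (from_nat x :: 'v flag))"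
  let ?h = "\<lambda>u. to_nat (u, hd (rot u), True)"
  let ?d = "\<lambda>c. ?h (d c)"
  have invol: "involutions_on ?F (crosses M)" by (rule rotation_involutions) auto
  have 1: "?L (f x) = ?L x" if f: "f \<in> ?F" and x: "x \<in> crosses M" for f x
  proof -
    obtain u v s where y: "u \<in> V" "v \<in> set (rot u)" "x = to_nat (u, v, s :: bool)"
      using x by (rule rotation_crossE) blast
    then have "(u, v, s) \<in> flags V rot" by (simp add: flags_def)
    then show ?thesis using f y inv[OF y(1,2)] by (auto simp: rotation_map_simps)
  qed
  have to_h: "?h u \<in> gorbit ?F (to_nat (u, v, s :: bool))" if "u \<in> V" "v \<in> set (rot u)" for u v s
    by (rule orbit_rotate[OF _ _ that gorbit_self]) auto
  have h_in: "?h u \<in> crosses M" if "u \<in> V" for u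
    using rot_nonempty[OF that] that by (auto simp: rotation_map_simps flags_def)
  have edge_step: "?h v \<in> gorbit ?F (?h u)" if uv: "u \<in> V" "v \<in> set (rot u)" for u v
  proof -
    note sym = rot_sym[OF uv]
    have f: "(u, v, True) \<in> flags V rot" using uv by (auto simp: flags_def)
    then have "to_nat (u, v, True) \<in> crosses M" by (auto simp: rotation_map_simps)
    then have "to_nat (u, v, True) \<in> gorbit ?F (?h u)"
      using gorbit_sym[OF invol _ to_h[OF uv]] by blast
    then have "to_nat (v, u, False) \<in> gorbit ?F (?h u)" using orbit_al(1)[OF f, of ?F "?h u"] by simp
    moreover have "?h v \<in> gorbit ?F (to_nat (v, u, False))" using to_h[of v u] sym by simp
    ultimately show ?thesis by (rule gorbit_trans)
  qed
  have reach: "?h w \<in> gorbit ?F (?h u)"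
    if "(u, w) \<in> {(u, v). u \<in> V \<and> v \<in> set (rot u)}\<^sup>*" for u w
    using that
  proof (induction rule: rtrancl_induct)
    case base then show ?case by (rule gorbit_self)
  next
    case (step w z)
    then have "w \<in> V" "z \<in> set (rot w)" by auto
    then show ?case using gorbit_trans[OF step.IH edge_step] by blast
  qed
  have 2: "?d (?L x) \<in> gorbit ?F x" if x: "x \<in> crosses M" for x
  proof -
    obtain u v s where y: "u \<in> V" "v \<in> set (rot u)" "x = to_nat (u, v, s :: bool)"
      using x by (rule rotation_crossE) blast
    have "?h (d (cl u)) \<in> gorbit ?F x"
      using gorbit_trans[OF to_h[OF y(1,2)] reach[OF conn[OF y(1)]]] y(3) by simp
    then show ?thesis by (simp add: y(3))
  qed
  have "card (comp_orbits M) = card (?L ` crosses M)"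
    unfolding comp_orbits_def
    by (rule gorbits_by_label(2)[where d = ?d]) (fact invol, fact 1, fact 2)
  moreover have "?L ` crosses M = cl ` V"
  proof
    show "?L ` crosses M \<subseteq> cl ` V" by (auto simp: rotation_map_simps flags_def)
    show "cl ` V \<subseteq> ?L ` crosses M"
    proof
      fix c assume "c \<in> cl ` V"
      then obtain u where "u \<in> V" "c = cl u" by blast
      then show "c \<in> ?L ` crosses M" using h_in[of u] by (intro image_eqI[of _ _ "?h u"]) auto
    qed
  qed
  ultimately show ?thesis by (simp add: num_comps_def rotation_map_simps)
qed

lemma rotation_map_num_verts: "num_verts M = card V"
  using rotation_map_vertex_orbits card_image[OF vcode_inj] by (simp add: num_verts_def rotation_map_simps)

end


text \<open>Reduces graph homomorphisms to adjacency-preserving vertex maps. The link to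
  \<open>fv\<close> is kept because the core argument needs to know that the images under
  \<open>fv\<close> lie in the subgraph.\<close>

lemma graph_hom_on_vertices:
  assumes V: "rotation_system V rot" and W: "rotation_system W rot'"
    and fv: "fv ` gverts (underlying_graph (rotation_map V rot)) \<subseteq>
      gverts (underlying_graph (rotation_map W rot'))"
    and fe: "\<And>e. e \<in> gedges (underlying_graph (rotation_map V rot)) \<Longrightarrow>
      fe e \<in> gedges (underlying_graph (rotation_map W rot')) \<and>
      gends (underlying_graph (rotation_map W rot')) (fe e) =
        fv ` gends (underlying_graph (rotation_map V rot)) e"
  shows "\<exists>\<phi>. (\<forall>u\<in>V. \<phi> u \<in> W \<and>
      fv (Inl (rotation_system.vcode rot u)) = Inl (rotation_system.vcode rot' (\<phi> u)) \<and>
      (\<forall>v\<in>set (rot u). \<phi> v \<in> set (rot' (\<phi> u))))"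
proof -
  interpret V: rotation_system V rot by (fact V)
  interpret W: rotation_system W rot' by (fact W)
  have "\<exists>w. w \<in> W \<and> fv (Inl (V.vcode u)) = Inl (W.vcode w)" if "u \<in> V" for u
    using fv that unfolding V.gverts_rotation_map W.gverts_rotation_map by auto
  then obtain \<phi> where \<phi>: "\<And>u. u \<in> V \<Longrightarrow> \<phi> u \<in> W \<and> fv (Inl (V.vcode u)) = Inl (W.vcode (\<phi> u))"
    by metis
  have "\<phi> v \<in> set (rot' (\<phi> u))" if uv: "u \<in> V" "v \<in> set (rot u)" for u v
  proof -
    have v: "v \<in> V" using V.rot_sym[OF uv] by simp
    have e: "V.ecode u v \<in> gedges (underlying_graph (rotation_map V rot))"
      using uv by (auto simp: V.gedges_rotation_map)
    obtain a b where ab: "a \<in> W" "b \<in> set (rot' a)" "fe (V.ecode u v) = W.ecode a b"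
      using fe[OF e] unfolding W.gedges_rotation_map by blast
    have "{Inl (W.vcode a), Inl (W.vcode b)} =
        fv ` gends (underlying_graph (rotation_map V rot)) (V.ecode u v)"
      using fe[OF e] W.gends_rotation_map[OF ab(1,2)] ab(3) by simp
    also have "\<dots> = {Inl (W.vcode (\<phi> u)), Inl (W.vcode (\<phi> v))}"
      using \<phi>[OF uv(1)] \<phi>[OF v] by (simp add: V.gends_rotation_map[OF uv])
    finally have "W.vcode ` {a, b} = W.vcode ` {\<phi> u, \<phi> v}"
      by (auto simp: doubleton_eq_iff)
    moreover have b: "b \<in> W" "a \<in> set (rot' b)" using W.rot_sym[OF ab(1,2)] by auto
    ultimately have "{a, b} = {\<phi> u, \<phi> v}"
      using inj_on_image_eq_iff[OF W.vcode_inj, of "{a, b}" "{\<phi> u, \<phi> v}"] ab(1) \<phi>[OF uv(1)] \<phi>[OF v]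
      by simp
    then show ?thesis using ab(2) b(2) by (auto simp: doubleton_eq_iff)
  qed
  with \<phi> show ?thesis by blast
qed

context rotation_system
begin

text \<open>An injective endomorphism of a finite graph is bijective on vertices. Edges are
  determined by their ends, so it is injective, hence bijective, on edges as well, and a subgraph
  containing the image is the whole graph.\<close>

lemma graph_core_rotation_map:
  assumes inj: "\<And>\<phi>. (\<And>u. u \<in> V \<Longrightarrow> \<phi> u \<in> V) \<Longrightarrow>
    (\<And>u v. u \<in> V \<Longrightarrow> v \<in> set (rot u) \<Longrightarrow> \<phi> v \<in> set (rot (\<phi> u))) \<Longrightarrow> inj_on \<phi> V"
  shows "graph_core (underlying_graph M)"
  unfolding graph_core_def
proof (intro conjI notI finite_graph_rotation_map)
  let ?G = "underlying_graph M"
  assume "\<exists>H. proper_subgraph H ?G \<and> graph_hom ?G H"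
  then obtain H where H: "proper_subgraph H ?G" "graph_hom ?G H" by blast
  from H(2)[unfolded graph_hom_def] obtain fv fe where
    fv: "fv ` gverts ?G \<subseteq> gverts H" and fe: "fe ` gedges ?G \<subseteq> gedges H"
    and ends: "\<forall>e\<in>gedges ?G. gends H (fe e) = fv ` gends ?G e"
    by (elim exE conjE) (rule that)
  have sub: "gverts H \<subseteq> gverts ?G" "gedges H \<subseteq> gedges ?G"
    "\<And>e. e \<in> gedges H \<Longrightarrow> gends H e = gends ?G e"
    using H(1) unfolding proper_subgraph_def subgraph_def by simp_all
  have fv': "fv ` gverts ?G \<subseteq> gverts ?G" using fv sub(1) by (rule subset_trans)
  have fe': "fe e \<in> gedges ?G \<and> gends ?G (fe e) = fv ` gends ?G e" if "e \<in> gedges ?G" for e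
  proof -
    have "fe e \<in> gedges H" using fe that by blast
    then show ?thesis using sub(2,3) ends that by auto
  qed
  obtain \<phi> where \<phi>: "\<And>u. u \<in> V \<Longrightarrow> \<phi> u \<in> V \<and> fv (Inl (vcode u)) = Inl (vcode (\<phi> u))"
    and adj: "\<And>u v. u \<in> V \<Longrightarrow> v \<in> set (rot u) \<Longrightarrow> \<phi> v \<in> set (rot (\<phi> u))"
    using graph_hom_on_vertices[OF rotation_system_axioms rotation_system_axioms fv' fe'] by blast
  have inj_\<phi>: "inj_on \<phi> V" by (rule inj) (use \<phi> adj in blast)+
  have "\<phi> ` V \<subseteq> V" using \<phi> by blast
  then have surj: "\<phi> ` V = V" using endo_inj_surj[OF finite_V _ inj_\<phi>] by blast
  have verts: "gverts ?G \<subseteq> gverts H"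
  proof
    fix x assume "x \<in> gverts ?G"
    then obtain y where "y \<in> V" "x = Inl (vcode y)" by (auto simp: gverts_rotation_map)
    moreover from this obtain u where "u \<in> V" "y = \<phi> u" using surj by blast
    ultimately have "u \<in> V" "x = Inl (vcode (\<phi> u))" by simp_all
    then have "u \<in> V" "x = fv (Inl (vcode u))" using \<phi> by auto
    then show "x \<in> gverts H" using fv by (auto simp: gverts_rotation_map)
  qed
  have "inj_on fe (gedges ?G)"
  proof (rule inj_onI)
    fix e e' assume e: "e \<in> gedges ?G" "e' \<in> gedges ?G" "fe e = fe e'"
    obtain u v where uv: "u \<in> V" "v \<in> set (rot u)" "e = ecode u v"
      using e(1) unfolding gedges_rotation_map by blast
    obtain u' v' where uv': "u' \<in> V" "v' \<in> set (rot u')" "e' = ecode u' v'"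
      using e(2) unfolding gedges_rotation_map by blast
    have v: "v \<in> V" "v' \<in> V" using rot_sym[OF uv(1,2)] rot_sym[OF uv'(1,2)] by auto
    have "fv ` gends ?G e = fv ` gends ?G e'" using fe'[OF e(1)] fe'[OF e(2)] e(3) by simp
    then have "{Inl (vcode (\<phi> u)) :: nat set + nat, Inl (vcode (\<phi> v))} =
        {Inl (vcode (\<phi> u')), Inl (vcode (\<phi> v'))}"
      using gends_rotation_map[OF uv(1,2)] gends_rotation_map[OF uv'(1,2)]
        \<phi>[OF uv(1)] \<phi>[OF uv'(1)] \<phi>[OF v(1)] \<phi>[OF v(2)] uv(3) uv'(3) by simp
    then have "vcode ` {\<phi> u, \<phi> v} = vcode ` {\<phi> u', \<phi> v'}"
      by (auto simp: doubleton_eq_iff)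
    then have "\<phi> ` {u, v} = \<phi> ` {u', v'}"
      using inj_on_image_eq_iff[OF vcode_inj, of "{\<phi> u, \<phi> v}" "{\<phi> u', \<phi> v'}"] \<phi> uv(1) uv'(1) v
      by simp
    then have "{u, v} = {u', v'}"
      using inj_on_image_eq_iff[OF inj_\<phi>, of "{u, v}" "{u', v'}"] uv(1) uv'(1) v by simp
    then show "e = e'" by (simp add: uv(3) uv'(3) ecode_eq_iff)
  qed
  moreover have "fe ` gedges ?G \<subseteq> gedges ?G" using fe' by blast
  moreover have "finite (gedges ?G)" using finite_graph_rotation_map by (simp add: finite_graph_def)
  ultimately have "fe ` gedges ?G = gedges ?G" using endo_inj_surj by blast
  then have "gedges ?G \<subseteq> gedges H" using fe by simp
  then show False using verts sub(1,2) H(1) by (auto simp: proper_subgraph_def)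
qed

text \<open>The lower bound is asked for closed walks, since labels are counted along walks; a cycle
  becomes a closed walk by reading its indices modulo its length.\<close>

lemma odd_girth_rotation_map:
  assumes lower: "\<And>w n. odd n \<Longrightarrow> (\<And>i. i < n \<Longrightarrow> w i \<in> V \<and> w (Suc i) \<in> set (rot (w i))) \<Longrightarrow>
      w n = w 0 \<Longrightarrow> g \<le> n"
    and g: "odd g" "3 \<le> g" and c: "inj_on c {..<g}"
    and adj: "\<And>i. i < g \<Longrightarrow> c i \<in> V \<and> c (Suc i mod g) \<in> set (rot (c i))"
  shows "odd_girth (underlying_graph M) = enat g"
proof -
  let ?G = "underlying_graph M"
  let ?S = "{enat (length es) | vs es. cycle_in ?G vs es \<and> odd (length es)}"
  define vs where "vs = map (\<lambda>i. Inl (vcode (c i)) :: nat set + nat) [0..<g]"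
  define es where "es = map (\<lambda>i. ecode (c i) (c (Suc i mod g))) [0..<g]"
  have "cycle_in ?G vs es"
    unfolding cycle_in_def
  proof (intro conjI allI impI)
    show "es \<noteq> []" "length vs = length es" using g by (auto simp: es_def vs_def)
    show "distinct vs"
      using c adj inj_onD[OF vcode_inj]
      by (auto simp: vs_def distinct_map inj_on_def)
    show "set vs \<subseteq> gverts ?G" using adj by (auto simp: vs_def gverts_rotation_map)
    show "set es \<subseteq> gedges ?G"
      using adj unfolding es_def gedges_rotation_map by auto blast
    show "gends ?G (es ! i) = {vs ! i, vs ! (Suc i mod length es)}" if "i < length es" for i
      using that g gends_rotation_map adj by (auto simp: es_def vs_def)
    have "inj_on (\<lambda>i. ecode (c i) (c (Suc i mod g))) {..<g}"
    proof (rule inj_onI)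
      fix i j assume ij: "i \<in> {..<g}" "j \<in> {..<g}"
        "ecode (c i) (c (Suc i mod g)) = ecode (c j) (c (Suc j mod g))"
      have bound: "Suc i mod g \<in> {..<g}" "Suc j mod g \<in> {..<g}" using g by auto
      have "c ` {i, Suc i mod g} = c ` {j, Suc j mod g}" using ij(3) by (simp add: ecode_eq_iff)
      then have eq: "{i, Suc i mod g} = {j, Suc j mod g}"
        using inj_on_image_eq_iff[OF c, of "{i, Suc i mod g}" "{j, Suc j mod g}"] ij bound by simp
      show "i = j"
      proof (rule ccontr)
        assume "i \<noteq> j"
        then have *: "i = Suc j mod g" "j = Suc i mod g" using eq by (auto simp: doubleton_eq_iff)
        have "Suc l mod g = (if Suc l = g then 0 else Suc l)" if "l < g" for l
          using that by auto
        \<comment> \<open>On a cycle with at least three vertices, two positions cannot be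
          successors of each other.\<close>
        then have "(Suc j = g \<and> i = 0) \<or> i = Suc j" "(Suc i = g \<and> j = 0) \<or> j = Suc i"
          using * ij(1,2) by (metis lessThan_iff)+
        then show False using g(2) by (elim disjE conjE) linarith+
      qed
    qed
    then show "distinct es" by (simp add: es_def distinct_map atLeast0LessThan)
  qed
  then have "enat g \<in> ?S" using g
    by (intro CollectI exI[of _ vs] exI[of _ es]) (simp add: es_def)
  moreover have "enat g \<le> x" if x: "x \<in> ?S" for x
  proof -
    obtain vs es where cyc: "cycle_in ?G vs es" "odd (length es)" "x = enat (length es)"
      using x by blast
    let ?n = "length es"
    have n0: "0 < ?n" using cyc(1) by (simp add: cycle_in_def)
    have len: "length vs = ?n" and vsV: "set vs \<subseteq> gverts ?G" and esE: "set es \<subseteq> gedges ?G"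
      and ends: "\<And>i. i < ?n \<Longrightarrow> gends ?G (es ! i) = {vs ! i, vs ! (Suc i mod ?n)}"
      using cyc(1) by (auto simp: cycle_in_def)
    have "\<exists>u. u \<in> V \<and> vs ! (i mod ?n) = Inl (vcode u)" for i
    proof -
      have "i mod ?n < length vs" using len n0 by simp
      then have "vs ! (i mod ?n) \<in> gverts ?G" using vsV nth_mem by blast
      then show ?thesis by (auto simp: gverts_rotation_map)
    qed
    then obtain w0 where w0: "\<And>i. w0 i \<in> V \<and> vs ! (i mod ?n) = Inl (vcode (w0 i))" by metis
    \<comment> \<open>The choice \<open>w0\<close> is not known to be periodic; reducing the index
      closes the walk by definition.\<close>
    define w where "w i = w0 (i mod ?n)" for i
    have w: "w i \<in> V" "vs ! (i mod ?n) = Inl (vcode (w i))" for i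
      using w0[of "i mod ?n"] by (simp_all add: w_def)
    have "w (Suc i) \<in> set (rot (w i))" if i: "i < ?n" for i
    proof -
      have "es ! i \<in> gedges ?G" using esE nth_mem[OF i] by blast
      then obtain a b where ab: "a \<in> V" "b \<in> set (rot a)" "es ! i = ecode a b"
        unfolding gedges_rotation_map by blast
      have b: "b \<in> V" "a \<in> set (rot b)" using rot_sym[OF ab(1,2)] by auto
      have "{Inl (vcode a) :: nat set + nat, Inl (vcode b)} = {Inl (vcode (w i)), Inl (vcode (w (Suc i)))}"
        using ends[OF i] gends_rotation_map[OF ab(1,2)] ab(3) w(2)[of i] w(2)[of "Suc i"] i by simp
      then have "vcode ` {a, b} = vcode ` {w i, w (Suc i)}" by (auto simp: doubleton_eq_iff)
      then have "{a, b} = {w i, w (Suc i)}"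
        using inj_on_image_eq_iff[OF vcode_inj, of "{a, b}" "{w i, w (Suc i)}"] ab(1) b(1) w(1) by simp
      then show ?thesis using ab(2) b(2) by (auto simp: doubleton_eq_iff)
    qed
    moreover have "w ?n = w 0" by (simp add: w_def)
    ultimately have "g \<le> ?n" using lower[OF cyc(2), of w] w(1) by blast
    then show ?thesis by (simp add: cyc(3))
  qed
  ultimately show ?thesis unfolding odd_girth_def by (intro antisym Inf_lower Inf_greatest)
qed

text \<open>\<open>K\<close> is a union of components. Its vertices lose no edges, so
  \<open>skip\<close> stops after one step and their rotation is unchanged; all other vertices
  become isolated and are removed one at a time.\<close>

lemma rotation_submap:
  assumes K: "K \<subseteq> V" and closed: "\<And>u v. u \<in> K \<Longrightarrow> v \<in> set (rot u) \<Longrightarrow> v \<in> K"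
  shows "submap (rotation_map K rot) M"
proof -
  define E where "E = {ecode u v | u v. u \<in> V - K \<and> v \<in> set (rot u)}"
  define D where "D = to_nat ` flags (V - K) rot"
  have E: "E \<subseteq> edge_orbits M" unfolding E_def rotation_map_edge_orbits by blast
  have flagK: "(u, v, s) \<in> flags (V - K) rot \<Longrightarrow> (v, u, s') \<in> flags (V - K) rot" for u v s s'
    using rot_sym[of u v] closed[of v u] by (auto simp: flags_def)
  have UE: "\<Union> E = D"
  proof
    show "\<Union> E \<subseteq> D"
    proof
      fix x assume "x \<in> \<Union> E"
      then obtain u v where uv: "u \<in> V - K" "v \<in> set (rot u)" "x \<in> ecode u v" unfolding E_def by blast
      then have "(u, v, s) \<in> flags (V - K) rot" for s by (simp add: flags_def)
      then show "x \<in> D" using uv(3) flagK unfolding ecode_def D_def by blast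
    qed
    show "D \<subseteq> \<Union> E"
    proof
      fix x assume "x \<in> D"
      then obtain u v s where uv: "(u, v, s) \<in> flags (V - K) rot" "x = to_nat (u, v, s :: bool)"
        unfolding D_def by auto
      then have "ecode u v \<in> E" by (auto simp: flags_def E_def)
      moreover have "x \<in> ecode u v" using uv(2) by (cases s) (simp_all add: ecode_def)
      ultimately show "x \<in> \<Union> E" by blast
    qed
  qed
  have split: "flags V rot - flags (V - K) rot = flags K rot" using K by (auto simp: flags_def)
  have C: "to_nat ` flags V rot - D = to_nat ` flags K rot"
    unfolding D_def image_set_diff[OF inj_to_nat, symmetric] split ..
  have KV: "x \<in> flags V rot" if "x \<in> flags K rot" for x using that K by (auto simp: flags_def)
  have disj: "to_nat x \<notin> D" if "x \<in> flags K rot" for x using that C by blast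
  have skip: "skip (vperm M) D (al2 M (to_nat x)) = to_nat (flag1 rot x)" if x: "x \<in> flags K rot" for x
  proof -
    have v: "vperm M (al2 M (to_nat x)) = to_nat (flag1 rot x)"
      using rotation_map_simps(4)[OF KV[OF x]]
      by (simp add: vperm_apply map_invol[OF is_map_rotation_map])
    obtain u w s where x_eq: "x = (u, w, s)" by (cases x)
    then have "u \<in> K" "w \<in> set (rot u)" using x by (simp_all add: flags_def)
    moreover from this have "u \<in> V" using K by blast
    ultimately have "flag1 rot x \<in> flags K rot"
      using cyc_next_props[OF distinct_rot, of u w] by (simp add: x_eq flags_def)
    then have "to_nat (flag1 rot x) \<notin> D" by (rule disj)
    then have "skip (vperm M) D (al2 M (to_nat x)) = (vperm M ^^ 1) (al2 M (to_nat x))"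
      by (intro skip_eqI) (simp_all add: v)
    then show ?thesis by (simp add: v)
  qed
  let ?N = "delete_edges M E"
  have N: "?N = rotation_map K rot\<lparr>isol := isol ?N\<rparr>"
  proof (rule cmap.equality)
    show "crosses ?N = crosses (rotation_map K rot\<lparr>isol := isol ?N\<rparr>)"
      by (simp add: delete_edges_def UE rotation_map_def C)
    show "al0 ?N = al0 (rotation_map K rot\<lparr>isol := isol ?N\<rparr>)"
    proof
      fix x show "al0 ?N x = al0 (rotation_map K rot\<lparr>isol := isol ?N\<rparr>) x"
        unfolding delete_edges_def UE Let_def rotation_map_simps(1) C
        using rotation_map_simps(3)[OF KV]
        by (simp add: rotation_map_def[of K] on_codes_def) auto
    qed
    show "al2 ?N = al2 (rotation_map K rot\<lparr>isol := isol ?N\<rparr>)"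
    proof
      fix x show "al2 ?N x = al2 (rotation_map K rot\<lparr>isol := isol ?N\<rparr>) x"
        unfolding delete_edges_def UE Let_def rotation_map_simps(1) C
        using rotation_map_simps(5)[OF KV]
        by (simp add: rotation_map_def[of K] on_codes_def) auto
    qed
    show "al1 ?N = al1 (rotation_map K rot\<lparr>isol := isol ?N\<rparr>)"
    proof
      fix x show "al1 ?N x = al1 (rotation_map K rot\<lparr>isol := isol ?N\<rparr>) x"
        unfolding delete_edges_def UE Let_def rotation_map_simps(1) C
        using skip
        by (simp add: rotation_map_def[of K] on_codes_def) auto
    qed
  qed simp_all
  have remove: "vertex_deletion\<^sup>*\<^sup>* L (L\<lparr>isol := 0\<rparr>)" for L :: "nat cmap"
  proof (induction "isol L" arbitrary: L)
    case 0
    then have "L\<lparr>isol := 0\<rparr> = L" by (intro cmap.equality) simp_all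
    then show ?case by simp
  next
    case (Suc i)
    have "vertex_deletion L (L\<lparr>isol := isol L - 1\<rparr>)"
      by (rule vertex_deletion.isolated) (use Suc.hyps(2) in simp)
    moreover have "vertex_deletion\<^sup>*\<^sup>* (L\<lparr>isol := isol L - 1\<rparr>) (L\<lparr>isol := isol L - 1\<rparr>\<lparr>isol := 0\<rparr>)"
      by (rule Suc.hyps(1)) (use Suc.hyps(2) in simp)
    ultimately show ?case by (simp add: converse_rtranclp_into_rtranclp)
  qed
  have "rotation_map K rot\<lparr>isol := 0\<rparr> = rotation_map K rot" by (simp add: rotation_map_def)
  moreover have "vertex_deletion\<^sup>*\<^sup>* ?N (?N\<lparr>isol := 0\<rparr>)" by (rule remove)
  moreover have "?N\<lparr>isol := 0\<rparr> = rotation_map K rot\<lparr>isol := 0\<rparr>" by (subst N) simp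
  ultimately show ?thesis unfolding submap_def using E by auto
qed

end

lemma plane_signed_genus: "plane M \<Longrightarrow> signed_genus M = 0"
  by (simp add: plane_def signed_genus_def genus_def)

text \<open>The empty sequence of gluings works; planarity makes the two signed genera
  agree.\<close>

lemma submap_map_hom:
  assumes "submap S M" "plane S" "plane M" shows "map_hom S M"
  unfolding map_hom_def
proof (intro conjI exI)
  show "signed_genus S = signed_genus M" using assms by (simp add: plane_signed_genus)
  show "gluing\<^sup>*\<^sup>* S S" by simp
  show "submap S M" by (fact assms)
  show "map_iso S S" unfolding map_iso_def by (intro conjI exI[of _ id]) auto
qed


section \<open>Chains of odd \<open>K\<^sub>4\<close> subdivisions\<close>

text \<open>
  The vertex \<open>(t, i, p, j)\<close> lies in the block \<open>i\<close> of the chain \<open>t\<close>, at position \<open>j\<close> on the path \<open>p\<close>.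
  The two paths of a block have length \<open>m\<close>, and each end of one is joined to each end of the other.
\<close>

type_synonym vx = "nat \<times> nat \<times> bool \<times> nat"

text \<open>The only difference between the chains. Reversing the path exchanges \<open>2\<close>
  and \<open>m - 2\<close>, so the exceptional block can be recognised only once the direction of
  its path is known.\<close>

definition bridge_pos :: "nat \<Rightarrow> nat \<Rightarrow> nat \<Rightarrow> nat" where
  "bridge_pos m t i = (if i = t then m - 2 else 2)"

fun block_adj :: "nat \<Rightarrow> bool \<times> nat \<Rightarrow> bool \<times> nat \<Rightarrow> bool" where
  "block_adj m (p, j) (q, j') \<longleftrightarrow> j \<le> m \<and> j' \<le> m \<and>
     (if p = q then j' = Suc j \<or> j = Suc j' else j \<in> {0, m} \<and> j' \<in> {0, m})"

fun chain_adj :: "nat \<Rightarrow> nat \<Rightarrow> vx \<Rightarrow> vx \<Rightarrow> bool" where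
  "chain_adj m N (t, i, p, j) (t', i', q, j') \<longleftrightarrow> t' = t \<and> i \<le> Suc N \<and> i' \<le> Suc N \<and>
     (i' = i \<and> block_adj m (p, j) (q, j') \<or>
      \<not> p \<and> \<not> q \<and> (i' = Suc i \<and> j = bridge_pos m t i \<and> j' = 0 \<or>
                   i = Suc i' \<and> j' = bridge_pos m t i' \<and> j = 0))"

text \<open>
  Every facial cycle of a block contains each of the labels \<open>0, \<dots>, m + 1\<close> exactly once, as
  opposite edges of the subdivided \<open>K\<^sub>4\<close> carry the same labels. Bridges have the label \<open>m + 2\<close>.
\<close>

fun edge_label :: "nat \<Rightarrow> vx \<Rightarrow> vx \<Rightarrow> nat" where
  "edge_label m (t, i, p, j) (t', i', q, j') =
     (if i \<noteq> i' then m + 2 else if p = q then min j j' else if j = j' then m + 1 else m)"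

text \<open>Number of colour changes, up to parity, from the start of block 0 to the start of block
  \<open>i\<close>: on every earlier block those along the first path up to the bridge, and one on
  the bridge itself.\<close>

definition block_parity :: "nat \<Rightarrow> nat \<Rightarrow> nat \<Rightarrow> nat \<Rightarrow> nat" where
  "block_parity m l t i =
     (\<Sum>k<i. Suc (bridge_pos m t k + of_bool (l < bridge_pos m t k)))"

text \<open>Exactly the edges labelled \<open>l\<close> become monochromatic. Along a path the
  parity of \<open>j\<close> alternates, and \<open>l < j\<close> cancels the change on the edge
  from \<open>l\<close> to \<open>l + 1\<close>. If \<open>l < m\<close>, both ends of a path thus
  get the same colour. If \<open>l\<close> is \<open>m\<close> or \<open>m + 1\<close>, they differ
  because \<open>m\<close> is odd, and the term with \<open>p\<close> decides which pair of opposite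
  edges of the quadrilateral is monochromatic.\<close>

fun colour :: "nat \<Rightarrow> nat \<Rightarrow> vx \<Rightarrow> bool" where
  "colour m l (t, i, p, j) \<longleftrightarrow>
     odd (j + of_bool (l < j) + of_bool (p \<and> l \<noteq> m + 1) + block_parity m l t i)"

lemma block_parity_Suc:
  "block_parity m l t (Suc i) =
    block_parity m l t i + Suc (bridge_pos m t i + of_bool (l < bridge_pos m t i))"
  by (simp add: block_parity_def)

lemma colour_eq_iff_label:
  assumes m: "odd m" and adj: "chain_adj m N u v" and l: "l \<le> m + 1"
  shows "colour m l u = colour m l v \<longleftrightarrow> edge_label m u v = l"
proof -
  obtain t i p j where u: "u = (t, i, p, j)" by (cases u)
  obtain t' i' q j' where v: "v = (t', i', q, j')" by (cases v)
  have t: "t' = t" using adj by (simp add: u v)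
  consider (path) "i' = i" "q = p" "j' = Suc j \<or> j = Suc j'"
    | (quad) "i' = i" "q \<noteq> p" "j \<in> {0, m}" "j' \<in> {0, m}"
    | (up) "i' = Suc i" "\<not> p" "\<not> q" "j = bridge_pos m t i" "j' = 0"
    | (down) "i = Suc i'" "\<not> p" "\<not> q" "j' = bridge_pos m t i'" "j = 0"
    using adj by (auto simp: u v split: if_splits)
  then show ?thesis
  proof cases
    case path
    then show ?thesis using t by (elim disjE) (auto simp: u v of_bool_def)
  next
    case quad
    have "m \<noteq> 0" using m by (intro notI) simp
    then show ?thesis using quad t m l by (cases p; cases q) (auto simp: u v of_bool_def)
  next
    case up
    then show ?thesis using t l by (auto simp: u v block_parity_Suc)
  next
    case down
    then show ?thesis using t l by (auto simp: u v block_parity_Suc)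
  qed
qed

definition chain_walk :: "nat \<Rightarrow> nat \<Rightarrow> (nat \<Rightarrow> vx) \<Rightarrow> nat \<Rightarrow> bool" where
  "chain_walk m N w n \<longleftrightarrow> (\<forall>i<n. chain_adj m N (w i) (w (Suc i))) \<and> w n = w 0"

text \<open>Without the label \<open>l\<close> the colour would alternate along the walk, which is
  impossible for odd length.\<close>

lemma closed_walk_label:
  assumes m: "odd m" and w: "chain_walk m N w n" "odd n" and l: "l \<le> m + 1"
  shows "\<exists>i<n. edge_label m (w i) (w (Suc i)) = l"
proof (rule ccontr)
  assume none: "\<not> ?thesis"
  have "colour m l (w i) = (colour m l (w 0) \<noteq> odd i)" if "i \<le> n" for i
    using that
  proof (induction i)
    case (Suc i)
    have "chain_adj m N (w i) (w (Suc i))" using w(1) Suc.prems by (simp add: chain_walk_def)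
    then have "colour m l (w i) \<noteq> colour m l (w (Suc i))"
      using colour_eq_iff_label[OF m _ l] none Suc.prems by auto
    then show ?case using Suc by auto
  qed simp
  from this[of n] show False using w by (simp add: chain_walk_def)
qed

lemma closed_walk_length:
  assumes m: "odd m" and w: "chain_walk m N w n" "odd n"
  shows "m + 2 \<le> n"
    and "n = m + 2 \<Longrightarrow> inj_on (\<lambda>i. edge_label m (w i) (w (Suc i))) {..<n}"
    and "n = m + 2 \<Longrightarrow> i < n \<Longrightarrow> edge_label m (w i) (w (Suc i)) \<le> m + 1"
proof -
  let ?L = "\<lambda>i. edge_label m (w i) (w (Suc i))"
  have sub: "{..m + 1} \<subseteq> ?L ` {..<n}"
  proof
    fix l assume "l \<in> {..m + 1}"
    then obtain i where "i < n" "?L i = l" using closed_walk_label[OF m w, of l] by auto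
    then show "l \<in> ?L ` {..<n}" by (intro image_eqI[of _ _ i]) simp_all
  qed
  have card: "card (?L ` {..<n}) \<le> n" using card_image_le[of "{..<n}" ?L] by simp
  have "m + 2 \<le> card (?L ` {..<n})" using card_mono[OF _ sub] by simp
  then show "m + 2 \<le> n" using card by simp
  assume n: "n = m + 2"
  have "card (?L ` {..<n}) = n" using card \<open>m + 2 \<le> card (?L ` {..<n})\<close> n by simp
  then show "inj_on ?L {..<n}" by (intro eq_card_imp_inj_on) simp_all
  have "{..m + 1} = ?L ` {..<n}"
    by (rule card_seteq[OF _ sub]) (use card n in simp_all)
  then show "i < n \<Longrightarrow> ?L i \<le> m + 1" by auto
qed

text \<open>A walk with unit steps that covers distance \<open>m\<close> in \<open>m\<close> steps
  can never turn back: being late at \<open>j\<close> could not be made up, and being early is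
  impossible.\<close>

lemma unit_steps_monotone:
  fixes x :: "nat \<Rightarrow> nat"
  assumes "\<And>j. j < m \<Longrightarrow> x (Suc j) = Suc (x j) \<or> x j = Suc (x (Suc j))"
    and "x 0 = 0" and "x m = m" and "j \<le> m"
  shows "x j = j"
proof -
  have up: "x k \<le> k" if "k \<le> m" for k
    using that
  proof (induction k)
    case (Suc k)
    then show ?case using assms(1)[of k] by force
  qed (simp add: assms(2))
  have "x (j + k) \<le> x j + k" if "j + k \<le> m" for k
    using that
  proof (induction k)
    case (Suc k)
    then show ?case using assms(1)[of "j + k"] by force
  qed simp
  from this[of "m - j"] show ?thesis using up[OF assms(4)] assms(3,4) by simp
qed

text \<open>A closed walk of four steps whose opposite vertices differ does not turn back at once,
  and for \<open>m >= 5\<close> it is too short to run through a long path. So it goes round the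
  quadrilateral, where the two ends of a path are opposite corners.\<close>

lemma block_quadrilateral:
  assumes m: "5 \<le> m"
    and "block_adj m (pa, a) (pb, b)" "block_adj m (pb, b) (pc, c)"
      "block_adj m (pc, c) (pd, d)" "block_adj m (pd, d) (pa, a)"
    and "(pa, a) \<noteq> (pc, c)" "(pb, b) \<noteq> (pd, d)"
  shows "pc = pa \<and> pb = (\<not> pa) \<and> pd = (\<not> pa) \<and> a \<in> {0, m} \<and> b \<in> {0, m} \<and> c = m - a \<and> d = m - b"
  using assms by (cases pa; cases pb; cases pc; cases pd) auto

section \<open>Rigidity of homomorphisms defined on one chain\<close>

locale chain_hom =
  fixes m N t :: nat and \<phi> :: "vx \<Rightarrow> vx"
  assumes m: "odd m" "5 \<le> m"
    and t: "1 \<le> t" "t \<le> N"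
    and hom: "\<And>i p j v. chain_adj m N (t, i, p, j) v \<Longrightarrow> chain_adj m N (\<phi> (t, i, p, j)) (\<phi> v)"
begin

text \<open>Along the path \<open>p\<close>, over the corner \<open>c\<close> of the other path, and
  back to the start. The two paths and the two corners give the four facial cycles of a single
  block.\<close>

definition face_walk :: "nat \<Rightarrow> bool \<Rightarrow> nat \<Rightarrow> nat \<Rightarrow> vx" where
  "face_walk i p c k = (if k \<le> m then (t, i, p, k) else if k = m + 1 then (t, i, \<not> p, c) else (t, i, p, 0))"

lemma face_walk_closed:
  assumes "i \<le> Suc N" "c \<in> {0, m}"
  shows "chain_walk m N (\<lambda>k. \<phi> (face_walk i p c k)) (m + 2)"
  unfolding chain_walk_def
proof (intro conjI allI impI)
  fix k assume k: "k < m + 2"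
  have "chain_adj m N (face_walk i p c k) (face_walk i p c (Suc k))"
    using k assms by (cases "k < m"; cases "k = m") (auto simp: face_walk_def)
  then show "chain_adj m N (\<phi> (face_walk i p c k)) (\<phi> (face_walk i p c (Suc k)))"
    using hom by (cases "face_walk i p c k") (auto simp: face_walk_def split: if_splits)
qed (simp add: face_walk_def)

lemma face_label_inj:
  assumes "i \<le> Suc N" "c \<in> {0, m}"
  shows "inj_on (\<lambda>k. edge_label m (\<phi> (face_walk i p c k)) (\<phi> (face_walk i p c (Suc k)))) {..<m + 2}"
  by (rule closed_walk_length(2)[OF m(1) face_walk_closed[OF assms]]) (use m in auto)

lemma face_label_le:
  assumes "i \<le> Suc N" "c \<in> {0, m}" "k < m + 2"
  shows "edge_label m (\<phi> (face_walk i p c k)) (\<phi> (face_walk i p c (Suc k))) \<le> m + 1"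
  by (rule closed_walk_length(3)[OF m(1) face_walk_closed[OF assms(1,2)]]) (use m assms in auto)

lemma same_block:
  assumes "chain_adj m N u v" "edge_label m u v \<le> m + 1"
  shows "fst v = fst u \<and> fst (snd v) = fst (snd u) \<and> block_adj m (snd (snd u)) (snd (snd v))"
  using assms by (cases u; cases v) (auto split: if_splits)

lemma quad_label:
  "fst (snd u) = fst (snd v) \<Longrightarrow> fst (snd (snd u)) \<noteq> fst (snd (snd v)) \<Longrightarrow> edge_label m u v \<in> {m, m + 1}"
  by (cases u; cases v) auto

lemma face_step:
  assumes "i \<le> Suc N" "c \<in> {0, m}" "k < m + 2"
  shows "fst (\<phi> (face_walk i p c (Suc k))) = fst (\<phi> (face_walk i p c k)) \<and>
    fst (snd (\<phi> (face_walk i p c (Suc k)))) = fst (snd (\<phi> (face_walk i p c k))) \<and>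
    block_adj m (snd (snd (\<phi> (face_walk i p c k)))) (snd (snd (\<phi> (face_walk i p c (Suc k)))))"
  using same_block[OF _ face_label_le[OF assms]] face_walk_closed[OF assms(1,2)] assms(3)
  by (simp add: chain_walk_def)

lemma path_step:
  assumes "i \<le> Suc N" "k < m"
  shows "fst (\<phi> (t, i, p, Suc k)) = fst (\<phi> (t, i, p, k)) \<and>
    fst (snd (\<phi> (t, i, p, Suc k))) = fst (snd (\<phi> (t, i, p, k))) \<and>
    block_adj m (snd (snd (\<phi> (t, i, p, k)))) (snd (snd (\<phi> (t, i, p, Suc k))))"
  using face_step[of i 0 k p] assms by (simp add: face_walk_def)

lemma quad_step:
  assumes "i \<le> Suc N" "c \<in> {0, m}" "c' \<in> {0, m}"
  shows "fst (\<phi> (t, i, \<not> p, c')) = fst (\<phi> (t, i, p, c)) \<and>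
    fst (snd (\<phi> (t, i, \<not> p, c'))) = fst (snd (\<phi> (t, i, p, c))) \<and>
    block_adj m (snd (snd (\<phi> (t, i, p, c)))) (snd (snd (\<phi> (t, i, \<not> p, c'))))"
proof (cases "c = m")
  case True
  then show ?thesis using face_step[of i c' m p] assms by (simp add: face_walk_def)
next
  case False
  have sym: "block_adj m x y \<longleftrightarrow> block_adj m y x" for x y by (cases x; cases y) auto
  show ?thesis
    using face_step[of i c' "m + 1" p] False assms sym by (simp add: face_walk_def)
qed

text \<open>The images of the facial walks contain no bridge, so they never leave the block in which
  they start, and these walks connect the whole block.\<close>

lemma block_constant:
  assumes "i \<le> Suc N" "j \<le> m"
  shows "fst (\<phi> (t, i, p, j)) = fst (\<phi> (t, i, False, 0)) \<and>
    fst (snd (\<phi> (t, i, p, j))) = fst (snd (\<phi> (t, i, False, 0)))"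
proof -
  have path: "fst (\<phi> (t, i, p, j)) = fst (\<phi> (t, i, p, 0)) \<and>
      fst (snd (\<phi> (t, i, p, j))) = fst (snd (\<phi> (t, i, p, 0)))" for p
    using assms(2)
  proof (induction j)
    case (Suc j)
    then show ?case using path_step[OF assms(1), of j p] by simp
  qed simp
  show ?thesis using path[of p] quad_step[OF assms(1), of 0 0 False] by (cases p) simp_all
qed

text \<open>Otherwise the image of the path would be an odd closed walk of length \<open>m\<close>,
  shorter than \<open>m + 2\<close>.\<close>

lemma ends_distinct:
  assumes "i \<le> Suc N" shows "\<phi> (t, i, p, 0) \<noteq> \<phi> (t, i, p, m)"
proof
  assume eq: "\<phi> (t, i, p, 0) = \<phi> (t, i, p, m)"
  have "chain_adj m N (\<phi> (t, i, p, k)) (\<phi> (t, i, p, Suc k))" if "k < m" for k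
    by (rule hom) (use that assms in simp)
  then have "chain_walk m N (\<lambda>k. \<phi> (t, i, p, k)) m" using eq by (simp add: chain_walk_def)
  then show False using closed_walk_length(1)[OF m(1) _ m(1)] by force
qed

text \<open>\<open>q\<close> tells whether the two paths are exchanged, \<open>fl\<close> which of
  them are reversed. First the four corners are located by \<open>block_quadrilateral\<close>, then
  the paths between them.\<close>

lemma block_image:
  assumes i: "i \<le> Suc N"
  shows "\<exists>t' i' q fl. \<forall>p. \<forall>j\<le>m.
    \<phi> (t, i, p, j) = (t', i', p \<noteq> q, if fl p then m - j else j)"
proof -
  let ?Q = "\<lambda>p j. fst (snd (snd (\<phi> (t, i, p, j))))" and ?X = "\<lambda>p j. snd (snd (snd (\<phi> (t, i, p, j))))"
  define t' i' where "t' = fst (\<phi> (t, i, False, 0))" and "i' = fst (snd (\<phi> (t, i, False, 0)))"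
  have img: "\<phi> (t, i, p, j) = (t', i', ?Q p j, ?X p j)" if "j \<le> m" for p j
    using block_constant[OF i that, of p] by (simp add: t'_def i'_def prod_eq_iff)
  have adj: "block_adj m (?Q p c, ?X p c) (?Q (\<not> p) c', ?X (\<not> p) c')"
    if "c \<in> {0, m}" "c' \<in> {0, m}" for p c c'
    using quad_step[OF i that, of p] by (simp add: prod_eq_iff)
  have neq: "(?Q p 0, ?X p 0) \<noteq> (?Q p m, ?X p m)" for p
    using ends_distinct[OF i, of p] img[of 0 p] img[of m p] by auto
  define q where "q = ?Q False 0"
  have "?Q False m = ?Q False 0 \<and> ?Q True 0 = (\<not> ?Q False 0) \<and> ?Q True m = (\<not> ?Q False 0) \<and>
      ?X False 0 \<in> {0, m} \<and> ?X True 0 \<in> {0, m} \<and> ?X False m = m - ?X False 0 \<and>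
      ?X True m = m - ?X True 0"
    by (rule block_quadrilateral[OF m(2)])
      (use adj[of 0 0 False] adj[of 0 m True] adj[of m m False] adj[of m 0 True]
        neq[of False] neq[of True] in simp_all)
  then have corner: "?Q p 0 = (p \<noteq> q)" "?Q p m = (p \<noteq> q)" "?X p 0 \<in> {0, m}" "?X p m = m - ?X p 0" for p
    by (cases p; simp add: q_def)+
  \<comment> \<open>If the image of the path changed sides, that edge would carry the label
    \<open>m\<close> or \<open>m + 1\<close>. The two edges of the same facial walk off the path
    already use up these two labels, and labels do not repeat.\<close>
  have Q_const: "?Q p (Suc k) = ?Q p k" if k: "k < m" for p k
  proof (rule ccontr)
    assume ne: "?Q p (Suc k) \<noteq> ?Q p k"
    let ?L = "\<lambda>k. edge_label m (\<phi> (face_walk i p 0 k)) (\<phi> (face_walk i p 0 (Suc k)))"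
    have "?L k \<in> {m, m + 1}"
      by (rule quad_label) (use ne k path_step[OF i k, of p] in \<open>auto simp: face_walk_def\<close>)
    moreover have "?L m \<in> {m, m + 1}" "?L (m + 1) \<in> {m, m + 1}"
      by (rule quad_label; use quad_step[OF i, of m 0 p] quad_step[OF i, of 0 0 p]
          corner(1)[of "\<not> p"] corner(1)[of p] corner(2)[of p] in \<open>simp add: face_walk_def\<close>)+
    moreover have "?L k \<noteq> ?L m" "?L k \<noteq> ?L (m + 1)" "?L m \<noteq> ?L (m + 1)"
      by (rule inj_on_contraD[OF face_label_inj[OF i, of 0 p]]; use k in simp)+
    ultimately show False by (metis insert_iff singletonD)
  qed
  have Q: "?Q p j = (p \<noteq> q)" if "j \<le> m" for p j
    using that by (induction j) (simp_all add: corner(1) Q_const)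
  have X_step: "?X p (Suc k) = Suc (?X p k) \<or> ?X p k = Suc (?X p (Suc k))"
    "?X p k \<le> m" "?X p (Suc k) \<le> m" if k: "k < m" for p k
  proof -
    have "block_adj m (?Q p k, ?X p k) (?Q p (Suc k), ?X p (Suc k))"
      using path_step[OF i k, of p] by (simp add: prod_eq_iff)
    then show "?X p (Suc k) = Suc (?X p k) \<or> ?X p k = Suc (?X p (Suc k))"
      "?X p k \<le> m" "?X p (Suc k) \<le> m"
      unfolding block_adj.simps Q_const[OF k, of p] by simp_all
  qed
  \<comment> \<open>The image moves by unit steps and has to get from one end to the other in
    \<open>m\<close> steps.\<close>
  have X: "?X p j = (if ?X p 0 \<noteq> 0 then m - j else j)" if j: "j \<le> m" for p j
  proof (cases "?X p 0 = 0")
    case True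
    have "?X p j = j"
      by (rule unit_steps_monotone[of m]) (use X_step(1) True corner(4)[of p] j in simp_all)
    then show ?thesis using True by simp
  next
    case False
    then have 0: "?X p 0 = m" using corner(3)[of p] by auto
    have le: "?X p k \<le> m" if "k \<le> m" for k
      using X_step(2)[of k p] X_step(3)[of "m - 1" p] that m(2) by (cases "k = m") auto
    have "m - ?X p j = j"
    proof (rule unit_steps_monotone[of m])
      fix k assume k: "k < m"
      show "m - ?X p (Suc k) = Suc (m - ?X p k) \<or> m - ?X p k = Suc (m - ?X p (Suc k))"
        using X_step[OF k, of p] by linarith
    qed (use 0 corner(4)[of p] j in simp_all)
    then show ?thesis using False le[OF j] by simp
  qed
  show ?thesis
  proof (intro exI allI impI)
    fix p j assume j: "j \<le> m"
    show "\<phi> (t, i, p, j) = (t', i', p \<noteq> q, if ?X p 0 \<noteq> 0 then m - j else j)"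
      using img[OF j, of p] Q[OF j, of p] X[OF j, of p] by simp
  qed
qed

lemma rigid:
  "\<exists>fl. \<forall>i\<le>Suc N. \<forall>p. \<forall>j\<le>m. \<phi> (t, i, p, j) = (t, i, p, if fl i p then m - j else j)"
proof -
  obtain T F q fl where img: "\<And>i p j. i \<le> Suc N \<Longrightarrow> j \<le> m \<Longrightarrow>
      \<phi> (t, i, p, j) = (T i, F i, p \<noteq> q i, if fl i p then m - j else j)"
    using block_image by metis
  have step: "T (Suc i) = T i \<and> F (Suc i) = Suc (F i) \<and> \<not> q i \<and> \<not> q (Suc i) \<and>
      \<not> fl (Suc i) False \<and> F (Suc i) \<le> Suc N \<and>
      (if fl i False then m - bridge_pos m t i else bridge_pos m t i) = bridge_pos m (T i) (F i)"
    if i: "i \<le> N" for i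
  proof -
    have le: "bridge_pos m t i \<le> m" using m(2) by (simp add: bridge_pos_def)
    define x where "x = (if fl i False then m - bridge_pos m t i else bridge_pos m t i)"
    define y where "y = (if fl (Suc i) False then m else 0)"
    have x: "x = 2 \<or> x = m - 2" using m(2) by (auto simp: x_def bridge_pos_def)
    have y: "y = 0 \<or> y = m" by (simp add: y_def)
    have "chain_adj m N (t, i, False, bridge_pos m t i) (t, Suc i, False, 0)" using i by simp
    then have "chain_adj m N (\<phi> (t, i, False, bridge_pos m t i)) (\<phi> (t, Suc i, False, 0))"
      by (rule hom)
    moreover have "\<phi> (t, i, False, bridge_pos m t i) = (T i, F i, q i, x)"
      using img[of i "bridge_pos m t i" False] i le by (simp add: x_def)
    moreover have "\<phi> (t, Suc i, False, 0) = (T (Suc i), F (Suc i), q (Suc i), y)"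
      using img[of "Suc i" 0 False] i by (simp add: y_def)
    ultimately have "chain_adj m N (T i, F i, q i, x) (T (Suc i), F (Suc i), q (Suc i), y)"
      by (simp only:)
    \<comment> \<open>The bridge cannot be folded into a block. As \<open>x\<close> is not 0, its
      image is also not a bridge passed backwards.\<close>
    moreover have "\<not> block_adj m (q i, x) (q (Suc i), y)"
      using x y m(2) by (auto split: if_splits)
    ultimately have "T (Suc i) = T i" "\<not> q i" "\<not> q (Suc i)" "F (Suc i) \<le> Suc N"
      "F (Suc i) = Suc (F i) \<and> x = bridge_pos m (T i) (F i) \<and> y = 0"
      using x m(2) by auto
    then show ?thesis using m(2) by (simp add: x_def[symmetric]) (auto simp: y_def split: if_splits)
  qed
  have TF: "T i = T 0 \<and> F i = F 0 + i" if "i \<le> Suc N" for i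
    using that by (induction i) (use step in auto)
  \<comment> \<open>The image of the last block has index \<open>F 0 + N + 1\<close>, which may not
    exceed \<open>N + 1\<close>.\<close>
  have F0: "F 0 = 0" using TF[of "Suc N"] step[of N] by simp
  have F: "F i = i" if "i \<le> Suc N" for i using TF[OF that] F0 by simp
  have q: "\<not> q i" if "i \<le> Suc N" for i
    using step[of i] step[of N] that by (cases "i = Suc N") auto
  \<comment> \<open>The bridge from block \<open>t - 1\<close> ends at the start of block
    \<open>t\<close>, so the first path there is not reversed. The outgoing bridge then sits at
    \<open>m - 2\<close> in the image as well, and in block \<open>t\<close> this happens only in
    the chain \<open>t\<close>.\<close>
  have "\<not> fl t False" using step[of "t - 1"] t by simp
  then have "bridge_pos m t t = bridge_pos m (T 0) t"
    using step[of t] TF[of t] F[of t] t by simp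
  then have T0: "T 0 = t" using m(2) by (auto simp: bridge_pos_def split: if_splits)
  show ?thesis
  proof (intro exI allI impI)
    fix i p j assume "i \<le> Suc N" "j \<le> m"
    then show "\<phi> (t, i, p, j) = (t, i, p, if fl i p then m - j else j)"
      using img[of i j p] TF[of i] F[of i] q[of i] T0 by simp
  qed
qed

end


text \<open>A plane drawing. Let A = \<open>(False, 0)\<close>, B = \<open>(True, 0)\<close>, C =
  \<open>(False, m)\<close>, D = \<open>(True, m)\<close> be the corners of a block. The
  quadrilateral A B C D is drawn with the path from A to C outside and the path from B to D inside.
  A bridge leaves on the outer side of the path from A to C and enters the next block at A, between
  B and the first inner vertex of the path. So all bridges of a chain lie in one outer face.\<close>

fun chain_rot :: "nat \<Rightarrow> nat \<Rightarrow> vx \<Rightarrow> vx list" where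
  "chain_rot m N (t, i, p, j) =
     (if p then
        if j = 0 then [(t, i, False, m), (t, i, False, 0), (t, i, True, 1)]
        else if j = m then [(t, i, False, 0), (t, i, False, m), (t, i, True, m - 1)]
        else [(t, i, True, j - 1), (t, i, True, j + 1)]
      else
        if j = 0 then
          if i = 0 then [(t, i, True, 0), (t, i, False, 1), (t, i, True, m)]
          else [(t, i, True, 0), (t, i - 1, False, bridge_pos m t (i - 1)), (t, i, False, 1),
                (t, i, True, m)]
        else if j = m then [(t, i, False, m - 1), (t, i, True, 0), (t, i, True, m)]
        else if j = bridge_pos m t i \<and> i \<le> N then
          [(t, i, False, j - 1), (t, Suc i, False, 0), (t, i, False, j + 1)]
        else [(t, i, False, j - 1), (t, i, False, j + 1)])"

definition chain_verts :: "nat \<Rightarrow> nat \<Rightarrow> nat set \<Rightarrow> vx set" where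
  "chain_verts m N I = I \<times> {..Suc N} \<times> UNIV \<times> {..m}"

lemma chain_verts_iff [simp]:
  "(t, i, p, j) \<in> chain_verts m N I \<longleftrightarrow> t \<in> I \<and> i \<le> Suc N \<and> j \<le> m"
  by (simp add: chain_verts_def)

lemma bridge_pos_bounds:
  assumes "5 \<le> m" shows "0 < bridge_pos m t i" "bridge_pos m t i < m"
  using assms by (auto simp: bridge_pos_def)

lemma chain_rot_iff_adj:
  assumes m: "5 \<le> m" and u: "u \<in> chain_verts m N I"
  shows "v \<in> set (chain_rot m N u) \<longleftrightarrow> chain_adj m N u v"
proof -
  obtain t i p j where u_eq: "u = (t, i, p, j)" by (cases u)
  obtain t' i' q j' where v_eq: "v = (t', i', q, j')" by (cases v)
  have ij: "i \<le> Suc N" "j \<le> m" using u by (auto simp: u_eq)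
  note b = bridge_pos_bounds[OF m, of t i] bridge_pos_bounds[OF m, of t i']
  show ?thesis
  proof (cases p)
    case True
    then show ?thesis using ij m by (cases q) (auto simp: u_eq v_eq)
  next
    case False
    consider "j = 0" "i = 0" | "j = 0" "i \<noteq> 0" | "j = m" | "0 < j" "j < m" using ij by linarith
    then show ?thesis
      by cases (use False ij m b in \<open>cases q; auto simp: u_eq v_eq\<close>)+
  qed
qed

lemma chain_adj_sym: "chain_adj m N u v \<Longrightarrow> chain_adj m N v u"
  by (cases u; cases v) (auto split: if_splits)

lemma chain_adj_irrefl: "m \<noteq> 0 \<Longrightarrow> \<not> chain_adj m N u u"
  by (cases u) auto

lemma chain_adj_verts:
  assumes "5 \<le> m" "chain_adj m N u v" "u \<in> chain_verts m N I" shows "v \<in> chain_verts m N I"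
proof -
  obtain t i p j t' i' q j' where uv: "u = (t, i, p, j)" "v = (t', i', q, j')"
    by (cases u; cases v)
  show ?thesis
    using assms(2,3) bridge_pos_bounds(2)[OF assms(1), of t i'] by (auto simp: uv)
qed

lemma distinct_chain_rot:
  assumes m: "5 \<le> m" shows "distinct (chain_rot m N (t, i, p, j))"
proof -
  have "bridge_pos m t (i - 1) \<noteq> 0" "k - Suc 0 \<noteq> Suc k" for k
    using bridge_pos_bounds[OF m, of t "i - 1"] by simp_all
  then show ?thesis using m by (cases p; cases i) simp_all
qed

lemma chain_rotation_system:
  assumes m: "5 \<le> m" and I: "finite I"
  shows "rotation_system (chain_verts m N I) (chain_rot m N)"
proof
  show "finite (chain_verts m N I)" using I by (simp add: chain_verts_def)
  fix u assume u: "u \<in> chain_verts m N I"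
  obtain t i p j where u_eq: "u = (t, i, p, j)" by (cases u)
  show "distinct (chain_rot m N u)"
    unfolding u_eq by (rule distinct_chain_rot[OF m])
  show "chain_rot m N u \<noteq> []" by (simp add: u_eq)
  fix v assume "v \<in> set (chain_rot m N u)"
  then have adj: "chain_adj m N u v" using chain_rot_iff_adj[OF m u] by simp
  have v: "v \<in> chain_verts m N I" by (rule chain_adj_verts[OF m adj u])
  have "v \<noteq> u" using adj chain_adj_irrefl[of m N u] m by auto
  then show "v \<in> chain_verts m N I \<and> v \<noteq> u \<and> u \<in> set (chain_rot m N v)"
    using v chain_rot_iff_adj[OF m v] chain_adj_sym[OF adj] by simp
qed

section \<open>Faces, components and Euler characteristic of the chain maps\<close>

lemma cyc_next_short:
  "cyc_next [a, b] x = (if x = a then b else if x = b then a else the None)"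
  "cyc_next [a, b, c] x = (if x = a then b else if x = b then c else if x = c then a else the None)"
  "cyc_next [a, b, c, d] x =
    (if x = a then b else if x = b then c else if x = c then d else if x = d then a else the None)"
  by (simp_all add: cyc_next_def)

text \<open>
  A face is labelled by its chain, its block and its number within the block. The outer faces of all
  blocks of the chain \<open>t\<close> are one face, with the label \<open>(t, 0, 0)\<close>.
\<close>

fun chain_face :: "nat \<Rightarrow> vx \<Rightarrow> vx \<Rightarrow> nat \<times> nat \<times> nat" where
  "chain_face m (t, i, p, j) (t', i', q, j') =
     (if i \<noteq> i' then (t, 0, 0)
      else if p = q then
        if j < j' then if p then (t, i, 2) else (t, 0, 0)
        else if p then (t, i, 3) else (t, i, 1)
      else if p then
        if j = 0 then if j' = 0 then (t, 0, 0) else (t, i, 3)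
        else if j' = 0 then (t, i, 2) else (t, i, 1)
      else
        if j = 0 then if j' = 0 then (t, i, 2) else (t, i, 1)
        else if j' = 0 then (t, 0, 0) else (t, i, 3))"

locale chain_map =
  fixes m N :: nat and I :: "nat set"
  assumes m: "5 \<le> m" and fin: "finite I"
begin

abbreviation "V \<equiv> chain_verts m N I"
abbreviation "rot \<equiv> chain_rot m N"

sublocale rotation_system V rot
  by (rule chain_rotation_system[OF m fin])

lemma chain_face_step:
  assumes u: "u \<in> V" and v: "v \<in> set (rot u)"
  shows "chain_face m v (cyc_next (rot v) u) = chain_face m u v"
proof -
  obtain t i p j where u_eq: "u = (t, i, p, j)" by (cases u)
  obtain t' i' q j' where v_eq: "v = (t', i', q, j')" by (cases v)
  have adj: "chain_adj m N u v" using v chain_rot_iff_adj[OF m u] by simp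
  have ij: "i \<le> Suc N" "j \<le> m" "t' = t" "i' \<le> Suc N" "j' \<le> m"
    using u adj rot_sym[OF u v] by (auto simp: u_eq v_eq)
  note b = bridge_pos_bounds[OF m, of t i] bridge_pos_bounds[OF m, of t i']
  consider (up) "i' = i" "q = p" "j' = Suc j" | (down) "i' = i" "q = p" "j = Suc j'"
    | (quad) "i' = i" "q \<noteq> p" "j \<in> {0, m}" "j' \<in> {0, m}"
    | (right) "i' = Suc i" "\<not> p" "\<not> q" "j = bridge_pos m t i" "j' = 0"
    | (left) "i = Suc i'" "\<not> p" "\<not> q" "j' = bridge_pos m t i'" "j = 0"
    using adj by (auto simp: u_eq v_eq split: if_splits)
  then show ?thesis
  proof cases
    case up
    then show ?thesis using ij m b by (cases p) (auto simp: u_eq v_eq cyc_next_short)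
  next
    case down
    then show ?thesis using ij m b by (cases p) (auto simp: u_eq v_eq cyc_next_short)
  next
    case quad
    then show ?thesis using ij m b by (cases p) (auto simp: u_eq v_eq cyc_next_short)
  next
    case right
    then show ?thesis using ij m b by (auto simp: u_eq v_eq cyc_next_short)
  next
    case left
    then show ?thesis using ij m b by (auto simp: u_eq v_eq cyc_next_short)
  qed
qed

definition face_conn :: "vx \<times> vx \<Rightarrow> vx \<times> vx \<Rightarrow> bool" where
  "face_conn x y \<longleftrightarrow> (x, y) \<in> (face_steps \<union> face_steps\<inverse>)\<^sup>*"

lemma face_conn_refl: "face_conn x x"
  by (simp add: face_conn_def)

lemma face_conn_trans [trans]: "face_conn x y \<Longrightarrow> face_conn y z \<Longrightarrow> face_conn x z"
  by (simp add: face_conn_def)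

lemma face_conn_sym: "face_conn x y \<Longrightarrow> face_conn y x"
  unfolding face_conn_def by (rule symD[OF sym_rtrancl[OF sym_Un_converse]])

lemma face_conn_step:
  assumes "u \<in> V" "chain_adj m N u v" "cyc_next (rot v) u = w"
  shows "face_conn (u, v) (v, w)"
proof -
  have "v \<in> set (rot u)" using chain_rot_iff_adj[OF m assms(1)] assms(2) by blast
  then have "((u, v), (v, w)) \<in> face_steps"
    unfolding face_steps_def assms(3)[symmetric] using assms(1) by blast
  then show ?thesis unfolding face_conn_def by (intro r_into_rtrancl UnI1)
qed

context
  fixes t i assumes t: "t \<in> I" and i: "i \<le> Suc N"
begin

text \<open>The outgoing bridge interrupts the outer face along the path from A to C. Edges after
  the bridge are followed forwards, over C and B, to the edge from B to A; edges before it
  (\<open>outer_head\<close>) are followed backwards to the start of the path. In the last block,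
  which has no outgoing bridge, the same division is harmless.\<close>

lemma outer_tail:
  assumes "bridge_pos m t i \<le> j" "j < m"
  shows "face_conn ((t, i, False, j), (t, i, False, Suc j)) ((t, i, True, 0), (t, i, False, 0))"
proof -
  have "j \<le> m - 1" using assms(2) by simp
  then show ?thesis
    using assms(1)
  proof (induction j rule: inc_induct)
    case base
    have "face_conn ((t, i, False, m - 1), (t, i, False, m)) ((t, i, False, m), (t, i, True, 0))"
      by (rule face_conn_step) (use t i m in \<open>simp_all add: cyc_next_short\<close>)
    also have "face_conn \<dots> ((t, i, True, 0), (t, i, False, 0))"
      by (rule face_conn_step) (use t i m in \<open>simp_all add: cyc_next_short\<close>)
    finally show ?case using m by simp
  next
    case (step j)
    have j: "Suc j < m" "bridge_pos m t i \<le> j" using step by simp_all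
    have "face_conn ((t, i, False, j), (t, i, False, Suc j)) ((t, i, False, Suc j), (t, i, False, Suc (Suc j)))"
      by (rule face_conn_step) (use t i m j in \<open>simp_all add: cyc_next_short\<close>)
    also have "face_conn \<dots> ((t, i, True, 0), (t, i, False, 0))"
      using step by simp
    finally show ?case .
  qed
qed

lemma outer_head:
  assumes "j < bridge_pos m t i"
  shows "face_conn ((t, i, False, j), (t, i, False, Suc j)) ((t, i, False, 0), (t, i, False, 1))"
  using assms
proof (induction j)
  case 0 then show ?case by (simp add: face_conn_refl)
next
  case (Suc j)
  have "face_conn ((t, i, False, j), (t, i, False, Suc j)) ((t, i, False, Suc j), (t, i, False, Suc (Suc j)))"
    by (rule face_conn_step)
      (use t i m Suc.prems bridge_pos_bounds[OF m, of t i] in \<open>simp_all add: cyc_next_short\<close>)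
  then have "face_conn ((t, i, False, Suc j), (t, i, False, Suc (Suc j))) ((t, i, False, j), (t, i, False, Suc j))"
    by (rule face_conn_sym)
  also have "face_conn \<dots> ((t, i, False, 0), (t, i, False, 1))" using Suc by simp
  finally show ?case .
qed

lemma outer_C_B: "face_conn ((t, i, False, m), (t, i, True, 0)) ((t, i, True, 0), (t, i, False, 0))"
  by (rule face_conn_step) (use t i m in \<open>simp_all add: cyc_next_short\<close>)

text \<open>This is the inner side of the path from A to C, so the face walk passes the vertex of
  the outgoing bridge without turning into it.\<close>

lemma face1_path:
  "j < m \<Longrightarrow> face_conn ((t, i, False, Suc j), (t, i, False, j)) ((t, i, True, m), (t, i, False, m))"
proof (induction j)
  case 0
  have "face_conn ((t, i, False, Suc 0), (t, i, False, 0)) ((t, i, False, 0), (t, i, True, m))"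
    by (rule face_conn_step) (use t i m in \<open>cases i; simp add: cyc_next_short\<close>)+
  also have "face_conn \<dots> ((t, i, True, m), (t, i, False, m))"
    by (rule face_conn_step) (use t i m in \<open>simp_all add: cyc_next_short\<close>)
  finally show ?case .
next
  case (Suc j)
  have "face_conn ((t, i, False, Suc (Suc j)), (t, i, False, Suc j)) ((t, i, False, Suc j), (t, i, False, j))"
    by (rule face_conn_step) (use t i m Suc.prems in \<open>simp_all add: cyc_next_short\<close>, arith)
  also have "face_conn \<dots> ((t, i, True, m), (t, i, False, m))" using Suc by simp
  finally show ?case .
qed

lemma face1_A_D: "face_conn ((t, i, False, 0), (t, i, True, m)) ((t, i, True, m), (t, i, False, m))"
  by (rule face_conn_step) (use t i m in \<open>simp_all add: cyc_next_short\<close>)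

lemma face2_path:
  assumes "j < m"
  shows "face_conn ((t, i, True, j), (t, i, True, Suc j)) ((t, i, True, m), (t, i, False, 0))"
proof -
  have "j \<le> m - 1" using assms by simp
  then show ?thesis
  proof (induction j rule: inc_induct)
    case base
    have "face_conn ((t, i, True, m - 1), (t, i, True, m)) ((t, i, True, m), (t, i, False, 0))"
      by (rule face_conn_step) (use t i m in \<open>simp_all add: cyc_next_short\<close>)
    then show ?case using m by simp
  next
    case (step j)
    have j: "Suc j < m" using step by simp
    have "face_conn ((t, i, True, j), (t, i, True, Suc j)) ((t, i, True, Suc j), (t, i, True, Suc (Suc j)))"
      by (rule face_conn_step) (use t i m j in \<open>simp_all add: cyc_next_short\<close>)
    also have "face_conn \<dots> ((t, i, True, m), (t, i, False, 0))"
      using step by simp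
    finally show ?case .
  qed
qed

lemma face2_A_B: "face_conn ((t, i, False, 0), (t, i, True, 0)) ((t, i, True, m), (t, i, False, 0))"
proof -
  have "face_conn ((t, i, False, 0), (t, i, True, 0)) ((t, i, True, 0), (t, i, True, Suc 0))"
    by (rule face_conn_step) (use t i m in \<open>simp_all add: cyc_next_short\<close>)
  also have "face_conn \<dots> ((t, i, True, m), (t, i, False, 0))" using face2_path[of 0] m by simp
  finally show ?thesis .
qed

lemma face3_B_C: "face_conn ((t, i, True, 0), (t, i, False, m)) ((t, i, False, m), (t, i, True, m))"
  by (rule face_conn_step) (use t i m in \<open>simp_all add: cyc_next_short\<close>)

lemma face3_path:
  "j < m \<Longrightarrow> face_conn ((t, i, True, Suc j), (t, i, True, j)) ((t, i, False, m), (t, i, True, m))"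
proof (induction j)
  case 0
  have "face_conn ((t, i, True, Suc 0), (t, i, True, 0)) ((t, i, True, 0), (t, i, False, m))"
    by (rule face_conn_step) (use t i m in \<open>simp_all add: cyc_next_short\<close>)
  also have "face_conn \<dots> ((t, i, False, m), (t, i, True, m))" by (rule face3_B_C)
  finally show ?case .
next
  case (Suc j)
  have "face_conn ((t, i, True, Suc (Suc j)), (t, i, True, Suc j)) ((t, i, True, Suc j), (t, i, True, j))"
    by (rule face_conn_step) (use t i m Suc.prems in \<open>simp_all add: cyc_next_short\<close>)
  also have "face_conn \<dots> ((t, i, False, m), (t, i, True, m))" using Suc by simp
  finally show ?case .
qed

end

text \<open>The second claim lowers the block index by one for the outgoing part of the outer face,
  and \<open>outer_bridge_down\<close> does so for the returning part; induction then leads both to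
  block 0.\<close>

lemma outer_bridge_up:
  assumes "t \<in> I" "i \<le> N"
  shows "face_conn ((t, i, False, bridge_pos m t i), (t, Suc i, False, 0))
      ((t, i, False, 0), (t, i, False, 1))"
    and "face_conn ((t, Suc i, False, 0), (t, Suc i, False, 1)) ((t, i, False, 0), (t, i, False, 1))"
proof -
  let ?r = "bridge_pos m t i"
  note b = bridge_pos_bounds[OF m, of t i]
  have r: "Suc (?r - 1) = ?r" using b by simp
  have "face_conn ((t, i, False, ?r - 1), (t, i, False, ?r)) ((t, i, False, ?r), (t, Suc i, False, 0))"
    by (rule face_conn_step) (use assms m b in \<open>simp_all add: cyc_next_short\<close>)
  moreover have "face_conn ((t, i, False, ?r - 1), (t, i, False, ?r)) ((t, i, False, 0), (t, i, False, 1))"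
    using outer_head[of t i "?r - 1"] r b assms by simp
  ultimately show 1: "face_conn ((t, i, False, ?r), (t, Suc i, False, 0)) ((t, i, False, 0), (t, i, False, 1))"
    using face_conn_sym face_conn_trans by blast
  have "face_conn ((t, i, False, ?r), (t, Suc i, False, 0)) ((t, Suc i, False, 0), (t, Suc i, False, 1))"
    by (rule face_conn_step) (use assms m b in \<open>simp_all add: cyc_next_short\<close>)
  then show "face_conn ((t, Suc i, False, 0), (t, Suc i, False, 1)) ((t, i, False, 0), (t, i, False, 1))"
    using face_conn_trans[OF face_conn_sym 1] by blast
qed

lemma outer_bridge_down:
  assumes "t \<in> I" "i \<le> N"
  shows "face_conn ((t, Suc i, False, 0), (t, i, False, bridge_pos m t i))
      ((t, i, True, 0), (t, i, False, 0))"
    and "face_conn ((t, Suc i, True, 0), (t, Suc i, False, 0)) ((t, i, True, 0), (t, i, False, 0))"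
proof -
  let ?r = "bridge_pos m t i"
  note b = bridge_pos_bounds[OF m, of t i]
  have "face_conn ((t, Suc i, False, 0), (t, i, False, ?r)) ((t, i, False, ?r), (t, i, False, Suc ?r))"
    by (rule face_conn_step) (use assms m b in \<open>simp_all add: cyc_next_short\<close>)
  also have "face_conn \<dots> ((t, i, True, 0), (t, i, False, 0))"
    using outer_tail[of t i ?r] assms b by simp
  finally show 1: "face_conn ((t, Suc i, False, 0), (t, i, False, ?r)) ((t, i, True, 0), (t, i, False, 0))" .
  have "face_conn ((t, Suc i, True, 0), (t, Suc i, False, 0)) ((t, Suc i, False, 0), (t, i, False, ?r))"
    by (rule face_conn_step) (use assms m b in \<open>simp_all add: cyc_next_short\<close>)
  also have "face_conn \<dots> ((t, i, True, 0), (t, i, False, 0))" by (rule 1)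
  finally show "face_conn ((t, Suc i, True, 0), (t, Suc i, False, 0)) ((t, i, True, 0), (t, i, False, 0))" .
qed

lemma outer_base:
  assumes t: "t \<in> I" and i: "i \<le> Suc N"
  shows "face_conn ((t, i, True, 0), (t, i, False, 0)) ((t, 0, True, 0), (t, 0, False, 0))"
    and "face_conn ((t, i, False, 0), (t, i, False, 1)) ((t, 0, True, 0), (t, 0, False, 0))"
proof -
  show "face_conn ((t, i, True, 0), (t, i, False, 0)) ((t, 0, True, 0), (t, 0, False, 0))"
    using i
  proof (induction i)
    case (Suc i)
    have "face_conn ((t, Suc i, True, 0), (t, Suc i, False, 0)) ((t, i, True, 0), (t, i, False, 0))"
      by (rule outer_bridge_down(2)[OF t]) (use Suc in simp)
    also have "face_conn \<dots> ((t, 0, True, 0), (t, 0, False, 0))" using Suc by simp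
    finally show ?case .
  qed (rule face_conn_refl)
  have "face_conn ((t, i, False, 0), (t, i, False, 1)) ((t, 0, False, 0), (t, 0, False, 1))"
    using i
  proof (induction i)
    case (Suc i)
    have "face_conn ((t, Suc i, False, 0), (t, Suc i, False, 1)) ((t, i, False, 0), (t, i, False, 1))"
      by (rule outer_bridge_up(2)[OF t]) (use Suc in simp)
    also have "face_conn \<dots> ((t, 0, False, 0), (t, 0, False, 1))" using Suc by simp
    finally show ?case .
  qed (rule face_conn_refl)
  \<comment> \<open>At A in block 0 no bridge intervenes, so the edge from B to A continues straight
    into the path. This joins the two parts of the outer face.\<close>
  also have "face_conn ((t, 0, True, 0), (t, 0, False, 0)) ((t, 0, False, 0), (t, 0, False, 1))"
    by (rule face_conn_step) (use t m in \<open>simp_all add: cyc_next_short\<close>)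
  then have "face_conn ((t, 0, False, 0), (t, 0, False, 1)) ((t, 0, True, 0), (t, 0, False, 0))"
    by (rule face_conn_sym)
  finally show "face_conn ((t, i, False, 0), (t, i, False, 1)) ((t, 0, True, 0), (t, 0, False, 0))" .
qed

definition face_dart :: "nat \<times> nat \<times> nat \<Rightarrow> vx \<times> vx" where
  "face_dart f = (case f of (t, i, c) \<Rightarrow>
     if c = 0 then ((t, 0, True, 0), (t, 0, False, 0))
     else if c = 1 then ((t, i, True, m), (t, i, False, m))
     else if c = 2 then ((t, i, True, m), (t, i, False, 0))
     else ((t, i, False, m), (t, i, True, m)))"

lemma chain_face_conn:
  assumes u: "u \<in> V" and v: "v \<in> set (rot u)"
  shows "face_conn (u, v) (face_dart (chain_face m u v))"
proof -
  obtain t i p j where u_eq: "u = (t, i, p, j)" by (cases u)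
  obtain t' i' q j' where v_eq: "v = (t', i', q, j')" by (cases v)
  have adj: "chain_adj m N u v" using v chain_rot_iff_adj[OF m u] by simp
  have ij: "t \<in> I" "i \<le> Suc N" "j \<le> m" "t' = t" "i' \<le> Suc N" "j' \<le> m"
    using u adj rot_sym[OF u v] by (auto simp: u_eq v_eq)
  have m0: "m \<noteq> 0" using m by simp
  note base = outer_base[OF ij(1)]
  consider (up) "i' = i" "\<not> p" "\<not> q" "j' = Suc j" | (down) "i' = i" "\<not> p" "\<not> q" "j = Suc j'"
    | (up') "i' = i" "p" "q" "j' = Suc j" | (down') "i' = i" "p" "q" "j = Suc j'"
    | (AB) "i' = i" "\<not> p" "q" "j = 0" "j' = 0" | (AD) "i' = i" "\<not> p" "q" "j = 0" "j' = m"
    | (CB) "i' = i" "\<not> p" "q" "j = m" "j' = 0" | (CD) "i' = i" "\<not> p" "q" "j = m" "j' = m"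
    | (BA) "i' = i" "p" "\<not> q" "j = 0" "j' = 0" | (BC) "i' = i" "p" "\<not> q" "j = 0" "j' = m"
    | (DA) "i' = i" "p" "\<not> q" "j = m" "j' = 0" | (DC) "i' = i" "p" "\<not> q" "j = m" "j' = m"
    | (right) "i' = Suc i" "\<not> p" "\<not> q" "j = bridge_pos m t i" "j' = 0"
    | (left) "i = Suc i'" "\<not> p" "\<not> q" "j' = bridge_pos m t i'" "j = 0"
    using adj by (auto simp: u_eq v_eq split: if_splits)
  then show ?thesis
  proof cases
    case up
    then have j: "j < m" using ij by simp
    have "face_conn (u, v) ((t, 0, True, 0), (t, 0, False, 0))"
    proof (cases "j < bridge_pos m t i")
      case True
      show ?thesis
        using face_conn_trans[OF outer_head[OF ij(1,2) True] base(2)[OF ij(2)]] up ij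
        by (simp add: u_eq v_eq)
    next
      case False
      then have "bridge_pos m t i \<le> j" by simp
      from face_conn_trans[OF outer_tail[OF ij(1,2) this j] base(1)[OF ij(2)]]
      show ?thesis using up ij by (simp add: u_eq v_eq)
    qed
    then show ?thesis using up by (simp add: u_eq v_eq face_dart_def)
  next
    case down
    then show ?thesis using face1_path[OF ij(1,2), of j'] ij by (simp add: u_eq v_eq face_dart_def)
  next
    case up'
    then show ?thesis using face2_path[OF ij(1,2), of j] ij by (simp add: u_eq v_eq face_dart_def)
  next
    case down'
    then show ?thesis using face3_path[OF ij(1,2), of j'] ij by (simp add: u_eq v_eq face_dart_def)
  next
    case AB
    then show ?thesis using face2_A_B[OF ij(1,2)] ij by (simp add: u_eq v_eq face_dart_def)
  next
    case AD
    then show ?thesis using face1_A_D[OF ij(1,2)] ij m0 by (simp add: u_eq v_eq face_dart_def)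
  next
    case CB
    then show ?thesis
      using face_conn_trans[OF outer_C_B[OF ij(1,2)] base(1)[OF ij(2)]] ij m0
      by (simp add: u_eq v_eq face_dart_def)
  next
    case CD
    then show ?thesis using ij m0 by (simp add: u_eq v_eq face_dart_def face_conn_refl)
  next
    case BA
    then show ?thesis using base(1)[OF ij(2)] ij by (simp add: u_eq v_eq face_dart_def)
  next
    case BC
    then show ?thesis using face3_B_C[OF ij(1,2)] ij m0 by (simp add: u_eq v_eq face_dart_def)
  next
    case DA
    then show ?thesis using ij m0 by (simp add: u_eq v_eq face_dart_def face_conn_refl)
  next
    case DC
    then show ?thesis using ij m0 by (simp add: u_eq v_eq face_dart_def face_conn_refl)
  next
    case right
    have "i \<le> N" using right ij by simp
    then show ?thesis
      using face_conn_trans[OF outer_bridge_up(1)[OF ij(1)] base(2)[OF ij(2)]] right ij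
      by (simp add: u_eq v_eq face_dart_def)
  next
    case left
    have i': "i' \<le> N" using left ij by simp
    then show ?thesis
      using face_conn_trans[OF outer_bridge_down(1)[OF ij(1) i'] base(1)[OF ij(5)]] left ij
      by (simp add: u_eq v_eq face_dart_def)
  qed
qed

lemma chain_num_faces: "num_faces M = card I * (3 * (N + 2) + 1)"
proof -
  let ?F = "(\<lambda>t. (t, 0, 0)) ` I \<union> I \<times> {..Suc N} \<times> {1, 2, 3 :: nat}"
  have "{chain_face m u v | u v. u \<in> V \<and> v \<in> set (rot u)} = ?F"
  proof
    show "{chain_face m u v | u v. u \<in> V \<and> v \<in> set (rot u)} \<subseteq> ?F"
    proof
      fix f assume "f \<in> {chain_face m u v | u v. u \<in> V \<and> v \<in> set (rot u)}"
      then obtain u v where u: "u \<in> V" and f: "f = chain_face m u v" by blast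
      obtain t i p j t' i' q j' where uv: "u = (t, i, p, j)" "v = (t', i', q, j')"
        by (cases u; cases v)
      show "f \<in> ?F" using u unfolding f uv by (auto split: if_splits)
    qed
    have dart: "chain_face m u v \<in> {chain_face m u v | u v. u \<in> V \<and> v \<in> set (rot u)}"
      if "u \<in> V" "chain_adj m N u v" for u v
      using that chain_rot_iff_adj[OF m that(1), of v] by blast
    show "?F \<subseteq> {chain_face m u v | u v. u \<in> V \<and> v \<in> set (rot u)}"
    proof
      fix f assume "f \<in> ?F"
      then consider t where "t \<in> I" "f = (t, 0, 0)" | t i where "t \<in> I" "i \<le> Suc N" "f = (t, i, 1)"
        | t i where "t \<in> I" "i \<le> Suc N" "f = (t, i, 2)" | t i where "t \<in> I" "i \<le> Suc N" "f = (t, i, 3)"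
        by auto
      then show "f \<in> {chain_face m u v | u v. u \<in> V \<and> v \<in> set (rot u)}"
      proof cases
        case (1 t)
        then show ?thesis using dart[of "(t, 0, True, 0)" "(t, 0, False, 0)"] m by simp
      next
        case (2 t i)
        then show ?thesis using dart[of "(t, i, True, m)" "(t, i, False, m)"] m by simp
      next
        case (3 t i)
        then show ?thesis using dart[of "(t, i, True, m)" "(t, i, False, 0)"] m by simp
      next
        case (4 t i)
        then show ?thesis using dart[of "(t, i, False, m)" "(t, i, True, m)"] m by simp
      qed
    qed
  qed
  then have "num_faces M = card ?F"
    using rotation_map_num_faces[of "chain_face m" face_dart] chain_face_step chain_face_conn
    by (simp add: face_conn_def)
  also have "\<dots> = card I + card I * ((N + 2) * 3)"
    using fin by (subst card_Un_disjoint) 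
      (auto simp: card_image inj_on_def card_cartesian_product algebra_simps)
  finally show ?thesis by (simp add: algebra_simps)
qed

lemma chain_num_comps: "num_comps M = card I"
proof -
  let ?R = "{(u, v). u \<in> V \<and> v \<in> set (rot u)}"
  have edge: "(u, v) \<in> ?R" if "u \<in> V" "chain_adj m N u v" for u v
    using that chain_rot_iff_adj[OF m that(1), of v] by simp
  have path: "((t, i, p, j), (t, i, p, 0)) \<in> ?R\<^sup>*" if "t \<in> I" "i \<le> Suc N" "j \<le> m" for t i p j
    using that(3)
  proof (induction j)
    case (Suc j)
    have "((t, i, p, Suc j), (t, i, p, j)) \<in> ?R" by (rule edge) (use that Suc in simp_all)
    moreover have "((t, i, p, j), (t, i, p, 0)) \<in> ?R\<^sup>*" by (rule Suc.IH) (use Suc.prems in simp)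
    ultimately show ?case by (rule converse_rtrancl_into_rtrancl)
  qed (rule rtrancl_refl)
  have base: "((t, i, False, 0), (t, 0, False, 0)) \<in> ?R\<^sup>*" if "t \<in> I" "i \<le> Suc N" for t i
    using that(2)
  proof (induction i)
    case (Suc i)
    note b = bridge_pos_bounds[OF m, of t i]
    have "((t, Suc i, False, 0), (t, i, False, bridge_pos m t i)) \<in> ?R"
      by (rule edge) (use that Suc b in simp_all)
    moreover have "((t, i, False, bridge_pos m t i), (t, i, False, 0)) \<in> ?R\<^sup>*"
      by (rule path) (use that Suc.prems b in simp_all)
    moreover have "((t, i, False, 0), (t, 0, False, 0)) \<in> ?R\<^sup>*" by (rule Suc.IH) (use Suc.prems in simp)
    ultimately show ?case by (meson converse_rtrancl_into_rtrancl rtrancl_trans)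
  qed (rule rtrancl_refl)
  have "num_comps M = card (fst ` V)"
  proof (rule rotation_map_num_comps[where d = "\<lambda>t. (t, 0, False, 0)"])
    fix u v assume "u \<in> V" "v \<in> set (rot u)"
    then have "chain_adj m N u v" using chain_rot_iff_adj[OF m, of u] by simp
    then show "fst v = fst u" by (cases u; cases v) simp
  next
    fix u assume u: "u \<in> V"
    obtain t i p j where u_eq: "u = (t, i, p, j)" by (cases u)
    have ti: "t \<in> I" "i \<le> Suc N" "j \<le> m" using u by (simp_all add: u_eq)
    have "((t, i, p, 0), (t, i, False, 0)) \<in> ?R\<^sup>*"
    proof (cases p)
      case True
      have "((t, i, p, 0), (t, i, False, 0)) \<in> ?R" by (rule edge) (use ti True in simp_all)
      then show ?thesis by (rule r_into_rtrancl)
    next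
      case False
      then show ?thesis by (simp only: rtrancl_refl)
    qed
    then have "(u, (t, 0, False, 0)) \<in> ?R\<^sup>*"
      using path[OF ti, of p] base[OF ti(1,2)] unfolding u_eq by (meson rtrancl_trans)
    then show "(u, (fst u, 0, False, 0)) \<in> ?R\<^sup>*" by (simp add: u_eq)
  qed
  also have "fst ` V = I" by (force simp: chain_verts_def image_iff)
  finally show ?thesis .
qed

text \<open>Every vertex has degree two, plus one at the four corners of a block, plus one for each
  end of a bridge.\<close>

lemma chain_num_edges: "num_edges M = card I * ((N + 2) * (2 * m + 4) + N + 1)"
proof -
  have len: "length (rot (t, i, p, j)) = 2 + of_bool (j = 0) + of_bool (j = m) +
      of_bool (j = 0 \<and> \<not> p \<and> i \<noteq> 0) + of_bool (j = bridge_pos m t i \<and> \<not> p \<and> i \<le> N)" for t i p j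
    using m bridge_pos_bounds[OF m, of t i] by auto
  have r: "bridge_pos m t i \<in> {..m}" for t i using bridge_pos_bounds[OF m, of t i] by simp
  have sum_eq: "(\<Sum>j\<le>m. of_bool (j = c \<and> P)) = (of_bool P :: nat)" if "c \<le> m" for c P
    using that by (cases P) (simp_all add: of_bool_def sum.delta)
  have sum_eq': "(\<Sum>j\<le>m. of_bool (j = c)) = (1 :: nat)" if "c \<le> m" for c
    using sum_eq[OF that, of True] by simp
  have inner: "(\<Sum>p\<in>UNIV. \<Sum>j\<le>m. length (rot (t, i, p, j))) =
      4 * m + 8 + of_bool (i \<noteq> 0) + of_bool (i \<le> N)" for t i
  proof -
    have "(\<Sum>j\<le>m. length (rot (t, i, p, j))) =
        2 * (m + 1) + 2 + of_bool (\<not> p \<and> i \<noteq> 0) + of_bool (\<not> p \<and> i \<le> N)" for p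
    proof -
      have "(\<Sum>j\<le>m. of_bool (j = 0 \<and> \<not> p \<and> i \<noteq> 0)) = (of_bool (\<not> p \<and> i \<noteq> 0) :: nat)"
        by (rule sum_eq) simp
      moreover have "(\<Sum>j\<le>m. of_bool (j = bridge_pos m t i \<and> \<not> p \<and> i \<le> N)) =
          (of_bool (\<not> p \<and> i \<le> N) :: nat)"
        by (rule sum_eq) (use r[of t i] in simp)
      moreover have "(\<Sum>j\<le>m. of_bool (j = 0)) = (1 :: nat)" "(\<Sum>j\<le>m. of_bool (j = m)) = (1 :: nat)"
        by (rule sum_eq'; simp)+
      ultimately show ?thesis unfolding len sum.distrib by simp
    qed
    then show ?thesis by (simp add: UNIV_bool)
  qed
  have "2 * num_edges M = (\<Sum>u\<in>V. length (rot u))" by (rule rotation_map_num_edges)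
  also have "\<dots> = (\<Sum>t\<in>I. \<Sum>i\<le>Suc N. \<Sum>p\<in>UNIV. \<Sum>j\<le>m. length (rot (t, i, p, j)))"
    by (simp only: chain_verts_def sum.cartesian_product')
  also have "\<dots> = (\<Sum>t\<in>I. \<Sum>i\<le>Suc N. 4 * m + 8 + of_bool (i \<noteq> 0) + of_bool (i \<le> N))"
    by (simp only: inner)
  also have "(\<Sum>i\<le>Suc N. 4 * m + 8 + of_bool (i \<noteq> 0) + of_bool (i \<le> N)) =
      (N + 2) * (4 * m + 8) + 2 * (N + 1)"
  proof -
    have "(\<Sum>i\<le>Suc N. of_bool (i \<noteq> 0) :: nat) = N + 1" by (subst sum.atMost_Suc_shift) simp
    moreover have "(\<Sum>i\<le>Suc N. of_bool (i \<le> N) :: nat) = N + 1" by simp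
    ultimately show ?thesis by (simp add: sum.distrib)
  qed
  finally show ?thesis by (simp add: algebra_simps)
qed

text \<open>Each chain has Euler characteristic \<open>(N + 2) * (2 * m + 2) - ((N + 2) * (2 * m +
  4) + N + 1) + (3 * (N + 2) + 1) = 2\<close>.\<close>

lemma chain_plane: "plane M"
proof -
  have "card V = card I * ((N + 2) * (2 * (m + 1)))"
    by (simp add: chain_verts_def card_cartesian_product)
  then have "num_verts M = card I * ((N + 2) * (2 * (m + 1)))"
    by (simp only: rotation_map_num_verts)
  then show ?thesis
    by (simp add: plane_def euler_genus_def euler_char_def chain_num_faces chain_num_comps
        chain_num_edges algebra_simps)
qed

end

text \<open>Every chain of \<open>I\<close> is mapped to itself, path by path and up to reversal.
  Reversing a second path is an automorphism of the graph, so injectivity is the most that can be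
  claimed; it gives the cores, and \<open>I \<subseteq> J\<close> excludes homomorphisms between
  different chains.\<close>

lemma chain_map_hom_rigid:
  assumes m_odd: "odd m" and I: "I \<subseteq> {1..N}"
    and \<phi>: "\<And>u. u \<in> chain_verts m N I \<Longrightarrow> \<phi> u \<in> chain_verts m N J"
    and adj: "\<And>u v. u \<in> chain_verts m N I \<Longrightarrow> v \<in> set (chain_rot m N u) \<Longrightarrow>
      \<phi> v \<in> set (chain_rot m N (\<phi> u))"
    and m: "5 \<le> m"
  shows "I \<subseteq> J" and "inj_on \<phi> (chain_verts m N I)"
proof -
  have rigid: "\<exists>fl. \<forall>i\<le>Suc N. \<forall>p. \<forall>j\<le>m. \<phi> (t, i, p, j) = (t, i, p, if fl i p then m - j else j)"
    if t: "t \<in> I" for t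
  proof (rule chain_hom.rigid, unfold_locales)
    show "odd m" "5 \<le> m" by (fact m_odd m)+
    show "1 \<le> t" "t \<le> N" using t I by auto
    fix i p j v assume uv: "chain_adj m N (t, i, p, j) v"
    have u: "(t, i, p, j) \<in> chain_verts m N I"
      using uv t bridge_pos_bounds(2)[OF m, of t i] by (cases v) auto
    have "v \<in> set (chain_rot m N (t, i, p, j))" using uv chain_rot_iff_adj[OF m u] by blast
    then show "chain_adj m N (\<phi> (t, i, p, j)) (\<phi> v)"
      using adj[OF u] chain_rot_iff_adj[OF m \<phi>[OF u]] by blast
  qed
  then obtain fl where fl: "\<And>t i p j. t \<in> I \<Longrightarrow> i \<le> Suc N \<Longrightarrow> j \<le> m \<Longrightarrow>
      \<phi> (t, i, p, j) = (t, i, p, if fl t i p then m - j else j)"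
    by metis
  show "I \<subseteq> J"
  proof
    fix t assume t: "t \<in> I"
    have "\<phi> (t, 0, False, 0) \<in> chain_verts m N J" by (rule \<phi>) (use t in simp)
    then show "t \<in> J" using fl[OF t, of 0 0 False] by simp
  qed
  show "inj_on \<phi> (chain_verts m N I)"
  proof (rule inj_onI)
    fix u v assume uv: "u \<in> chain_verts m N I" "v \<in> chain_verts m N I" "\<phi> u = \<phi> v"
    obtain t i p j where u: "u = (t, i, p, j)" by (cases u)
    obtain t' i' p' j' where v: "v = (t', i', p', j')" by (cases v)
    have b: "t \<in> I" "i \<le> Suc N" "j \<le> m" "t' \<in> I" "i' \<le> Suc N" "j' \<le> m"
      using uv(1,2) by (simp_all add: u v)
    have eq: "(t, i, p, if fl t i p then m - j else j) = (t', i', p', if fl t' i' p' then m - j' else j')"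
      using uv(3) by (simp only: u v fl[OF b(1-3)] fl[OF b(4-6)])
    then have "t = t'" "i = i'" "p = p'" by simp_all
    moreover from this have "j = j'" using eq b(3,6) by (auto split: if_splits)
    ultimately show "u = v" by (simp add: u v)
  qed
qed

section \<open>Cores, odd girth and homomorphisms of the chain maps\<close>

context chain_map
begin

lemma chain_graph_core:
  assumes "odd m" "I \<subseteq> {1..N}" shows "graph_core (underlying_graph M)"
proof (rule graph_core_rotation_map)
  fix \<phi> assume *: "\<And>u. u \<in> V \<Longrightarrow> \<phi> u \<in> V"
    "\<And>u v. u \<in> V \<Longrightarrow> v \<in> set (rot u) \<Longrightarrow> \<phi> v \<in> set (rot (\<phi> u))"
  show "inj_on \<phi> V" by (rule chain_map_hom_rigid(2)[OF assms * m])
qed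

lemma chain_odd_girth:
  assumes m_odd: "odd m" and "I \<noteq> {}" shows "odd_girth (underlying_graph M) = enat (m + 2)"
proof -
  obtain t where t: "t \<in> I" using assms(2) by blast
  \<comment> \<open>The facial cycle of block 0 along the path from A to C and over B.\<close>
  define c :: "nat \<Rightarrow> vx" where "c i = (if i \<le> m then (t, 0, False, i) else (t, 0, True, 0))" for i
  show ?thesis
  proof (rule odd_girth_rotation_map)
    show "odd (m + 2)" "3 \<le> m + 2" using m_odd m by simp_all
    show "inj_on c {..<m + 2}" by (auto simp: inj_on_def c_def split: if_splits)
    fix i assume i: "i < m + 2"
    consider "i < m" | "i = m" | "i = m + 1" using i by linarith
    then have "c i \<in> V \<and> chain_adj m N (c i) (c (Suc i mod (m + 2)))"
      by cases (use t in \<open>simp_all add: c_def\<close>)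
    then show "c i \<in> V \<and> c (Suc i mod (m + 2)) \<in> set (rot (c i))"
      using chain_rot_iff_adj[OF m] by blast
  next
    fix w n assume *: "odd n" "\<And>i. i < n \<Longrightarrow> w i \<in> V \<and> w (Suc i) \<in> set (rot (w i))" "w n = w 0"
    have "chain_adj m N (w i) (w (Suc i))" if "i < n" for i
      using *(2)[OF that] chain_rot_iff_adj[OF m, of "w i" N I] by simp
    then have "chain_walk m N w n" using *(3) by (simp add: chain_walk_def)
    then show "m + 2 \<le> n" using closed_walk_length(1)[OF m_odd _ *(1)] by blast
  qed
qed

lemma chain_crosses: "I \<noteq> {} \<Longrightarrow> crosses M \<noteq> {}"
proof -
  assume "I \<noteq> {}"
  then obtain t where "t \<in> I" by blast
  then have "((t, 0, True, 0), (t, 0, False, 0), True) \<in> flags V rot" by (simp add: flags_def)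
  then show "crosses M \<noteq> {}" unfolding rotation_map_simps(1) by blast
qed

lemma chain_submap:
  assumes "J \<subseteq> I" shows "submap (rotation_map (chain_verts m N J) rot) M"
proof (rule rotation_submap)
  show "chain_verts m N J \<subseteq> V" using assms by (auto simp: chain_verts_def)
  fix u v assume u: "u \<in> chain_verts m N J" and v: "v \<in> set (rot u)"
  have "chain_adj m N u v" using v chain_rot_iff_adj[OF m u] by simp
  then show "v \<in> chain_verts m N J" by (rule chain_adj_verts[OF m _ u])
qed

end

lemma chain_no_map_hom:
  assumes m: "5 \<le> m" "odd m" and I: "I \<subseteq> {1..N}" and J: "finite J" "J \<noteq> {}"
    and hom: "map_hom (rotation_map (chain_verts m N I) (chain_rot m N))
      (rotation_map (chain_verts m N J) (chain_rot m N))"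
  shows "I \<subseteq> J"
proof -
  interpret I: chain_map m N I by unfold_locales (use m I finite_subset in auto)
  interpret J: chain_map m N J by unfold_locales (use m J in auto)
  have "graph_hom (underlying_graph I.M) (underlying_graph J.M)"
    by (rule map_hom_graph_hom[OF I.is_map_rotation_map J.is_map_rotation_map
          J.chain_crosses[OF J(2)] hom])
  then obtain fv fe where "fv ` gverts (underlying_graph I.M) \<subseteq> gverts (underlying_graph J.M)"
    and "fe ` gedges (underlying_graph I.M) \<subseteq> gedges (underlying_graph J.M)"
    and "\<forall>e\<in>gedges (underlying_graph I.M).
      gends (underlying_graph J.M) (fe e) = fv ` gends (underlying_graph I.M) e"
    unfolding graph_hom_def by (elim exE conjE) (rule that)
  then obtain \<phi> where \<phi>: "\<forall>u\<in>I.V. \<phi> u \<in> J.V \<and>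
      fv (Inl (I.vcode u)) = Inl (J.vcode (\<phi> u)) \<and> (\<forall>v\<in>set (I.rot u). \<phi> v \<in> set (J.rot (\<phi> u)))"
    using graph_hom_on_vertices[OF I.rotation_system_axioms J.rotation_system_axioms, of fv fe]
    by blast
  show ?thesis
    by (rule chain_map_hom_rigid(1)[OF m(2) I _ _ m(1), of \<phi>]) (use \<phi> in blast)+
qed

theorem theorem4p24:
  fixes n k :: nat
  assumes "even n" and "odd k" and "k \<ge> 3"
  shows "\<exists>(B :: nat cmap) (A :: nat \<Rightarrow> nat cmap).
    is_map B \<and> plane B \<and> (\<forall>i\<in>{1..n}. is_map (A i) \<and> plane (A i)) \<and>
    (\<forall>i\<in>{1..n}. graph_core (underlying_graph (A i))) \<and> map_core B \<and>
    odd_girth (underlying_graph B) = enat (2 * k + 1) \<and>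
    (\<forall>i\<in>{1..n}. odd_girth (underlying_graph (A i)) = enat (2 * k + 1)) \<and>
    (\<forall>i\<in>{1..n}. map_hom (A i) B) \<and>
    (\<forall>i\<in>{1..n}. \<forall>j\<in>{1..n}. i \<noteq> j \<longrightarrow> \<not> map_hom (A i) (A j))"
proof -
  \<comment> \<open>\<open>m + 2\<close> is the required odd girth. The extra chain
    \<open>n + 1\<close> keeps the index set of \<open>B\<close> nonempty, so that \<open>B\<close>
    contains an odd cycle even for \<open>n = 0\<close>.\<close>
  define m N where "m = 2 * k - 1" and "N = Suc n"
  have mk: "5 \<le> m" "odd m" "m + 2 = 2 * k + 1" using assms(3) by (simp_all add: m_def)
  define X where "X I = rotation_map (chain_verts m N I) (chain_rot m N)" for I
  have props: "is_map (X I)" "plane (X I)" "isol (X I) = 0" "graph_core (underlying_graph (X I))"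
    "odd_girth (underlying_graph (X I)) = enat (2 * k + 1)" if I: "I \<subseteq> {1..N}" "I \<noteq> {}" for I
  proof -
    interpret chain_map m N I by unfold_locales (use mk I finite_subset in auto)
    show "is_map (X I)" unfolding X_def by (rule is_map_rotation_map)
    show "plane (X I)" unfolding X_def by (rule chain_plane)
    show "isol (X I) = 0" unfolding X_def by (rule rotation_map_simps)
    show "graph_core (underlying_graph (X I))" unfolding X_def by (rule chain_graph_core[OF mk(2) I(1)])
    show "odd_girth (underlying_graph (X I)) = enat (2 * k + 1)"
      using chain_odd_girth[OF mk(2) I(2)] unfolding X_def mk(3) .
  qed
  have sub: "{i} \<subseteq> {1..N}" "{i} \<noteq> {}" if "i \<in> {1..n}" for i using that by (auto simp: N_def)
  have all: "{1..N} \<subseteq> {1..N}" "{1..N} \<noteq> {}" by (auto simp: N_def)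
  have core: "map_core (X {1..N})" by (rule map_core_if_graph_core[OF props(1,3,4)[OF all]])
  have hom: "map_hom (X {i}) (X {1..N})" if i: "i \<in> {1..n}" for i
  proof (rule submap_map_hom[OF _ props(2)[OF sub[OF i]] props(2)[OF all]])
    interpret chain_map m N "{1..N}" by unfold_locales (use mk in auto)
    show "submap (X {i}) (X {1..N})" unfolding X_def by (rule chain_submap[OF sub(1)[OF i]])
  qed
  have no_hom: "\<not> map_hom (X {i}) (X {j})" if i: "i \<in> {1..n}" and "i \<noteq> j" for i j
  proof
    assume "map_hom (X {i}) (X {j})"
    then have "{i} \<subseteq> {j}"
      unfolding X_def using chain_no_map_hom[OF mk(1,2) sub(1)[OF i], of "{j}"] by simp
    then show False using \<open>i \<noteq> j\<close> by simp
  qed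
  show ?thesis
    by (intro exI[of _ "X {1..N}"] exI[of _ "\<lambda>i. X {i}"] conjI ballI impI
        props(1,2,5)[OF all] props(1,2,4,5)[OF sub] core hom no_hom)
qed

end
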